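(* Let $p>2$ be a prime, $\mathbf{F}$ a field of characteristic $p$, and $M\in\mathbf{F}^{2\times4}$. If $\gamma_{1234}(M)\neq0$, $\gamma_{1235}(M)\neq0$ and $\gamma_{1357}(M)=0$, then, with $\widehat{f_1},h_2,h_3$ and $N_M(z)$ as defined in the context, the set $\mathcal B:=\{x,\widehat{f_1},h_2,h_3,N_M(z)\}$ is a SAGBI basis for $\mathbf{F}[V_M]^E$. Furthermore, $\mathbf{F}[V_M]^E$ is a complete intersection with generating relations coming from the subduction of the têtes-à-têtes $(h_2^p,\widehat{f_1}^{p+2})$ and $(h_3^p,\widehat{f_1}^{(p^2-2p-1)/2}h_2^{(p^2+1)/2})$.
   Context: For $M=(c_{ij})\in\mathbf{F}^{2\times4}$, $E=\langle e_1,e_2,e_3,e_4\rangle\cong(\mathbf{Z}/p)^4$ acts on $\mathbf{F}[V_M]=\mathbf{F}[x,y,z]$ (on the right, by algebra automorphisms) by $x\cdot e_j=x$, $y\cdot e_j=y+c_{1j}x$, $z\cdot e_j=z+2c_{1j}y+(c_{1j}^2+c_{2j})x$; $\mathbf{F}[V_M]^E$ is the ring of invariants. For $f\in\mathbf{F}[V_M]$, $N_M(f)$ is the product of the distinct elements of the $E$-orbit of $f$. Minors: $\Gamma(M)$ is the $10\times4$ matrix whose row $2k+1$ is $(c_{11}^{p^k},\dots,c_{14}^{p^k})$ and whose row $2k+2$ is $(c_{21}^{p^k},\dots,c_{24}^{p^k})$, $k=0,\dots,4$; $\gamma_{ijk\ell}(M)$ is its $4\times4$ minor with rows $i,j,k,\ell$,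 written $\bar\gamma_{ijk\ell}$. Put $\delta:=y^2-xz$, $\alpha_2=-\bar\gamma_{1237}/\bar\gamma_{1235}$, $\alpha_1=\bar\gamma_{1257}/\bar\gamma_{1235}$, $\alpha_0=\bar\gamma_{2357}/\bar\gamma_{1235}$, $\beta_3=\bar\gamma_{1235}/\bar\gamma_{1234}$, $\beta_2=\bar\gamma_{1245}/\bar\gamma_{1234}$, $\beta_1=\bar\gamma_{1345}/\bar\gamma_{1234}$, $\beta_0=\bar\gamma_{2345}/\bar\gamma_{1234}$. Under the hypotheses of the claim, $\bar\gamma_{2357}\neq0$ and $N_M(y)=y^{p^3}+\alpha_2y^{p^2}x^{p^3-p^2}+\alpha_1y^px^{p^3-p}+\alpha_0yx^{p^3-1}$, and one defines $$\widehat{f_1}:=y^{p^2}+\beta_3\delta^px^{p^2-2p}+\beta_2y^px^{p^2-p}+\beta_1\delta x^{p^2-2}+\beta_0yx^{p^2-1},$$ $$\widetilde{h_2}:=N_M(y)-\widehat{f_1}^p+\beta_3^px^{p^3-2p^2}\widehat{f_1}^2,\qquad h_2:=\frac{\widetilde{h_2}}{2\beta_3^{p+1}x^{p^3-p^2-2p}}.$$ For $p\ge5$, $$\widetilde{h_3}:=h_2^p-\widehat{f_1}^{p+2}+2\beta_3\widehat{f_1}^ph_2x^{p^2-2p}-\beta_3^{-p}\left(\alpha_2\widehat{f_1}^{p+1}x^{p^2}-\alpha_2\beta_3\widehat{f_1}^{p-1}h_2x^{2p^2-2p}+\alpha_1\widehat{f_1}^{(p-3)/2}h_2^{(p+1)/2}x^{2p^2-p}\right),$$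 and for $p=3$, $$\widetilde{h_3}:=h_2^3-\widehat{f_1}^5+2\beta_3\widehat{f_1}^3h_2x^3-\left(\alpha_2\beta_3^{-3}+\beta_3^3\right)\left(\widehat{f_1}^4x^9-\beta_3\widehat{f_1}^2h_2x^{12}\right)-\left(\alpha_1\beta_3^{-3}+\alpha_2\beta_3^{-1}+\beta_3^5\right)h_2^2x^{15}.$$ Finally $h_3:=\bar\gamma_{1235}^{p+1}\widetilde{h_3}/(x^{2p^2-1}\bar\gamma_{2357}\bar\gamma_{1234}^p)$. These are elements of $\mathbf{F}[V_M]^E$ with lead terms $y^{p^2}$, $y^{p^2+2p}$, $y^{p^3+1}$ for $\widehat{f_1},h_2,h_3$ respectively. Conventions: graded reverse lexicographic order with $x<y<z$; $\mathrm{LM}$, $\mathrm{LT}$ denote lead monomial and lead term (with coefficient). A finite subset $\mathcal B=\{b_1,\dots,b_m\}$ of a subalgebra $A$ of a polynomial ring is a SAGBI basis for $A$ if the monomials $\mathrm{LM}(b_i)$ generate the algebra spanned by the lead monomials of the elements of $A$. A tête-à-tête is a pair $(b^I,b^J)$ of products of elements of $\mathcal B$ with $\mathrm{LM}(b^I)=\mathrm{LM}(b^J)$. Its subduction: choose a scalar $c$ with $\mathrm{LT}(b^I)=\mathrm{LT}(cb^J)$ and repeatedly cancel the lead term of $b^I-cb^J$ by scalar multiples of products of elements of $\mathcal B$; if this ends at zero, it expresses $b^I-cb^J$ as a polynomial in $\mathcal B$, giving a relation. "Generating relations coming from the subduction of" given têtes-à-têtes means that the kernel of the surjection from the polynomial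 ring on $m$ variables sending the variables to $b_1,\dots,b_m$ is generated by the relations so obtained. A complete intersection is an algebra having a presentation whose ideal of relations is generated by a regular sequence. *)

theory Defs
  imports "HOL-Analysis.Analysis" "HOL-Library.Poly_Mapping"
begin

section \<open>Multivariate polynomials\<close>

type_synonym ('v, 'a) mpoly = "('v \<Rightarrow>\<^sub>0 nat) \<Rightarrow>\<^sub>0 'a"

abbreviation keys :: "('v \<Rightarrow>\<^sub>0 'a::zero) \<Rightarrow> 'v set" where "keys \<equiv> Poly_Mapping.keys"
abbreviation lookup :: "('v \<Rightarrow>\<^sub>0 'a::zero) \<Rightarrow> 'v \<Rightarrow> 'a" where "lookup \<equiv> Poly_Mapping.lookup"

definition Const :: "'a \<Rightarrow> ('v, 'a::zero) mpoly" where
  "Const c = Poly_Mapping.single 0 c"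

definition Mon :: "('v \<Rightarrow>\<^sub>0 nat) \<Rightarrow> ('v, 'a::zero_neq_one) mpoly" where
  "Mon m = Poly_Mapping.single m 1"

definition Var :: "'v \<Rightarrow> ('v, 'a::zero_neq_one) mpoly" where
  "Var v = Mon (Poly_Mapping.single v 1)"

text \<open>The algebra homomorphism sending each variable \<open>v\<close> to \<open>\<phi> v\<close>.\<close>

definition subst :: "('v \<Rightarrow> ('w, 'a::comm_ring_1) mpoly) \<Rightarrow> ('v, 'a) mpoly \<Rightarrow> ('w, 'a) mpoly" where
  "subst \<phi> f = (\<Sum>m\<in>keys f. Const (lookup f m) * (\<Prod>v\<in>keys m. \<phi> v ^ lookup m v))"

text \<open>\<open>exact_quot f g\<close> is meaningful only when \<open>g\<close> is nonzero and divides \<open>f\<close>.\<close>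

definition exact_quot :: "('v, 'a::comm_ring_1) mpoly \<Rightarrow> ('v, 'a) mpoly \<Rightarrow> ('v, 'a) mpoly" where
  "exact_quot f g = (THE q. f = q * g)"

global_interpretation mp: vector_space "\<lambda>c (f :: ('v, 'a::field) mpoly). Const c * f"
  by unfold_locales (simp_all add: Const_def algebra_simps mult_single single_add flip: mult.assoc)

definition subalgebra :: "('v, 'a::field) mpoly set \<Rightarrow> bool" where
  "subalgebra A \<longleftrightarrow> range Const \<subseteq> A \<and> (\<forall>f\<in>A. \<forall>g\<in>A. f + g \<in> A \<and> f * g \<in> A)"


section \<open>Lead terms in \<open>F[x,y,z]\<close> and SAGBI bases\<close>

datatype xyz = VX | VY | VZ

abbreviation X :: "(xyz, 'a::zero_neq_one) mpoly" where "X \<equiv> Var VX"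
abbreviation Y :: "(xyz, 'a::zero_neq_one) mpoly" where "Y \<equiv> Var VY"
abbreviation Z :: "(xyz, 'a::zero_neq_one) mpoly" where "Z \<equiv> Var VZ"

definition mdeg :: "(xyz \<Rightarrow>\<^sub>0 nat) \<Rightarrow> nat" where
  "mdeg m = lookup m VX + lookup m VY + lookup m VZ"

text \<open>Graded reverse lexicographic order with \<open>x < y < z\<close>: in equal degree, the monomial with
  the larger exponent at the smallest variable where the exponents differ is the smaller one.\<close>

definition grevlex_less :: "(xyz \<Rightarrow>\<^sub>0 nat) \<Rightarrow> (xyz \<Rightarrow>\<^sub>0 nat) \<Rightarrow> bool" where
  "grevlex_less m n \<longleftrightarrow> mdeg m < mdeg n \<or> mdeg m = mdeg n \<and>
     (lookup m VX > lookup n VX \<or> lookup m VX = lookup n VX \<and> lookup m VY > lookup n VY)"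

text \<open>\<open>lead_mon f\<close> is the exponent of \<open>LM(f)\<close>; it is meaningful only for nonzero \<open>f\<close>.\<close>

definition lead_mon :: "(xyz, 'a::zero) mpoly \<Rightarrow> (xyz \<Rightarrow>\<^sub>0 nat)" where
  "lead_mon f = (THE m. m \<in> keys f \<and> (\<forall>n\<in>keys f. n = m \<or> grevlex_less n m))"

definition lead_term :: "(xyz, 'a::zero) mpoly \<Rightarrow> (xyz, 'a) mpoly" where
  "lead_term f = Poly_Mapping.single (lead_mon f) (lookup f (lead_mon f))"

definition LMs :: "(xyz, 'a::field) mpoly set \<Rightarrow> (xyz, 'a) mpoly set" where
  "LMs S = {Mon (lead_mon f) | f. f \<in> S \<and> f \<noteq> 0}"

definition sagbi_basis :: "(xyz, 'a::field) mpoly set \<Rightarrow> (xyz, 'a) mpoly set \<Rightarrow> bool" where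
  "sagbi_basis A B \<longleftrightarrow> finite B \<and> B \<subseteq> A \<and> subalgebra hull LMs B = mp.span (LMs A)"


section \<open>Presentations and complete intersections\<close>

text \<open>\<open>polyring n\<close> is the polynomial ring in the \<open>n\<close> variables \<open>0, \<dots>, n - 1\<close>.\<close>

definition polyring :: "nat \<Rightarrow> (nat, 'a::field) mpoly set" where
  "polyring n = {f. \<forall>m\<in>keys f. keys m \<subseteq> {..<n}}"

definition ideal_gen :: "'r::comm_ring_1 set \<Rightarrow> 'r list \<Rightarrow> 'r set" where
  "ideal_gen R rs = {\<Sum>i<length rs. c i * rs ! i | c. \<forall>i<length rs. c i \<in> R}"

definition regular_seq :: "'r::comm_ring_1 set \<Rightarrow> 'r list \<Rightarrow> bool" where
  "regular_seq R rs \<longleftrightarrow> set rs \<subseteq> R \<and> 1 \<notin> ideal_gen R rs \<and>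
     (\<forall>i<length rs. \<forall>f\<in>R. f * rs ! i \<in> ideal_gen R (take i rs) \<longrightarrow> f \<in> ideal_gen R (take i rs))"

text \<open>The generators \<open>bs\<close> and relations \<open>rs\<close> present the algebra \<open>A\<close> as a complete intersection.\<close>

definition ci_presentation ::
  "(xyz, 'a::field) mpoly set \<Rightarrow> (xyz, 'a) mpoly list \<Rightarrow> (nat, 'a) mpoly list \<Rightarrow> bool" where
  "ci_presentation A bs rs \<longleftrightarrow>
     subst ((!) bs) ` polyring (length bs) = A \<and>
     {f \<in> polyring (length bs). subst ((!) bs) f = 0} = ideal_gen (polyring (length bs)) rs \<and>
     regular_seq (polyring (length bs)) rs"

definition complete_intersection :: "(xyz, 'a::field) mpoly set \<Rightarrow> bool" where
  "complete_intersection A \<longleftrightarrow> (\<exists>bs rs. ci_presentation A bs rs)"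


section \<open>Subduction of tete-a-tetes\<close>

text \<open>\<open>gens_pow bs K\<close> is the product \<open>b\<^sup>K\<close>, for exponents \<open>K\<close> supported on \<open>{..<length bs}\<close>.\<close>

definition gens_pow :: "(xyz, 'a::field) mpoly list \<Rightarrow> (nat \<Rightarrow>\<^sub>0 nat) \<Rightarrow> (xyz, 'a) mpoly" where
  "gens_pow bs K = (\<Prod>i<length bs. (bs ! i) ^ lookup K i)"

text \<open>\<open>subducts bs f P\<close>: some run of the subduction of \<open>f\<close> ends at zero, and \<open>P\<close> is the sum of the
  scaled monomials in the generators that it has subtracted, so that \<open>f\<close> is \<open>P\<close> evaluated at \<open>bs\<close>.\<close>

inductive subducts :: "(xyz, 'a::field) mpoly list \<Rightarrow> (xyz, 'a) mpoly \<Rightarrow> (nat, 'a) mpoly \<Rightarrow> bool"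
  for bs where
  zero: "subducts bs 0 0"
| step: "subducts bs f (Const d * Mon K + P)"
    if "f \<noteq> 0" and "keys K \<subseteq> {..<length bs}"
      and "lead_term f = lead_term (Const d * gens_pow bs K)"
      and "subducts bs (f - Const d * gens_pow bs K) P"

definition tete_a_tete ::
  "(xyz, 'a::field) mpoly list \<Rightarrow> (nat \<Rightarrow>\<^sub>0 nat) \<Rightarrow> (nat \<Rightarrow>\<^sub>0 nat) \<Rightarrow> bool" where
  "tete_a_tete bs I J \<longleftrightarrow> keys I \<subseteq> {..<length bs} \<and> keys J \<subseteq> {..<length bs} \<and>
     lead_mon (gens_pow bs I) = lead_mon (gens_pow bs J)"

text \<open>\<open>r\<close> is a relation obtained from a subduction to zero of the tete-a-tete \<open>(b\<^sup>I, b\<^sup>J)\<close>.\<close>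

definition tete_relation ::
  "(xyz, 'a::field) mpoly list \<Rightarrow> (nat \<Rightarrow>\<^sub>0 nat) \<Rightarrow> (nat \<Rightarrow>\<^sub>0 nat) \<Rightarrow> (nat, 'a) mpoly \<Rightarrow> bool" where
  "tete_relation bs I J r \<longleftrightarrow> tete_a_tete bs I J \<and>
     (\<exists>c P. lead_term (gens_pow bs I) = lead_term (Const c * gens_pow bs J) \<and>
        subducts bs (gens_pow bs I - Const c * gens_pow bs J) P \<and>
        r = Mon I - Const c * Mon J - P)"


section \<open>The action of \<open>E = (Z/p)\<^sup>4\<close>\<close>

definition act_gen :: "'a::field^4^2 \<Rightarrow> 4 \<Rightarrow> (xyz, 'a) mpoly \<Rightarrow> (xyz, 'a) mpoly" where
  "act_gen M j = subst (\<lambda>v. case v of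
       VX \<Rightarrow> X
     | VY \<Rightarrow> Y + Const (M$1$j) * X
     | VZ \<Rightarrow> Z + Const (2 * M$1$j) * Y + Const ((M$1$j)\<^sup>2 + M$2$j) * X)"

text \<open>The group element \<open>e\<^sub>1\<^sup>a\<^sup>1 e\<^sub>2\<^sup>a\<^sup>2 e\<^sub>3\<^sup>a\<^sup>3 e\<^sub>4\<^sup>a\<^sup>4\<close> of \<open>E\<close>, with exponents taken in \<open>{0..<p}\<close>, acting on
  the right.\<close>

definition act :: "'a::field^4^2 \<Rightarrow> (4 \<Rightarrow> nat) \<Rightarrow> (xyz, 'a) mpoly \<Rightarrow> (xyz, 'a) mpoly" where
  "act M a = (act_gen M 4 ^^ a 4) \<circ> (act_gen M 3 ^^ a 3) \<circ> (act_gen M 2 ^^ a 2) \<circ> (act_gen M 1 ^^ a 1)"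

definition E_exps :: "nat \<Rightarrow> (4 \<Rightarrow> nat) set" where
  "E_exps p = {a. \<forall>j. a j < p}"

definition invariants :: "nat \<Rightarrow> 'a::field^4^2 \<Rightarrow> (xyz, 'a) mpoly set" where
  "invariants p M = {f. \<forall>a\<in>E_exps p. act M a f = f}"

definition orbit_norm :: "nat \<Rightarrow> 'a::field^4^2 \<Rightarrow> (xyz, 'a) mpoly \<Rightarrow> (xyz, 'a) mpoly" where
  "orbit_norm p M f = (\<Prod>g\<in>(\<lambda>a. act M a f) ` E_exps p. g)"


section \<open>The minors and the invariants built from them\<close>

text \<open>Row \<open>r \<in> {1..10}\<close> of the matrix \<open>\<Gamma>(M)\<close>.\<close>

definition Gamma_row :: "nat \<Rightarrow> 'a::field^4^2 \<Rightarrow> nat \<Rightarrow> 'a^4" where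
  "Gamma_row p M r = (\<chi> j. (M $ (if odd r then 1 else 2) $ j) ^ (p ^ ((r - 1) div 2)))"

definition minor :: "nat \<Rightarrow> 'a::field^4^2 \<Rightarrow> nat \<Rightarrow> nat \<Rightarrow> nat \<Rightarrow> nat \<Rightarrow> 'a" where
  "minor p M i j k l =
     det (vector [Gamma_row p M i, Gamma_row p M j, Gamma_row p M k, Gamma_row p M l] :: 'a^4^4)"

definition delta :: "(xyz, 'a::field) mpoly" where
  "delta = Y\<^sup>2 - X * Z"

definition alpha0 :: "nat \<Rightarrow> 'a::field^4^2 \<Rightarrow> 'a" where
  "alpha0 p M = minor p M 2 3 5 7 / minor p M 1 2 3 5"
definition alpha1 :: "nat \<Rightarrow> 'a::field^4^2 \<Rightarrow> 'a" where
  "alpha1 p M = minor p M 1 2 5 7 / minor p M 1 2 3 5"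
definition alpha2 :: "nat \<Rightarrow> 'a::field^4^2 \<Rightarrow> 'a" where
  "alpha2 p M = - minor p M 1 2 3 7 / minor p M 1 2 3 5"

definition beta0 :: "nat \<Rightarrow> 'a::field^4^2 \<Rightarrow> 'a" where
  "beta0 p M = minor p M 2 3 4 5 / minor p M 1 2 3 4"
definition beta1 :: "nat \<Rightarrow> 'a::field^4^2 \<Rightarrow> 'a" where
  "beta1 p M = minor p M 1 3 4 5 / minor p M 1 2 3 4"
definition beta2 :: "nat \<Rightarrow> 'a::field^4^2 \<Rightarrow> 'a" where
  "beta2 p M = minor p M 1 2 4 5 / minor p M 1 2 3 4"
definition beta3 :: "nat \<Rightarrow> 'a::field^4^2 \<Rightarrow> 'a" where
  "beta3 p M = minor p M 1 2 3 5 / minor p M 1 2 3 4"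

definition f1_hat :: "nat \<Rightarrow> 'a::field^4^2 \<Rightarrow> (xyz, 'a) mpoly" where
  "f1_hat p M = Y ^ p\<^sup>2
     + Const (beta3 p M) * delta ^ p * X ^ (p\<^sup>2 - 2 * p)
     + Const (beta2 p M) * Y ^ p * X ^ (p\<^sup>2 - p)
     + Const (beta1 p M) * delta * X ^ (p\<^sup>2 - 2)
     + Const (beta0 p M) * Y * X ^ (p\<^sup>2 - 1)"

definition h2_tilde :: "nat \<Rightarrow> 'a::field^4^2 \<Rightarrow> (xyz, 'a) mpoly" where
  "h2_tilde p M = orbit_norm p M Y - f1_hat p M ^ p
     + Const (beta3 p M ^ p) * X ^ (p ^ 3 - 2 * p\<^sup>2) * (f1_hat p M)\<^sup>2"

definition h2 :: "nat \<Rightarrow> 'a::field^4^2 \<Rightarrow> (xyz, 'a) mpoly" where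
  "h2 p M = exact_quot (h2_tilde p M)
     (Const (2 * beta3 p M ^ (p + 1)) * X ^ (p ^ 3 - p\<^sup>2 - 2 * p))"

definition h3_tilde :: "nat \<Rightarrow> 'a::field^4^2 \<Rightarrow> (xyz, 'a) mpoly" where
  "h3_tilde p M =
    (let f = f1_hat p M; h = h2 p M; b = beta3 p M; a1 = alpha1 p M; a2 = alpha2 p M in
     if p = 3 then
       h ^ 3 - f ^ 5 + Const (2 * b) * f ^ 3 * h * X ^ 3
       - Const (a2 / b ^ 3 + b ^ 3) * (f ^ 4 * X ^ 9 - Const b * f\<^sup>2 * h * X ^ 12)
       - Const (a1 / b ^ 3 + a2 / b + b ^ 5) * h\<^sup>2 * X ^ 15
     else
       h ^ p - f ^ (p + 2) + Const (2 * b) * f ^ p * h * X ^ (p\<^sup>2 - 2 * p)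
       - Const (1 / b ^ p) *
           (Const a2 * f ^ (p + 1) * X ^ p\<^sup>2
            - Const (a2 * b) * f ^ (p - 1) * h * X ^ (2 * p\<^sup>2 - 2 * p)
            + Const a1 * f ^ ((p - 3) div 2) * h ^ ((p + 1) div 2) * X ^ (2 * p\<^sup>2 - p)))"

definition h3 :: "nat \<Rightarrow> 'a::field^4^2 \<Rightarrow> (xyz, 'a) mpoly" where
  "h3 p M = exact_quot (Const (minor p M 1 2 3 5 ^ (p + 1)) * h3_tilde p M)
     (X ^ (2 * p\<^sup>2 - 1) * Const (minor p M 2 3 5 7 * minor p M 1 2 3 4 ^ p))"

end

theory Submission
  imports Defs
begin

text \<open>In the coordinates \<open>y\<close> and \<open>\<delta>\<close> the group acts by the translations \<open>y \<mapsto> y + u x\<close>,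
  \<open>\<delta> \<mapsto> \<delta> - v x\<^sup>2\<close>. The hypothesis on \<open>\<gamma>\<^sub>1\<^sub>3\<^sub>5\<^sub>7\<close> makes the values \<open>u\<close> an \<open>F\<^sub>p\<close>-space of order
  \<open>p\<^sup>3\<close> over each point of which lie \<open>p\<close> values of \<open>v\<close>. After inverting \<open>x\<close> the polynomial ring is
  free over \<open>F[x, f\<^sub>1, N(y)]\<close> on the \<open>y\<^sup>i \<delta>\<^sup>j\<close> with \<open>i < p\<^sup>3\<close>, \<open>j < p\<close>, and counting roots shows that the
  invariants become \<open>F[x, x\<^sup>-\<^sup>1, f\<^sub>1, h\<^sub>2]\<close>. Let \<open>A\<close> be the span of the monomials in \<open>x\<close>, \<open>f\<^sub>1\<close>, \<open>h\<^sub>2\<close>, \<open>h\<^sub>3\<close>,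
  \<open>N(z)\<close> with exponents of \<open>h\<^sub>2\<close> and \<open>h\<^sub>3\<close> less than \<open>p\<close>. Their lead monomials are distinct, and the
  power of \<open>x\<close> in a lead monomial is the power of \<open>x\<close> dividing the element, so \<open>x g \<in> A\<close> implies
  \<open>g \<in> A\<close>. Up to powers of \<open>x\<close>, \<open>h\<^sub>3\<close> is monic of degree \<open>p\<close> in \<open>h\<^sub>2\<close>, and a weight argument shows that \<open>N(z)\<close>
  is monic of degree \<open>p\<^sup>2\<close> in \<open>h\<^sub>2\<close>, hence of degree \<open>p\<close> in \<open>h\<^sub>3\<close>. This rewrites \<open>h\<^sub>3\<^sup>p\<close>, so \<open>A\<close> is a ring
  and equals the ring of invariants; no explicit form of the second relation is needed. Finally, for a suitable order
  the two relations have the coprime lead monomials \<open>h\<^sub>2\<^sup>p\<close> and \<open>h\<^sub>3\<^sup>p\<close>, so division with remainder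
  gives the presentation and the regularity of the sequence.\<close>

text \<open>The hypothesis on \<open>minor p M 1 3 5 7\<close> removes the second row of
  \<open>M\<close> from Cramer's expansion of row 7 of the matrix of minors, so each value
  \<open>u\<close> is a root of an additive polynomial of degree p^3. Row 5 then gives, for fixed
  \<open>u\<close>, an equation of degree p in \<open>v\<close>. There are p^4 distinct pairs, so
  both bounds are attained; the same count forces \<open>alpha0\<close> to be nonzero, without which
  \<open>h3\<close> could not be normalised. All divisions by powers of x rest on writing f1 as
  y^(p^2) + x^q eps with q = p^2 - 2p and on the additivity of p-th powers. For p = 3 the exponent q
  is so small that terms negligible for larger p survive, hence the separate formula for
  \<open>h3_tilde\<close>. The obstacle is h3^p: rewriting it seems to require the ring structure of
  A, which in turn requires rewriting h3^p. The way out is that polynomials of degree below p^2 in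
  h2 reduce into A without ever producing h3^p, so N(z) can be compared with h3^p first. The weight
  is needed because the graded order sees f1, h2 and h3 only as powers of y, while by weight h2 is
  led by x^(2p) z^(p^2).\<close>

type_synonym 'a xpoly = "(xyz, 'a) mpoly"

text \<open>Linearly ordered variables make the exponents a linearly ordered monoid, and polynomials
  over a field with such exponents have no zero divisors; all cancellations below rely on this. The
  monomial order of the theorem is the separately defined \<open>grevlex_less\<close>.\<close>

instantiation xyz :: linorder
begin

definition rank_xyz :: "xyz \<Rightarrow> nat" where
  "rank_xyz v = (case v of VX \<Rightarrow> 0 | VY \<Rightarrow> 1 | VZ \<Rightarrow> 2)"

definition less_eq_xyz :: "xyz \<Rightarrow> xyz \<Rightarrow> bool" where
  "less_eq_xyz v w \<longleftrightarrow> rank_xyz v \<le> rank_xyz w"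

definition less_xyz :: "xyz \<Rightarrow> xyz \<Rightarrow> bool" where
  "less_xyz v w \<longleftrightarrow> rank_xyz v < rank_xyz w"

instance
  by standard (auto simp: less_eq_xyz_def less_xyz_def rank_xyz_def split: xyz.splits)

end

section \<open>The characteristic of a polynomial ring\<close>

lemma of_nat_poly_mapping_eq_0_iff:
  "(of_nat n :: 'v::monoid_add \<Rightarrow>\<^sub>0 'a::semiring_1) = 0 \<longleftrightarrow> (of_nat n :: 'a) = 0"
proof
  assume "(of_nat n :: 'v \<Rightarrow>\<^sub>0 'a) = 0"
  then have "lookup (of_nat n :: 'v \<Rightarrow>\<^sub>0 'a) 0 = 0" by simp
  then show "(of_nat n :: 'a) = 0" by (simp add: lookup_of_nat)
next
  assume "(of_nat n :: 'a) = 0"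
  then have "Poly_Mapping.single 0 (of_nat n :: 'a) = (0 :: 'v \<Rightarrow>\<^sub>0 'a)" by simp
  then show "(of_nat n :: 'v \<Rightarrow>\<^sub>0 'a) = 0" by (simp only: single_of_nat)
qed

text \<open>Transfers the prime characteristic to F[x,y,z], so that p-th powers are additive there
  as well as in the field.\<close>

lemma CHAR_poly_mapping [simp]:
  "CHAR('v::monoid_add \<Rightarrow>\<^sub>0 'a::semiring_1) = CHAR('a)"
  by (rule CHAR_eqI) (simp_all add: of_nat_poly_mapping_eq_0_iff of_nat_eq_0_iff_char_dvd)

subsection \<open>Polynomial arithmetic\<close>

lemma Const_0 [simp]: "Const 0 = 0"
  by (simp add: Const_def)

lemma Const_1 [simp]: "Const 1 = 1"
  by (simp add: Const_def)

lemma Const_add: "Const (c + d) = Const c + Const d" for c d :: "'a::monoid_add"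
  by (simp add: Const_def single_add)

lemma Const_uminus: "Const (- c) = - Const c" for c :: "'a::ab_group_add"
  by (simp add: Const_def single_uminus)

lemma Const_diff: "Const (c - d) = Const c - Const d" for c d :: "'a::ab_group_add"
  by (simp add: Const_def single_diff)

lemma Const_mult: "Const (c * d) = Const c * Const d" for c d :: "'a::semiring_0"
  by (simp add: Const_def mult_single)

lemma Const_power: "Const (c ^ n) = Const c ^ n" for c :: "'a::semiring_1"
  by (induction n) (simp_all add: Const_mult)

lemma Const_numeral: "Const (numeral n) = numeral n"
  by (simp add: Const_def)

lemma Const_eq_iff [simp]: "Const c = Const d \<longleftrightarrow> c = d"
  unfolding Const_def by (metis lookup_single_eq)

lemma Const_eq_0_iff [simp]: "Const c = 0 \<longleftrightarrow> c = 0"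
  using Const_eq_iff[of c 0] by (simp del: Const_eq_iff)

lemmas Const_hom = Const_add Const_uminus Const_diff Const_mult Const_power Const_numeral

lemma Mon_0 [simp]: "Mon 0 = 1"
  by (simp add: Mon_def)

lemma Mon_add: "Mon (m + n) = Mon m * (Mon n :: ('v, 'a::{semiring_0,zero_neq_one,semiring_1}) mpoly)"
  by (simp add: Mon_def mult_single)

lemma Const_mult_Mon: "Const c * Mon m = Poly_Mapping.single m (c :: 'a::{zero_neq_one,semiring_1})"
  by (simp add: Const_def Mon_def mult_single)

lemma lookup_Const_mult [simp]: "lookup (Const c * f) m = c * lookup f m"
  for c :: "'a::semiring_0"
proof -
  have "Const c * f = Poly_Mapping.map ((*) c) f"
    by (simp add: Const_def mult_map_scale_conv_mult)
  then show ?thesis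
    by (simp add: Poly_Mapping.map.rep_eq when_def)
qed

lemma in_keys_addD: "k \<in> keys (f + g) \<Longrightarrow> k \<in> keys f \<or> k \<in> keys g"
  using Poly_Mapping.keys_add[of f g] by blast

lemma in_keys_multE:
  assumes "k \<in> keys (f * g)"
  obtains a b where "k = a + b" "a \<in> keys f" "b \<in> keys g"
  using keys_mult[of f g] assms by blast

lemma in_keys_sumE:
  assumes "k \<in> keys (\<Sum>i\<in>I. f i)"
  obtains i where "i \<in> I" "k \<in> keys (f i)"
  using Poly_Mapping.keys_sum[of f I] assms by blast

lemma keys_Const_mult: "c \<noteq> 0 \<Longrightarrow> keys (Const c * f) = keys f" for c :: "'a::field"
  by (rule set_eqI) (simp add: in_keys_iff)

lemma keys_Mon [simp]: "keys (Mon m :: ('v, 'a::zero_neq_one) mpoly) = {m}"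
  by (simp add: Mon_def)

lemma poly_mapping_sum_single: "f = (\<Sum>m\<in>keys f. Poly_Mapping.single m (lookup f m))"
proof (rule poly_mapping_eqI)
  fix k
  have "(\<Sum>m\<in>keys f. lookup (Poly_Mapping.single m (lookup f m)) k)
      = (\<Sum>m\<in>keys f. if m = k then lookup f k else 0)"
    by (rule sum.cong) (simp_all add: lookup_single when_def)
  then show "lookup f k = lookup (\<Sum>m\<in>keys f. Poly_Mapping.single m (lookup f m)) k"
    by (simp add: lookup_sum in_keys_iff)
qed

lemma mpoly_sum_Mon: "f = (\<Sum>m\<in>keys f. Const (lookup f m) * Mon m)" for f :: "('v, 'a::comm_ring_1) mpoly"
  using poly_mapping_sum_single[of f] by (simp add: Const_mult_Mon)

lemma Mon_eq_prod_Var: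
  "Mon m = (\<Prod>v\<in>keys m. Var v ^ lookup m v :: ('v, 'a::comm_ring_1) mpoly)"
proof -
  have pow: "Var v ^ n = (Mon (Poly_Mapping.single v n) :: ('v, 'a) mpoly)" for v n
    by (induction n) (simp_all add: Var_def Mon_add[symmetric] single_add[symmetric])
  have "Mon (\<Sum>v\<in>A. g v) = (\<Prod>v\<in>A. Mon (g v) :: ('v, 'a) mpoly)" for A and g :: "'v \<Rightarrow> 'v \<Rightarrow>\<^sub>0 nat"
    by (induction A rule: infinite_finite_induct) (simp_all add: Mon_add)
  then show ?thesis
    using poly_mapping_sum_single[of m] by (metis (no_types, lifting) pow prod.cong)
qed

lemma mpoly_induct [case_names Const add Var]:
  fixes f :: "('v, 'a::comm_ring_1) mpoly"
  assumes "\<And>c. P (Const c)" and "\<And>f g. P f \<Longrightarrow> P g \<Longrightarrow> P (f + g)" and "\<And>v f. P f \<Longrightarrow> P (Var v * f)"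
  shows "P f"
proof -
  have pow: "P (Var v ^ n * g)" if "P g" for v n g
    using that by (induction n) (simp_all add: assms(3) mult.assoc)
  have prod: "P (Const c * (\<Prod>v\<in>A. Var v ^ e v))" for c e and A :: "'v set"
  proof (induction A rule: infinite_finite_induct)
    case (insert v A)
    from pow[OF insert.IH, of v "e v"] show ?case
      using insert.hyps by (simp add: mult_ac)
  qed (simp_all add: assms(1))
  have "P (\<Sum>m\<in>S. Const (lookup f m) * Mon m)" if "finite S" for S
    using that
  proof induction
    case empty
    then show ?case using assms(1)[of 0] by simp
  next
    case (insert m S)
    then show ?case by (simp add: assms(2) prod Mon_eq_prod_Var)
  qed
  from this[OF finite_keys[of f]] show ?thesis
    by (simp flip: mpoly_sum_Mon)
qed

subsection \<open>Substitution\<close>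

lemma subst_superset:
  assumes "finite S" and "keys f \<subseteq> S"
  shows "subst \<phi> f = (\<Sum>m\<in>S. Const (lookup f m) * (\<Prod>v\<in>keys m. \<phi> v ^ lookup m v))"
  unfolding subst_def using assms by (intro sum.mono_neutral_left) (auto simp: in_keys_iff)

lemma subst_add: "subst \<phi> (f + g) = subst \<phi> f + subst \<phi> g"
proof -
  let ?S = "keys f \<union> keys g"
  have "keys (f + g) \<subseteq> ?S" by (rule Poly_Mapping.keys_add)
  then show ?thesis
    by (simp add: subst_superset[of ?S] lookup_add Const_add distrib_right sum.distrib)
qed

lemma subst_0 [simp]: "subst \<phi> 0 = 0"
  by (simp add: subst_def)

lemma subst_sum: "subst \<phi> (\<Sum>i\<in>I. f i) = (\<Sum>i\<in>I. subst \<phi> (f i))"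
  by (induction I rule: infinite_finite_induct) (simp_all add: subst_add)

lemma subst_single:
  "subst \<phi> (Poly_Mapping.single m c) = Const c * (\<Prod>v\<in>keys m. \<phi> v ^ lookup m v)"
  by (cases "c = 0") (simp_all add: subst_def)

lemma subst_Const [simp]: "subst \<phi> (Const c) = Const c"
  by (subst (1) Const_def) (simp add: subst_single)

lemma subst_1 [simp]: "subst \<phi> 1 = 1"
  using subst_Const[of \<phi> 1] by simp

lemma subst_mult: "subst \<phi> (f * g) = subst \<phi> f * subst \<phi> g"
proof -
  let ?E = "\<lambda>m. \<Prod>v\<in>keys m. \<phi> v ^ lookup m v"
  have E: "?E m = (\<Prod>v\<in>S. \<phi> v ^ lookup m v)" if "finite S" "keys m \<subseteq> S" for m S
    using that by (intro prod.mono_neutral_left) (auto simp: in_keys_iff)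
  have E_add: "?E (m + n) = ?E m * ?E n" for m n
  proof -
    let ?S = "keys m \<union> keys n"
    have S: "finite ?S" "keys (m + n) \<subseteq> ?S" "keys m \<subseteq> ?S" "keys n \<subseteq> ?S"
      by (auto dest: subsetD[OF Poly_Mapping.keys_add])
    show ?thesis
      unfolding E[OF S(1,2)] E[OF S(1,3)] E[OF S(1,4)]
      by (simp add: lookup_add power_add prod.distrib)
  qed
  have single: "subst \<phi> (Poly_Mapping.single m c * Poly_Mapping.single n d)
      = subst \<phi> (Poly_Mapping.single m c) * subst \<phi> (Poly_Mapping.single n d)" for m n c d
    by (simp add: mult_single subst_single E_add Const_mult mult_ac)
  have "subst \<phi> ((\<Sum>m\<in>keys f. Poly_Mapping.single m (lookup f m)) *
          (\<Sum>n\<in>keys g. Poly_Mapping.single n (lookup g n)))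
      = subst \<phi> (\<Sum>m\<in>keys f. Poly_Mapping.single m (lookup f m)) *
        subst \<phi> (\<Sum>n\<in>keys g. Poly_Mapping.single n (lookup g n))"
    by (simp add: sum_product subst_sum single)
  then show ?thesis
    by (simp flip: poly_mapping_sum_single)
qed

lemma subst_Var [simp]: "subst \<phi> (Var v) = \<phi> v"
  by (simp add: Var_def Mon_def subst_single)

lemma subst_power: "subst \<phi> (f ^ n) = subst \<phi> f ^ n"
  by (induction n) (simp_all add: subst_mult)

lemma subst_uminus: "subst \<phi> (- f) = - subst \<phi> f"
  using subst_add[of \<phi> f "- f"] by (simp add: eq_neg_iff_add_eq_0 add.commute)

lemma subst_diff: "subst \<phi> (f - g) = subst \<phi> f - subst \<phi> g"
  using subst_add[of \<phi> f "- g"] by (simp add: subst_uminus)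

lemma subst_prod: "subst \<phi> (\<Prod>i\<in>I. f i) = (\<Prod>i\<in>I. subst \<phi> (f i))"
  by (induction I rule: infinite_finite_induct) (simp_all add: subst_mult)

lemma subst_subst: "subst \<phi> (subst \<psi> f) = subst (\<lambda>v. subst \<phi> (\<psi> v)) f"
  by (induction f rule: mpoly_induct) (simp_all add: subst_add subst_mult)

lemma subst_Var_id [simp]: "subst Var f = f"
  by (induction f rule: mpoly_induct) (simp_all add: subst_add subst_mult)

lemmas subst_hom = subst_add subst_mult subst_power subst_uminus subst_diff

subsection \<open>Spans and subalgebras\<close>

text \<open>The family \<open>b\<close> may repeat values on \<open>J\<close>. Passing to a subset
  on which it is injective lets the sum be indexed by exponents instead of polynomials, so that each
  summand keeps its own lead monomial.\<close>

lemma span_image_finite_sum: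
  assumes "g \<in> mp.span (b ` J)"
  obtains I c where "finite I" "I \<subseteq> J" "\<And>i. i \<in> I \<Longrightarrow> c i \<noteq> 0" "g = (\<Sum>i\<in>I. Const (c i) * b i)"
proof -
  obtain T where T: "T \<subseteq> J" "inj_on b T" "b ` T = b ` J"
    by (rule subset_image_inj[THEN iffD1, of "b ` J" b J, elim_format]) auto
  from assms have "g \<in> mp.span (b ` T)" by (simp add: T)
  then obtain t r where t: "finite t" "t \<subseteq> b ` T" "g = (\<Sum>a\<in>t. Const (r a) * a)"
    by (auto simp: mp.span_explicit)
  define I where "I = {i \<in> T. b i \<in> t \<and> r (b i) \<noteq> 0}"
  have bI: "b ` I = {a \<in> t. r a \<noteq> 0}"
    using t(2) by (auto simp: I_def)
  have inj: "inj_on b I"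
    using T(2) by (rule inj_on_subset) (auto simp: I_def)
  have "finite (b ` I)"
    using t(1) by (simp add: bI)
  then have "finite I"
    using inj by (simp add: finite_image_iff)
  have "g = (\<Sum>a\<in>b ` I. Const (r a) * a)"
    unfolding t(3) bI by (intro sum.mono_neutral_right) (use t(1) in auto)
  also have "\<dots> = (\<Sum>i\<in>I. Const (r (b i)) * b i)"
    using inj by (simp add: sum.reindex)
  finally show ?thesis
    using \<open>finite I\<close> T(1) by (intro that[of I "\<lambda>i. r (b i)"]) (auto simp: I_def)
qed

lemma span_mult_left:
  assumes "f \<in> mp.span S" and "\<And>s. s \<in> S \<Longrightarrow> h * s \<in> mp.span T"
  shows "h * f \<in> mp.span T"
  using assms(1)
proof (induction rule: mp.span_induct_alt)
  case base
  then show ?case by (simp add: mp.span_zero)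
next
  case (step c s f)
  have "h * (Const c * s + f) = Const c * (h * s) + h * f"
    by (simp add: algebra_simps)
  then show ?case
    using step assms(2) by (simp add: mp.span_add mp.span_scale)
qed

lemma span_mult:
  assumes "f \<in> mp.span S" "g \<in> mp.span T" "\<And>s t. s \<in> S \<Longrightarrow> t \<in> T \<Longrightarrow> s * t \<in> mp.span U"
  shows "f * g \<in> mp.span U"
proof (rule span_mult_left[OF assms(2)])
  fix t assume "t \<in> T"
  then have "t * f \<in> mp.span U"
    using assms(1,3) by (intro span_mult_left[of f S]) (simp_all add: mult.commute[of t])
  then show "f * t \<in> mp.span U" by (simp add: mult.commute)
qed

lemma subalgebra_span:
  assumes "1 \<in> S" "\<And>s t. s \<in> S \<Longrightarrow> t \<in> S \<Longrightarrow> s * t \<in> S"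
  shows "subalgebra (mp.span S)"
proof -
  have "Const c \<in> mp.span S" for c
    using mp.span_scale[OF mp.span_base[OF assms(1)], of c] by simp
  then show ?thesis
    unfolding subalgebra_def
    by (auto intro: mp.span_add span_mult[of _ S _ S] mp.span_base assms(2))
qed

lemma subalgebraD:
  assumes "subalgebra A"
  shows "Const c \<in> A" "1 \<in> A" "0 \<in> A" "f \<in> A \<Longrightarrow> g \<in> A \<Longrightarrow> f + g \<in> A" "f \<in> A \<Longrightarrow> g \<in> A \<Longrightarrow> f * g \<in> A"
    "f \<in> A \<Longrightarrow> - f \<in> A" "f \<in> A \<Longrightarrow> g \<in> A \<Longrightarrow> f - g \<in> A" "f \<in> A \<Longrightarrow> f ^ n \<in> A"
proof -
  show C: "Const c \<in> A" for c using assms by (auto simp: subalgebra_def)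
  show one: "1 \<in> A" and zero: "0 \<in> A" using C[of 1] C[of 0] by simp_all
  show add: "f \<in> A \<Longrightarrow> g \<in> A \<Longrightarrow> f + g \<in> A" for f g using assms by (auto simp: subalgebra_def)
  show mult: "f \<in> A \<Longrightarrow> g \<in> A \<Longrightarrow> f * g \<in> A" for f g using assms by (auto simp: subalgebra_def)
  show neg: "f \<in> A \<Longrightarrow> - f \<in> A" for f using mult[OF C[of "- 1"], of f] by (simp add: Const_uminus)
  show "f \<in> A \<Longrightarrow> g \<in> A \<Longrightarrow> f - g \<in> A" using add neg by (metis uminus_add_conv_diff add.commute)
  show "f \<in> A \<Longrightarrow> f ^ n \<in> A" by (induction n) (simp_all add: one mult)
qed

lemma subalgebra_sum: "subalgebra A \<Longrightarrow> (\<And>i. i \<in> I \<Longrightarrow> f i \<in> A) \<Longrightarrow> (\<Sum>i\<in>I. f i) \<in> A"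
  by (induction I rule: infinite_finite_induct) (auto simp: subalgebraD)

lemma span_subset_subalgebra: "subalgebra A \<Longrightarrow> S \<subseteq> A \<Longrightarrow> mp.span S \<subseteq> A"
  by (rule mp.span_minimal) (auto simp: mp.subspace_def subalgebraD)

lemma subalgebra_hull: "subalgebra (subalgebra hull S)"
  by (rule hull_in) (auto simp: subalgebra_def)

subsection \<open>Lead monomials\<close>

text \<open>The relation is a parameter because three are used: \<open>grevlex_less\<close>, the
  comparison of weights, and an order on exponents of the generators. For weights, which do not
  separate all monomials, a lead monomial is one that strictly dominates every other, and it need
  not exist.\<close>

definition is_lead :: "(('v \<Rightarrow>\<^sub>0 nat) \<Rightarrow> ('v \<Rightarrow>\<^sub>0 nat) \<Rightarrow> bool) \<Rightarrow> ('v, 'a::zero) mpoly \<Rightarrow> ('v \<Rightarrow>\<^sub>0 nat) \<Rightarrow> bool"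
  where "is_lead lt f m \<longleftrightarrow> m \<in> keys f \<and> (\<forall>n\<in>keys f. n = m \<or> lt n m)"

locale mon_order =
  fixes lt :: "('v \<Rightarrow>\<^sub>0 nat) \<Rightarrow> ('v \<Rightarrow>\<^sub>0 nat) \<Rightarrow> bool"
  assumes irrefl: "\<not> lt m m"
    and trans: "lt l m \<Longrightarrow> lt m n \<Longrightarrow> lt l n"
    and add_right: "lt m n \<Longrightarrow> lt (m + k) (n + k)"
begin

lemma add_left: "lt m n \<Longrightarrow> lt (k + m) (k + n)"
  using add_right[of m n k] by (simp add: add.commute)

lemma add_both: "lt m n \<Longrightarrow> lt k l \<Longrightarrow> lt (m + k) (n + l)"
  using add_right add_left trans by blast

lemma is_lead_Mon: "is_lead lt (Mon m :: ('v, 'a::zero_neq_one) mpoly) m"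
  by (simp add: is_lead_def)

lemma is_lead_1: "is_lead lt (1 :: ('v, 'a::{zero_neq_one,semiring_1}) mpoly) 0"
  using is_lead_Mon[of 0] by simp

lemma is_lead_Const_mult:
  "is_lead lt (f :: ('v, 'a::field) mpoly) m \<Longrightarrow> c \<noteq> 0 \<Longrightarrow> is_lead lt (Const c * f) m"
  by (simp add: is_lead_def keys_Const_mult)

lemma is_lead_unique: "is_lead lt f m \<Longrightarrow> is_lead lt f n \<Longrightarrow> m = n"
proof (rule ccontr)
  assume "is_lead lt f m" "is_lead lt f n" "m \<noteq> n"
  then have "lt m n" "lt n m" by (auto simp: is_lead_def)
  then show False using trans irrefl by blast
qed

lemma is_lead_mult:
  fixes f g :: "('v, 'a::field) mpoly"
  assumes f: "is_lead lt f m" and g: "is_lead lt g n"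
  shows "is_lead lt (f * g) (m + n)" and "lookup (f * g) (m + n) = lookup f m * lookup g n"
proof -
  define f' where "f' = f - Poly_Mapping.single m (lookup f m)"
  define g' where "g' = g - Poly_Mapping.single n (lookup g n)"
  have f': "lt k m" if "k \<in> keys f'" for k
    using that f by (auto simp: f'_def is_lead_def in_keys_iff lookup_minus lookup_single when_def split: if_splits)
  have g': "lt k n" if "k \<in> keys g'" for k
    using that g by (auto simp: g'_def is_lead_def in_keys_iff lookup_minus lookup_single when_def split: if_splits)
  define r where "r = Poly_Mapping.single m (lookup f m) * g' + f' * g"
  have eq: "f * g = Poly_Mapping.single (m + n) (lookup f m * lookup g n) + r"
    by (simp add: r_def f'_def g'_def mult_single[symmetric] algebra_simps)
  have r: "lt k (m + n)" if "k \<in> keys r" for k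
  proof -
    from that consider "k \<in> keys (Poly_Mapping.single m (lookup f m) * g')" | "k \<in> keys (f' * g)"
      unfolding r_def by (blast dest: in_keys_addD)
    then show ?thesis
    proof cases
      case 1
      then obtain a b where "k = a + b" "a \<in> keys (Poly_Mapping.single m (lookup f m))" "b \<in> keys g'"
        by (rule in_keys_multE)
      then show ?thesis
        using g' add_left by (auto split: if_splits)
    next
      case 2
      then obtain a b where "k = a + b" "a \<in> keys f'" "b \<in> keys g"
        by (rule in_keys_multE)
      then show ?thesis
        using f'[of a] g add_right[of a m n] add_both[of a m b n] by (auto simp: is_lead_def)
    qed
  qed
  have "lookup r (m + n) = 0"
    using r irrefl by (auto simp: in_keys_iff)
  then show c: "lookup (f * g) (m + n) = lookup f m * lookup g n"
    by (simp add: eq lookup_add)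
  moreover have "lookup f m * lookup g n \<noteq> 0"
    using f g by (simp add: is_lead_def in_keys_iff)
  moreover have "k = m + n \<or> lt k (m + n)" if "k \<in> keys (f * g)" for k
  proof -
    from that have "k \<in> keys (Poly_Mapping.single (m + n) (lookup f m * lookup g n)) \<or> k \<in> keys r"
      unfolding eq by (rule in_keys_addD)
    then show ?thesis using r by (auto split: if_splits)
  qed
  ultimately show "is_lead lt (f * g) (m + n)"
    by (simp add: is_lead_def in_keys_iff)
qed

lemma is_lead_power:
  fixes f :: "('v, 'a::field) mpoly"
  assumes "is_lead lt f m"
  shows "is_lead lt (f ^ k) ((\<Sum>i<k. m))"
proof (induction k)
  case (Suc k)
  from is_lead_mult(1)[OF assms Suc] show ?case by (simp add: add.commute)
qed (simp add: is_lead_1)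

lemma is_lead_prod:
  fixes f :: "'i \<Rightarrow> ('v, 'a::field) mpoly"
  assumes "\<And>i. i \<in> I \<Longrightarrow> is_lead lt (f i) (m i)"
  shows "is_lead lt (\<Prod>i\<in>I. f i) (\<Sum>i\<in>I. m i)"
  using assms
  by (induction I rule: infinite_finite_induct) (simp_all add: is_lead_1 is_lead_mult)

lemma ex_maximal:
  assumes "finite I" "I \<noteq> {}"
  shows "\<exists>i\<in>I. \<forall>j\<in>I. \<not> lt (m i) (m j)"
  using assms
proof (induction rule: finite_ne_induct)
  case (singleton x)
  then show ?case by (simp add: irrefl)
next
  case (insert x F)
  then obtain i where i: "i \<in> F" "\<forall>j\<in>F. \<not> lt (m i) (m j)" by blast
  show ?case
  proof (cases "lt (m i) (m x)")
    case True
    then have "\<forall>j\<in>insert x F. \<not> lt (m x) (m j)"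
      using i trans irrefl by blast
    then show ?thesis by blast
  next
    case False
    then show ?thesis using i by blast
  qed
qed

text \<open>A different summand containing \<open>m i\<close> would have lead monomial
  \<open>m i\<close> or a larger one; injectivity and maximality exclude both, so nothing cancels at
  \<open>m i\<close>. It is stated in \<open>mon_order\<close> because it is applied to
  weights.\<close>

lemma lookup_sum_at_maximal:
  fixes b :: "'i \<Rightarrow> ('v, 'a::field) mpoly"
  assumes "finite I" "inj_on m I" "\<And>i. i \<in> I \<Longrightarrow> is_lead lt (b i) (m i)"
    and "i \<in> I" "\<And>j. j \<in> I \<Longrightarrow> \<not> lt (m i) (m j)"
  shows "lookup (\<Sum>i\<in>I. Const (c i) * b i) (m i) = c i * lookup (b i) (m i)"
proof -
  have "lookup (b j) (m i) = 0" if "j \<in> I" "j \<noteq> i" for j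
  proof (rule ccontr)
    assume "lookup (b j) (m i) \<noteq> 0"
    with assms(3)[OF that(1)] have "m i = m j \<or> lt (m i) (m j)"
      by (auto simp: is_lead_def in_keys_iff)
    then show False using that assms by (auto dest: inj_onD)
  qed
  then have "(\<Sum>j\<in>I. c j * lookup (b j) (m i)) = (\<Sum>j\<in>I. if j = i then c i * lookup (b i) (m i) else 0)"
    by (intro sum.cong) auto
  then show ?thesis
    using assms(1,4) by (simp add: lookup_sum)
qed

end

locale total_mon_order = mon_order lt for lt :: "('v \<Rightarrow>\<^sub>0 nat) \<Rightarrow> ('v \<Rightarrow>\<^sub>0 nat) \<Rightarrow> bool" +
  assumes total: "m \<noteq> n \<Longrightarrow> lt m n \<or> lt n m"
begin

lemma ex_is_lead:
  assumes "f \<noteq> 0"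
  shows "\<exists>m. is_lead lt f m"
proof -
  have "keys f \<noteq> {}" using assms by simp
  then obtain m where "m \<in> keys f" "\<forall>n\<in>keys f. \<not> lt m n"
    using ex_maximal[of "keys f" "\<lambda>m. m"] by auto
  then have "is_lead lt f m" unfolding is_lead_def using total by blast
  then show ?thesis ..
qed

text \<open>Among distinct lead monomials the largest cannot cancel. This serves both as linear
  independence and as the computation of lead monomials of a whole span.\<close>

lemma is_lead_sum:
  fixes b :: "'i \<Rightarrow> ('v, 'a::field) mpoly"
  assumes "finite I" "I \<noteq> {}" "inj_on m I" "\<And>i. i \<in> I \<Longrightarrow> is_lead lt (b i) (m i)"
    and "\<And>i. i \<in> I \<Longrightarrow> c i \<noteq> 0"
  obtains i where "i \<in> I" "is_lead lt (\<Sum>i\<in>I. Const (c i) * b i) (m i)"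
    "\<And>j. j \<in> I \<Longrightarrow> j = i \<or> lt (m j) (m i)"
proof -
  obtain i where i: "i \<in> I" "\<And>j. j \<in> I \<Longrightarrow> \<not> lt (m i) (m j)"
    using ex_maximal[OF assms(1,2), of m] by blast
  then have j: "j = i \<or> lt (m j) (m i)" if "j \<in> I" for j
    using that total assms(3) by (metis inj_onD)
  have "lookup (\<Sum>i\<in>I. Const (c i) * b i) (m i) \<noteq> 0"
    using lookup_sum_at_maximal[OF assms(1,3,4) i, of c] assms(4,5) i(1)
    by (simp add: is_lead_def in_keys_iff)
  moreover have "n = m i \<or> lt n (m i)" if "n \<in> keys (\<Sum>i\<in>I. Const (c i) * b i)" for n
  proof -
    from that obtain k where k: "k \<in> I" "n \<in> keys (Const (c k) * b k)"
      by (rule in_keys_sumE)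
    then have "n = m k \<or> lt n (m k)"
      using assms(4)[of k] by (auto simp: is_lead_def in_keys_iff)
    then show ?thesis using j[OF k(1)] trans by blast
  qed
  ultimately have "is_lead lt (\<Sum>i\<in>I. Const (c i) * b i) (m i)"
    by (simp add: is_lead_def in_keys_iff)
  then show ?thesis using that i(1) j by blast
qed

end

subsection \<open>Monomials and orders in three variables\<close>

abbreviation xyzm :: "nat \<Rightarrow> nat \<Rightarrow> nat \<Rightarrow> (xyz \<Rightarrow>\<^sub>0 nat)" where
  "xyzm a b c \<equiv> Poly_Mapping.single VX a + Poly_Mapping.single VY b + Poly_Mapping.single VZ c"

lemma xyz_mon_eq_iff:
  "m = n \<longleftrightarrow> lookup m VX = lookup n VX \<and> lookup m VY = lookup n VY \<and> lookup m VZ = lookup n VZ"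
proof (intro iffI poly_mapping_eqI)
  fix v
  assume "lookup m VX = lookup n VX \<and> lookup m VY = lookup n VY \<and> lookup m VZ = lookup n VZ"
  then show "lookup m v = lookup n v" by (cases v) simp_all
qed simp

lemma lookup_xyzm [simp]:
  "lookup (xyzm a b c) VX = a" "lookup (xyzm a b c) VY = b" "lookup (xyzm a b c) VZ = c"
  by (simp_all add: lookup_add lookup_single)

lemma Var_power: "Var v ^ n = Mon (Poly_Mapping.single v n)" for v :: 'v
  by (induction n) (simp_all add: Var_def Mon_add[symmetric] single_add[symmetric])

lemma Mon_xyzm: "X ^ a * Y ^ b * Z ^ c = (Mon (xyzm a b c) :: (xyz, 'a::comm_ring_1) mpoly)"
  by (simp add: Mon_add Var_power)

lemma mdeg_add [simp]: "mdeg (m + n) = mdeg m + mdeg n"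
  by (simp add: mdeg_def lookup_add)

interpretation grevlex: total_mon_order grevlex_less
proof
  fix k l m n :: "xyz \<Rightarrow>\<^sub>0 nat"
  show "\<not> grevlex_less m m" by (simp add: grevlex_less_def)
  show "grevlex_less l m \<Longrightarrow> grevlex_less m n \<Longrightarrow> grevlex_less l n" by (auto simp: grevlex_less_def)
  show "grevlex_less m n \<Longrightarrow> grevlex_less (m + k) (n + k)"
    by (auto simp: grevlex_less_def lookup_add)
  show "m \<noteq> n \<Longrightarrow> grevlex_less m n \<or> grevlex_less n m"
    by (auto simp: grevlex_less_def xyz_mon_eq_iff mdeg_def)
qed

lemma finite_mdeg_le: "finite {m. mdeg m \<le> d}"
proof (rule finite_subset)
  show "{m. mdeg m \<le> d} \<subseteq> (\<lambda>(a, b, c). xyzm a b c) ` ({..d} \<times> {..d} \<times> {..d})"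
  proof
    fix m assume "m \<in> {m. mdeg m \<le> d}"
    then have "m = (\<lambda>(a, b, c). xyzm a b c) (lookup m VX, lookup m VY, lookup m VZ)"
      "(lookup m VX, lookup m VY, lookup m VZ) \<in> {..d} \<times> {..d} \<times> {..d}"
      by (auto simp: mdeg_def xyz_mon_eq_iff)
    then show "m \<in> (\<lambda>(a, b, c). xyzm a b c) ` ({..d} \<times> {..d} \<times> {..d})" by blast
  qed
qed auto

lemma finite_grevlex_less: "finite {m. grevlex_less m n}"
  by (rule finite_subset[OF _ finite_mdeg_le[of "mdeg n"]]) (auto simp: grevlex_less_def)

text \<open>Degrees are compared first, so only finitely many monomials lie below a given one.
  Termination of subduction rests on this.\<close>

lemma wfp_grevlex_less: "wfp grevlex_less"
proof -
  have "wf (inv_image less_than (\<lambda>m. card {l. grevlex_less l m}))" by simp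
  moreover have "{(m, n). grevlex_less m n} \<subseteq> inv_image less_than (\<lambda>m. card {l. grevlex_less l m})"
  proof (clarsimp, rule psubset_card_mono[OF finite_grevlex_less])
    fix m n assume "grevlex_less m n"
    then have "m \<notin> {l. grevlex_less l m}" "m \<in> {l. grevlex_less l n}" "{l. grevlex_less l m} \<subseteq> {l. grevlex_less l n}"
      using grevlex.irrefl grevlex.trans by auto
    then show "{l. grevlex_less l m} \<subset> {l. grevlex_less l n}" by blast
  qed
  ultimately show ?thesis
    unfolding wfp_def by (rule wf_subset)
qed

lemma lead_mon_eqI: "is_lead grevlex_less f m \<Longrightarrow> lead_mon f = m"
  unfolding lead_mon_def is_lead_def[symmetric]
  by (rule the_equality) (simp_all add: grevlex.is_lead_unique)

lemma is_lead_lead_mon: "f \<noteq> 0 \<Longrightarrow> is_lead grevlex_less f (lead_mon f)"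
  using grevlex.ex_is_lead lead_mon_eqI by metis

lemma lead_mon_mult:
  fixes f g :: "(xyz, 'a::field) mpoly"
  shows "f \<noteq> 0 \<Longrightarrow> g \<noteq> 0 \<Longrightarrow> lead_mon (f * g) = lead_mon f + lead_mon g"
  by (intro lead_mon_eqI grevlex.is_lead_mult is_lead_lead_mon)

lemma lead_mon_diff_less:
  fixes f g :: "(xyz, 'a::field) mpoly"
  assumes "lead_term f = lead_term g" "f \<noteq> 0" "f - g \<noteq> 0"
  shows "grevlex_less (lead_mon (f - g)) (lead_mon f)"
proof -
  let ?m = "lead_mon f"
  have f: "is_lead grevlex_less f ?m" using assms(2) by (rule is_lead_lead_mon)
  then have c: "lookup f ?m \<noteq> 0" by (simp add: is_lead_def in_keys_iff)
  have lt: "Poly_Mapping.single ?m (lookup f ?m) = Poly_Mapping.single (lead_mon g) (lookup g (lead_mon g))"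
    using assms(1) by (simp add: lead_term_def)
  then have "keys (Poly_Mapping.single ?m (lookup f ?m)) = keys (Poly_Mapping.single (lead_mon g) (lookup g (lead_mon g)))"
    by simp
  with c have m: "lead_mon g = ?m" "lookup g (lead_mon g) \<noteq> 0"
    by (simp_all split: if_splits)
  have eq: "lookup f ?m = lookup g ?m" using lt m by (metis lookup_single_eq)
  have "g \<noteq> 0" using m by auto
  then have g: "is_lead grevlex_less g ?m" using is_lead_lead_mon m(1) by metis
  have l: "is_lead grevlex_less (f - g) (lead_mon (f - g))" using assms(3) by (rule is_lead_lead_mon)
  then have k: "lead_mon (f - g) \<in> keys f \<union> keys g"
    by (auto simp: is_lead_def in_keys_iff lookup_minus)
  have "lead_mon (f - g) \<noteq> ?m"
  proof
    assume e: "lead_mon (f - g) = ?m"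
    have "lookup (f - g) (lead_mon (f - g)) \<noteq> 0" using l by (simp add: is_lead_def in_keys_iff)
    then show False unfolding e by (simp add: lookup_minus eq)
  qed
  then show ?thesis using k f g by (auto simp: is_lead_def)
qed

section \<open>Homogeneous polynomials\<close>

definition homogeneous :: "nat \<Rightarrow> (xyz, 'a::zero) mpoly \<Rightarrow> bool" where
  "homogeneous d f \<longleftrightarrow> (\<forall>m\<in>keys f. mdeg m = d)"

lemma homogeneous_add: "homogeneous d f \<Longrightarrow> homogeneous d g \<Longrightarrow> homogeneous d (f + g)"
  unfolding homogeneous_def by (blast dest: in_keys_addD)

lemma homogeneous_mult: "homogeneous d f \<Longrightarrow> homogeneous e g \<Longrightarrow> homogeneous (d + e) (f * g)"
  unfolding homogeneous_def by (auto elim!: in_keys_multE)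

lemma homogeneous_Const: "homogeneous 0 (Const c)"
  by (simp add: homogeneous_def Const_def mdeg_def)

lemma homogeneous_1: "homogeneous 0 (1 :: (xyz, 'a::semiring_1) mpoly)"
  using homogeneous_Const[of "1 :: 'a"] by simp

lemma homogeneous_Const_mult: "homogeneous d f \<Longrightarrow> homogeneous d (Const c * f)"
  using homogeneous_mult[OF homogeneous_Const] by fastforce

lemma homogeneous_uminus: "homogeneous d f \<Longrightarrow> homogeneous d (- f)" for f :: "(xyz, 'a::ab_group_add) mpoly"
  by (simp add: homogeneous_def in_keys_iff)

lemma homogeneous_diff: "homogeneous d f \<Longrightarrow> homogeneous d g \<Longrightarrow> homogeneous d (f - g)"
  for f :: "(xyz, 'a::ab_group_add) mpoly"
  using homogeneous_add[OF _ homogeneous_uminus] by fastforce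

lemma homogeneous_power: "homogeneous d f \<Longrightarrow> homogeneous (n * d) (f ^ n)"
  for f :: "(xyz, 'a::comm_semiring_1) mpoly"
proof (induction n)
  case 0
  then show ?case by (simp add: homogeneous_1)
next
  case (Suc n)
  then show ?case using homogeneous_mult[of d f "n * d" "f ^ n"] by simp
qed

lemma homogeneous_Var: "homogeneous 1 (Var v)"
  by (cases v) (simp_all add: homogeneous_def Var_def mdeg_def lookup_single)

lemma homogeneous_Var_power: "homogeneous n (Var v ^ n :: (xyz, 'a::comm_semiring_1) mpoly)"
  using homogeneous_power[OF homogeneous_Var, of n v] by simp

text \<open>The part \<open>g1\<close> of \<open>g\<close> outside degree \<open>e\<close> gives a
  product \<open>f * g1\<close> that is homogeneous of degree \<open>d + e\<close> and yet has no
  monomial of that degree, so it vanishes. In this way \<open>h2\<close> and \<open>h3\<close>,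
  known through their products with powers of x, inherit homogeneity.\<close>

lemma homogeneous_cancel:
  fixes f g :: "(xyz, 'a::field) mpoly"
  assumes "homogeneous (d + e) (f * g)" "homogeneous d f" "f \<noteq> 0"
  shows "homogeneous e g"
  unfolding homogeneous_def
proof (rule ccontr)
  assume neg: "\<not> (\<forall>m\<in>keys g. mdeg m = e)"
  define g0 where "g0 = (\<Sum>m\<in>{m \<in> keys g. mdeg m = e}. Const (lookup g m) * Mon m)"
  define g1 where "g1 = (\<Sum>m\<in>{m \<in> keys g. mdeg m \<noteq> e}. Const (lookup g m) * Mon m)"
  have g: "g = g0 + g1"
    by (subst mpoly_sum_Mon[of g], unfold g0_def g1_def, subst sum.union_disjoint[symmetric])
      (auto intro: sum.cong)
  have k1: "mdeg m \<noteq> e" if "m \<in> keys g1" for m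
    using that by (auto simp: g1_def Const_mult_Mon elim!: in_keys_sumE split: if_splits)
  have h0: "homogeneous e g0"
    unfolding homogeneous_def by (auto simp: g0_def Const_mult_Mon elim!: in_keys_sumE split: if_splits)
  have "homogeneous (d + e) (f * g1)"
    using homogeneous_diff[OF assms(1) homogeneous_mult[OF assms(2) h0]]
    by (simp add: g algebra_simps)
  moreover have "mdeg m \<noteq> d + e" if "m \<in> keys (f * g1)" for m
  proof -
    from that obtain a b where "m = a + b" "a \<in> keys f" "b \<in> keys g1"
      by (rule in_keys_multE)
    then show ?thesis using assms(2) k1 by (auto simp: homogeneous_def)
  qed
  ultimately have "keys (f * g1) = {}" by (auto simp: homogeneous_def)
  then have "g1 = 0" using assms(3) by simp
  then show False using neg h0 g by (simp add: homogeneous_def)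
qed

lemma lookup_X_mult_eq_0: "lookup m VX = 0 \<Longrightarrow> lookup (X * f) m = 0"
  for f :: "(xyz, 'a::comm_ring_1) mpoly"
proof (rule ccontr)
  assume m: "lookup m VX = 0" and "lookup (X * f) m \<noteq> 0"
  then have "m \<in> keys (X * f)" by (simp add: in_keys_iff)
  then obtain a b where "m = a + b" "a \<in> keys (X :: 'a xpoly)" by (rule in_keys_multE)
  then show False using m by (simp add: Var_def lookup_add)
qed

text \<open>Within one degree, the order puts every monomial divisible by x below all those that are
  not. The reduction modulo x therefore decides the lead monomial.\<close>

lemma is_lead_of_mod_X:
  fixes f :: "(xyz, 'a::field) mpoly"
  assumes "homogeneous d f" "f = Const c * Y ^ d + X * g" "c \<noteq> 0"
  shows "is_lead grevlex_less f (xyzm 0 d 0)"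
proof -
  have lk: "lookup f m = (if m = xyzm 0 d 0 then c else 0)" if "lookup m VX = 0" for m
    unfolding assms(2) using lookup_X_mult_eq_0[OF that, of g]
    by (simp add: lookup_add Var_power Mon_def lookup_single when_def)
  have "n = xyzm 0 d 0 \<or> grevlex_less n (xyzm 0 d 0)" if "n \<in> keys f" for n
  proof (cases "lookup n VX = 0")
    case True
    then show ?thesis using that lk[OF True] by (auto simp: in_keys_iff split: if_splits)
  next
    case False
    have "mdeg n = mdeg (xyzm 0 d 0)"
      using assms(1) that by (simp add: homogeneous_def mdeg_def lookup_add lookup_single)
    then show ?thesis using False by (simp add: grevlex_less_def lookup_single)
  qed
  moreover have "lookup f (xyzm 0 d 0) = c"
    using lk[OF lookup_xyzm(1)[of 0 d 0]] by simp
  ultimately show ?thesis using assms(3) unfolding is_lead_def in_keys_iff by blast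
qed

text \<open>The weight \<open>(0, 1, 2)\<close> on \<open>(x, y, z)\<close> gives \<open>\<delta>\<close> the weight of \<open>xz\<close>, which makes the top forms
  of \<open>f\<^sub>1\<close>, \<open>h\<^sub>2\<close> and \<open>N(z)\<close> monomials that reveal the \<open>h\<^sub>2\<close>-degree of \<open>N(z)\<close>.\<close>

definition wt :: "(xyz \<Rightarrow>\<^sub>0 nat) \<Rightarrow> nat" where
  "wt m = lookup m VY + 2 * lookup m VZ"

definition wt_less :: "(xyz \<Rightarrow>\<^sub>0 nat) \<Rightarrow> (xyz \<Rightarrow>\<^sub>0 nat) \<Rightarrow> bool" where
  "wt_less m n \<longleftrightarrow> wt m < wt n"

lemma wt_add [simp]: "wt (m + n) = wt m + wt n"
  by (simp add: wt_def lookup_add)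

interpretation wt: mon_order wt_less
  by standard (auto simp: wt_less_def)

definition wt_le :: "nat \<Rightarrow> (xyz, 'a::zero) mpoly \<Rightarrow> bool" where
  "wt_le w f \<longleftrightarrow> (\<forall>m\<in>keys f. wt m \<le> w)"

lemma wt_le_mono: "wt_le w f \<Longrightarrow> w \<le> w' \<Longrightarrow> wt_le w' f"
  by (force simp: wt_le_def)

lemma wt_le_add: "wt_le w f \<Longrightarrow> wt_le w g \<Longrightarrow> wt_le w (f + g)"
  unfolding wt_le_def by (blast dest: in_keys_addD)

lemma wt_le_mult: "wt_le v f \<Longrightarrow> wt_le w g \<Longrightarrow> wt_le (v + w) (f * g)"
  unfolding wt_le_def by (auto elim!: in_keys_multE intro!: add_mono)

lemma wt_le_Const: "wt_le 0 (Const c)"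
  by (simp add: wt_le_def Const_def wt_def)

lemma wt_le_Const_mult: "wt_le w f \<Longrightarrow> wt_le w (Const c * f)"
  using wt_le_mult[OF wt_le_Const] by fastforce

lemma wt_le_uminus: "wt_le w f \<Longrightarrow> wt_le w (- f)" for f :: "(xyz, 'a::ab_group_add) mpoly"
  by (simp add: wt_le_def in_keys_iff)

lemma wt_le_diff: "wt_le w f \<Longrightarrow> wt_le w g \<Longrightarrow> wt_le w (f - g)"
  for f :: "(xyz, 'a::ab_group_add) mpoly"
  using wt_le_add[OF _ wt_le_uminus] by fastforce

lemma wt_le_power: "wt_le w f \<Longrightarrow> wt_le (n * w) (f ^ n)" for f :: "(xyz, 'a::comm_semiring_1) mpoly"
proof (induction n)
  case 0
  then show ?case using wt_le_Const[of "1 :: 'a"] by simp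
next
  case (Suc n)
  then show ?case using wt_le_mult[of w f "n * w" "f ^ n"] by simp
qed

lemma wt_le_X: "wt_le 0 X" and wt_le_Y: "wt_le 1 Y" and wt_le_Z: "wt_le 2 Z"
  by (simp_all add: wt_le_def Var_def wt_def lookup_single)

lemma is_lead_wt_add:
  fixes f g :: "(xyz, 'a::field) mpoly"
  assumes "is_lead wt_less f m" "wt_le w g" "w < wt m"
  shows "is_lead wt_less (f + g) m"
proof -
  have "lookup g m = 0" using assms(2,3) by (force simp: wt_le_def in_keys_iff)
  then have "m \<in> keys (f + g)" using assms(1) by (simp add: is_lead_def in_keys_iff lookup_add)
  moreover have "n = m \<or> wt_less n m" if "n \<in> keys (f + g)" for n
  proof -
    have "n \<in> keys f \<or> n \<in> keys g" using that by (rule in_keys_addD)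
    then show ?thesis using assms by (force simp: is_lead_def wt_le_def wt_less_def)
  qed
  ultimately show ?thesis by (simp add: is_lead_def)
qed

subsection \<open>The group action\<close>

definition transl :: "'a::field \<Rightarrow> 'a \<Rightarrow> 'a xpoly \<Rightarrow> 'a xpoly" where
  "transl u v = subst (\<lambda>w. case w of VX \<Rightarrow> X | VY \<Rightarrow> Y + Const u * X
     | VZ \<Rightarrow> Z + Const (2 * u) * Y + Const (u\<^sup>2 + v) * X)"

lemma transl_hom:
  "transl u v (f + g) = transl u v f + transl u v g"
  "transl u v (f * g) = transl u v f * transl u v g"
  "transl u v (f ^ n) = transl u v f ^ n"
  "transl u v (- f) = - transl u v f"
  "transl u v (f - g) = transl u v f - transl u v g"
  "transl u v (Const c) = Const c"
  "transl u v (numeral k) = numeral k"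
  "transl u v X = X" "transl u v Y = Y + Const u * X"
  "transl u v Z = Z + Const (2 * u) * Y + Const (u\<^sup>2 + v) * X"
  using subst_Const[of _ "numeral k"] by (simp_all add: transl_def subst_hom Const_numeral)

lemma transl_sum: "transl u v (\<Sum>i\<in>I. f i) = (\<Sum>i\<in>I. transl u v (f i))"
  by (simp add: transl_def subst_sum)

lemma transl_prod: "transl u v (\<Prod>i\<in>I. f i) = (\<Prod>i\<in>I. transl u v (f i))"
  by (simp add: transl_def subst_prod)

lemma transl_delta: "transl u v delta = delta - Const v * X\<^sup>2"
  unfolding delta_def transl_hom Const_hom by algebra

text \<open>The summand \<open>u\<^sup>2\<close> in the image of z absorbs the cross term 2 u u' of
  a composition, so the pairs \<open>(u, v)\<close> simply add and every group element acts as a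
  single translation.\<close>

lemma transl_transl: "transl u v (transl u' v' f) = transl (u + u') (v + v') f"
proof -
  have *: "transl u v ((case w of VX \<Rightarrow> X | VY \<Rightarrow> Y + Const u' * X
      | VZ \<Rightarrow> Z + Const (2 * u') * Y + Const (u'\<^sup>2 + v') * X))
    = (case w of VX \<Rightarrow> X | VY \<Rightarrow> Y + Const (u + u') * X
      | VZ \<Rightarrow> Z + Const (2 * (u + u')) * Y + Const ((u + u')\<^sup>2 + (v + v')) * X)" for w
  proof (cases w)
    case VX
    then show ?thesis by (simp add: transl_hom)
  next
    case VY
    then show ?thesis unfolding VY xyz.case transl_hom Const_hom by (simp add: distrib_right)
  next
    case VZ
    then show ?thesis unfolding VZ xyz.case transl_hom Const_hom
      by (simp add: algebra_simps power2_eq_square)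
  qed
  have "transl u v (transl u' v' f) = subst (\<lambda>w. transl u v ((case w of VX \<Rightarrow> X | VY \<Rightarrow> Y + Const u' * X
      | VZ \<Rightarrow> Z + Const (2 * u') * Y + Const (u'\<^sup>2 + v') * X))) f"
    unfolding transl_def by (rule subst_subst)
  then show ?thesis
    unfolding * transl_def[of "u + u'"] .
qed

lemma transl_0: "transl 0 0 f = f"
proof -
  have "(\<lambda>w. case w of VX \<Rightarrow> X :: 'a xpoly | VY \<Rightarrow> Y + Const 0 * X
      | VZ \<Rightarrow> Z + Const (2 * 0) * Y + Const (0\<^sup>2 + 0) * X) = Var"
    by (auto split: xyz.splits)
  then show ?thesis unfolding transl_def by (simp only: subst_Var_id)
qed

definition ushift :: "'a::field^4^2 \<Rightarrow> (4 \<Rightarrow> nat) \<Rightarrow> 'a" where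
  "ushift M a = (\<Sum>j\<in>UNIV. of_nat (a j) * M$1$j)"

definition vshift :: "'a::field^4^2 \<Rightarrow> (4 \<Rightarrow> nat) \<Rightarrow> 'a" where
  "vshift M a = (\<Sum>j\<in>UNIV. of_nat (a j) * M$2$j)"

lemma act_eq_transl: "act M a f = transl (ushift M a) (vshift M a) f"
proof -
  have gen: "act_gen M j = transl (M$1$j) (M$2$j)" for j
    by (simp add: act_gen_def transl_def)
  have pow: "(act_gen M j ^^ n) f = transl (of_nat n * M$1$j) (of_nat n * M$2$j) f" for j n f
    by (induction n) (simp_all add: transl_0 gen transl_transl algebra_simps)
  show ?thesis
    by (simp add: act_def pow transl_transl ushift_def vshift_def sum_4 add_ac)
qed

lemma finite_E_exps: "finite (E_exps p)" and card_E_exps: "card (E_exps p) = p ^ 4"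
proof -
  have "E_exps p = PiE UNIV (\<lambda>_. {..<p})"
    by (auto simp: E_exps_def)
  then show "finite (E_exps p)" "card (E_exps p) = p ^ 4"
    by (simp_all add: card_PiE finite_PiE)
qed

subsection \<open>Cramer's rule for the minors\<close>

lemma vector_4 [simp]:
  "(vector [a, b, c, d] :: 'a::zero^4) $ 1 = a" "(vector [a, b, c, d] :: 'a^4) $ 2 = b"
  "(vector [a, b, c, d] :: 'a^4) $ 3 = c" "(vector [a, b, c, d] :: 'a^4) $ 4 = d"
  by (simp_all add: vector_def)

lemma det_4:
  "det (A :: 'a::comm_ring_1^4^4) =
    A$1$1 * (A$2$2 * (A$3$3 * A$4$4 - A$3$4 * A$4$3) - A$2$3 * (A$3$2 * A$4$4 - A$3$4 * A$4$2)
      + A$2$4 * (A$3$2 * A$4$3 - A$3$3 * A$4$2))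
  - A$1$2 * (A$2$1 * (A$3$3 * A$4$4 - A$3$4 * A$4$3) - A$2$3 * (A$3$1 * A$4$4 - A$3$4 * A$4$1)
      + A$2$4 * (A$3$1 * A$4$3 - A$3$3 * A$4$1))
  + A$1$3 * (A$2$1 * (A$3$2 * A$4$4 - A$3$4 * A$4$2) - A$2$2 * (A$3$1 * A$4$4 - A$3$4 * A$4$1)
      + A$2$4 * (A$3$1 * A$4$2 - A$3$2 * A$4$1))
  - A$1$4 * (A$2$1 * (A$3$2 * A$4$3 - A$3$3 * A$4$2) - A$2$2 * (A$3$1 * A$4$3 - A$3$3 * A$4$1)
      + A$2$3 * (A$3$1 * A$4$2 - A$3$2 * A$4$1))"
proof -
  have f1: "finite {2::4, 3, 4}" "1 \<notin> {2::4, 3, 4}" by auto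
  have f2: "finite {3::4, 4}" "2 \<notin> {3::4, 4}" by auto
  have f3: "finite {4::4}" "3 \<notin> {4::4}" by auto
  show ?thesis
    unfolding det_def UNIV_4
    unfolding sum_over_permutations_insert[OF f1]
    unfolding sum_over_permutations_insert[OF f2]
    unfolding sum_over_permutations_insert[OF f3]
    unfolding permutes_sing
    by (simp add: sign_swap_id permutation_swap_id permutation_compose sign_compose sign_id swap_id_eq algebra_simps)
qed

lemma cramer_4:
  fixes a b c d r :: "'a::comm_ring_1^4"
  shows "det (vector [a, b, c, d] :: 'a^4^4) * r $ j =
    det (vector [r, b, c, d] :: 'a^4^4) * a $ j + det (vector [a, r, c, d] :: 'a^4^4) * b $ j +
    det (vector [a, b, r, d] :: 'a^4^4) * c $ j + det (vector [a, b, c, r] :: 'a^4^4) * d $ j"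
  using exhaust_4[of j] by (elim disjE) (simp_all add: det_4 algebra_simps)

lemma det_4_swap:
  fixes a b c d :: "'a::comm_ring_1^4"
  shows "det (vector [b, a, c, d] :: 'a^4^4) = - det (vector [a, b, c, d] :: 'a^4^4)"
    and "det (vector [a, c, b, d] :: 'a^4^4) = - det (vector [a, b, c, d] :: 'a^4^4)"
    and "det (vector [a, b, d, c] :: 'a^4^4) = - det (vector [a, b, c, d] :: 'a^4^4)"
  by (simp_all add: det_4 algebra_simps)

lemma det_nonzero_imp_kernel_0:
  fixes A :: "'a::field^'n^'n"
  assumes "det A \<noteq> 0" "\<And>i. (\<Sum>j\<in>UNIV. A $ i $ j * d j) = 0"
  shows "d j = 0"
proof -
  obtain B where B: "B ** A = mat 1"
    using assms(1) by (auto simp: invertible_det_nz[symmetric] invertible_def)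
  have "A *v (\<chi> j. d j) = 0"
    using assms(2) by (simp add: matrix_vector_mult_def vec_eq_iff)
  then have "B *v (A *v (\<chi> j. d j)) = 0" by simp
  then have "(\<chi> j. d j) = (0 :: 'a^'n)"
    by (simp add: matrix_vector_mul_assoc B)
  then show ?thesis by (simp add: vec_eq_iff)
qed

lemma of_nat_power_CHAR:
  assumes "prime CHAR('a::comm_semiring_1)"
  shows "(of_nat n :: 'a) ^ (CHAR('a) ^ k) = of_nat n"
proof (induction n)
  case 0
  then show ?case using prime_gt_0_nat[OF assms] by (simp add: zero_power)
next
  case (Suc n)
  then show ?case using freshmans_dream'[OF assms refl, of 1 "of_nat n" k] by simp
qed

section \<open>The hypotheses and the row relations they give\<close>

locale claim_matrix =
  fixes p :: nat and M :: "'a::field^4^2"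
  assumes prime_p: "prime p" and p_gt_2: "p > 2" and CHAR_p: "CHAR('a) = p"
    and minor1234: "minor p M 1 2 3 4 \<noteq> 0" and minor1235: "minor p M 1 2 3 5 \<noteq> 0"
    and minor1357: "minor p M 1 3 5 7 = 0"
begin

abbreviation "b0 \<equiv> beta0 p M"
abbreviation "b1 \<equiv> beta1 p M"
abbreviation "b2 \<equiv> beta2 p M"
abbreviation "b3 \<equiv> beta3 p M"
abbreviation "a0 \<equiv> alpha0 p M"
abbreviation "a1 \<equiv> alpha1 p M"
abbreviation "a2 \<equiv> alpha2 p M"

lemma p_gt_0: "p > 0" and p_ge_3: "p \<ge> 3" and odd_p: "odd p"
  using p_gt_2 prime_p prime_odd_nat by auto

text \<open>Frees exponents such as \<open>(p - 3) div 2\<close> from truncated subtraction and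
  division.\<close>

lemma p_odd_form:
  obtains k where "p = 2 * k + 3"
proof -
  obtain j where "p = 2 * j + 1" using odd_p oddE by blast
  then have "p = 2 * (j - 1) + 3" using p_gt_2 by simp
  then show ?thesis using that by blast
qed

lemma prime_CHAR: "prime CHAR('a)"
  using CHAR_p prime_p by simp

lemma prime_CHAR_mpoly: "prime CHAR('a xpoly)"
  using CHAR_p prime_p by simp

lemma add_power_p: "(x + y :: 'a) ^ (p ^ k) = x ^ (p ^ k) + y ^ (p ^ k)"
  using freshmans_dream'[OF prime_CHAR refl, of x y k] by (simp add: CHAR_p)

lemma sum_power_p: "(\<Sum>i\<in>I. f i :: 'a) ^ (p ^ k) = (\<Sum>i\<in>I. f i ^ (p ^ k))"
  using freshmans_dream_sum'[OF prime_CHAR refl, of f I k] by (simp add: CHAR_p)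

lemma diff_power_p: "(x - y :: 'a) ^ (p ^ k) = x ^ (p ^ k) - y ^ (p ^ k)"
  using add_power_p[of "x - y" y k] by simp

lemma of_nat_power_p: "(of_nat n :: 'a) ^ (p ^ k) = of_nat n"
  using of_nat_power_CHAR[OF prime_CHAR, of n k] by (simp add: CHAR_p)

lemma b3_nz: "b3 \<noteq> 0"
  using minor1234 minor1235 by (simp add: beta3_def)

text \<open>Cramer's rule for row 5 over rows 1 to 4, which are independent as the minor 1234 is
  nonzero. The alternating signs come from moving row 5 into its place in each minor; with the shift
  of \<open>delta\<close> by - v x^2 they turn into the signs of \<open>f1_hat\<close>.\<close>

lemma row5: "(M$1$j) ^ p\<^sup>2 = b3 * (M$2$j) ^ p - b2 * (M$1$j) ^ p + b1 * M$2$j - b0 * M$1$j"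
proof -
  define r where "r = (\<lambda>i. Gamma_row p M i)"
  have m: "minor p M i j k l = det (vector [r i, r j, r k, r l] :: 'a^4^4)" for i j k l
    by (simp add: minor_def r_def)
  have s: "det (vector [r 5, r 2, r 3, r 4] :: 'a^4^4) = - minor p M 2 3 4 5"
    "det (vector [r 1, r 5, r 3, r 4] :: 'a^4^4) = minor p M 1 3 4 5"
    "det (vector [r 1, r 2, r 5, r 4] :: 'a^4^4) = - minor p M 1 2 4 5"
    unfolding m
    using det_4_swap(1)[of "r 2" "r 5" "r 3" "r 4"] det_4_swap(2)[of "r 2" "r 3" "r 5" "r 4"]
      det_4_swap(3)[of "r 2" "r 3" "r 5" "r 4"]
      det_4_swap(2)[of "r 1" "r 3" "r 5" "r 4"] det_4_swap(3)[of "r 1" "r 3" "r 5" "r 4"]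
      det_4_swap(3)[of "r 1" "r 2" "r 5" "r 4"] by simp_all
  have rj: "r 1 $ j = M$1$j" "r 2 $ j = M$2$j" "r 3 $ j = (M$1$j) ^ p" "r 4 $ j = (M$2$j) ^ p"
    "r 5 $ j = (M$1$j) ^ p\<^sup>2"
    by (simp_all add: r_def Gamma_row_def)
  have "minor p M 1 2 3 4 * (M$1$j) ^ p\<^sup>2 = - minor p M 2 3 4 5 * M$1$j + minor p M 1 3 4 5 * M$2$j
      - minor p M 1 2 4 5 * (M$1$j) ^ p + minor p M 1 2 3 5 * (M$2$j) ^ p"
    using cramer_4[of "r 1" "r 2" "r 3" "r 4" "r 5" j] unfolding s rj unfolding m[symmetric] by simp
  also have "\<dots> = minor p M 1 2 3 4 * (b3 * (M$2$j) ^ p - b2 * (M$1$j) ^ p + b1 * M$2$j - b0 * M$1$j)"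
    using minor1234 by (simp add: beta0_def beta1_def beta2_def beta3_def algebra_simps)
  finally show ?thesis
    using minor1234 by simp
qed

text \<open>Cramer's rule for row 7 over rows 1, 2, 3, 5. The coefficient of row 2 is a multiple of
  the minor 1357, so its vanishing leaves a relation among Frobenius powers of the first row of
  \<open>M\<close> alone.\<close>

lemma row7: "(M$1$j) ^ p ^ 3 + a2 * (M$1$j) ^ p\<^sup>2 + a1 * (M$1$j) ^ p + a0 * M$1$j = 0"
proof -
  define r where "r = (\<lambda>i. Gamma_row p M i)"
  have m: "minor p M i j k l = det (vector [r i, r j, r k, r l] :: 'a^4^4)" for i j k l
    by (simp add: minor_def r_def)
  have s: "det (vector [r 7, r 2, r 3, r 5] :: 'a^4^4) = - minor p M 2 3 5 7"
    "det (vector [r 1, r 7, r 3, r 5] :: 'a^4^4) = minor p M 1 3 5 7"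
    "det (vector [r 1, r 2, r 7, r 5] :: 'a^4^4) = - minor p M 1 2 5 7"
    unfolding m
    using det_4_swap(1)[of "r 2" "r 7" "r 3" "r 5"] det_4_swap(2)[of "r 2" "r 3" "r 7" "r 5"]
      det_4_swap(3)[of "r 2" "r 3" "r 7" "r 5"]
      det_4_swap(2)[of "r 1" "r 3" "r 7" "r 5"] det_4_swap(3)[of "r 1" "r 3" "r 7" "r 5"]
      det_4_swap(3)[of "r 1" "r 2" "r 7" "r 5"] by simp_all
  have rj: "r 1 $ j = M$1$j" "r 3 $ j = (M$1$j) ^ p"
    "r 5 $ j = (M$1$j) ^ p\<^sup>2" "r 7 $ j = (M$1$j) ^ p ^ 3"
    by (simp_all add: r_def Gamma_row_def)
  have "minor p M 1 2 3 5 * (M$1$j) ^ p ^ 3 = - minor p M 2 3 5 7 * M$1$j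
      - minor p M 1 2 5 7 * (M$1$j) ^ p + minor p M 1 2 3 7 * (M$1$j) ^ p\<^sup>2"
    using cramer_4[of "r 1" "r 2" "r 3" "r 5" "r 7" j] unfolding s rj unfolding m[symmetric] minor1357 by simp
  then show ?thesis
    using minor1235 by (simp add: alpha0_def alpha1_def alpha2_def field_simps)
qed

subsection \<open>The translation lattice\<close>

abbreviation "u \<equiv> ushift M"
abbreviation "v \<equiv> vshift M"

lemma u_power_p: "u a ^ (p ^ k) = (\<Sum>j\<in>UNIV. of_nat (a j) * (M$1$j) ^ (p ^ k))"
  and v_power_p: "v a ^ (p ^ k) = (\<Sum>j\<in>UNIV. of_nat (a j) * (M$2$j) ^ (p ^ k))"
  by (simp_all add: ushift_def vshift_def sum_power_p power_mult_distrib of_nat_power_p)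

lemma u_root: "u a ^ p ^ 3 + a2 * u a ^ p\<^sup>2 + a1 * u a ^ p + a0 * u a = 0"
proof -
  have "u a ^ p ^ 3 + a2 * u a ^ p ^ 2 + a1 * u a ^ p ^ 1 + a0 * u a ^ p ^ 0
      = (\<Sum>j\<in>UNIV. of_nat (a j) * ((M$1$j) ^ p ^ 3 + a2 * (M$1$j) ^ p\<^sup>2 + a1 * (M$1$j) ^ p + a0 * M$1$j))"
    unfolding u_power_p by (simp add: sum_4 algebra_simps)
  then show ?thesis by (simp add: row7)
qed

lemma uv_relation: "u a ^ p\<^sup>2 - b3 * v a ^ p + b2 * u a ^ p - b1 * v a + b0 * u a = 0"
proof -
  have "u a ^ p ^ 2 - b3 * v a ^ p ^ 1 + b2 * u a ^ p ^ 1 - b1 * v a ^ p ^ 0 + b0 * u a ^ p ^ 0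
      = (\<Sum>j\<in>UNIV. of_nat (a j) * ((M$1$j) ^ p\<^sup>2 - b3 * (M$2$j) ^ p + b2 * (M$1$j) ^ p - b1 * M$2$j + b0 * M$1$j))"
    unfolding u_power_p v_power_p by (simp add: sum_4 algebra_simps)
  then show ?thesis by (simp add: row5)
qed

text \<open>The difference \<open>d\<close> of two exponent vectors has entries fixed by Frobenius.
  Hence equality of \<open>u\<close> and of \<open>v\<close> also gives equality of their p-th
  powers, and \<open>d\<close> lies in the kernel of the matrix with rows 1 to 4, whose determinant
  is nonzero.\<close>

lemma inj_uv: "inj_on (\<lambda>a. (u a, v a)) (E_exps p)"
proof (rule inj_onI)
  fix a b assume a: "a \<in> E_exps p" and b: "b \<in> E_exps p" and eq: "(u a, v a) = (u b, v b)"
  define d where "d = (\<lambda>j. of_nat (a j) - of_nat (b j) :: 'a)"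
  have U: "(\<Sum>j\<in>UNIV. d j * (M$1$j) ^ (p ^ k)) = 0" and V: "(\<Sum>j\<in>UNIV. d j * (M$2$j) ^ (p ^ k)) = 0" for k
    using eq u_power_p[of a k] u_power_p[of b k] v_power_p[of a k] v_power_p[of b k]
    by (simp_all add: d_def left_diff_distrib sum_subtractf)
  let ?A = "vector [Gamma_row p M 1, Gamma_row p M 2, Gamma_row p M 3, Gamma_row p M 4] :: 'a^4^4"
  have "(\<Sum>j\<in>UNIV. ?A $ i $ j * d j) = 0" for i
    using exhaust_4[of i] U[of 0] U[of 1] V[of 0] V[of 1]
    by (elim disjE) (simp_all add: Gamma_row_def mult.commute)
  then have "d j = 0" for j
    using minor1234 unfolding minor_def by (intro det_nonzero_imp_kernel_0[of ?A d j])
  then have *: "of_nat (a j) = (of_nat (b j) :: 'a)" for j by (simp add: d_def)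
  have no: "of_nat m \<noteq> (of_nat n :: 'a)" if "m < n" "n < p" for m n
  proof -
    have "\<not> p dvd n - m" using that by (auto dest: dvd_imp_le)
    then show ?thesis using of_nat_eq_iff_char_dvd[OF that(1), where 'a='a] CHAR_p by simp
  qed
  have "a j = b j" for j
  proof -
    have "a j < p" "b j < p" using a b by (auto simp: E_exps_def)
    then show ?thesis using *[of j] no[of "a j" "b j"] no[of "b j" "a j"] by (metis linorder_neqE_nat)
  qed
  then show "a = b" by (rule ext)
qed

definition U where "U = u ` E_exps p"
definition V where "V c = {d. \<exists>a\<in>E_exps p. u a = c \<and> v a = d}"

definition n_poly :: "'a poly" where
  "n_poly = monom 1 (p ^ 3) + monom a2 (p\<^sup>2) + monom a1 p + monom a0 1"

lemma p_powers: "1 < p" "p < p\<^sup>2" "p\<^sup>2 < p ^ 3" "p < p ^ 3" "1 < p\<^sup>2" "1 < p ^ 3"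
proof -
  show p: "1 < p" using p_gt_2 by simp
  show "p < p\<^sup>2" using power_strict_increasing[of 1 2 p] p by simp
  show "p\<^sup>2 < p ^ 3" using power_strict_increasing[of 2 3 p] p by simp
  show "p < p ^ 3" using power_strict_increasing[of 1 3 p] p by simp
  show "1 < p\<^sup>2" "1 < p ^ 3" using p by (rule one_less_power; simp)+
qed

lemma poly_n_poly: "poly n_poly t = t ^ p ^ 3 + a2 * t ^ p\<^sup>2 + a1 * t ^ p + a0 * t"
  by (simp add: n_poly_def poly_monom)

lemma coeff_n_poly:
  "coeff n_poly i = (if i = p ^ 3 then 1 else if i = p\<^sup>2 then a2 else if i = p then a1 else if i = 1 then a0 else 0)"
  using p_powers by (auto simp: n_poly_def)

lemma degree_n_poly: "degree n_poly = p ^ 3"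
proof (rule antisym)
  show "degree n_poly \<le> p ^ 3"
    using p_powers by (intro degree_le) (auto simp: coeff_n_poly)
  show "p ^ 3 \<le> degree n_poly"
    by (rule le_degree) (simp add: coeff_n_poly)
qed

lemma finite_U: "finite U"
  by (simp add: U_def finite_E_exps)

lemma card_U_le: "card U \<le> p ^ 3"
proof -
  have nz: "n_poly \<noteq> 0" using degree_n_poly p_powers by auto
  have "card U \<le> card {t. poly n_poly t = 0}"
    using nz by (intro card_mono poly_roots_finite) (auto simp: U_def poly_n_poly u_root)
  also have "\<dots> \<le> p ^ 3" using card_poly_roots_bound[OF nz] by (simp add: degree_n_poly)
  finally show ?thesis .
qed

lemma V_bound: "finite (V c)" "card (V c) \<le> p"
proof -
  \<comment> \<open>This is \<open>uv_relation\<close> with the value \<open>c\<close> of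
    \<open>u\<close> held fixed, read as a polynomial in \<open>v\<close>; its degree is p because
    \<open>b3\<close> is nonzero.\<close>
  define g where "g = monom (- b3) p + monom (- b1) 1 + [:c ^ p\<^sup>2 + b2 * c ^ p + b0 * c:]"
  have "coeff g p = - b3" using p_gt_2 by (simp add: g_def coeff_pCons split: nat.splits)
  then have nz: "g \<noteq> 0" using b3_nz by auto
  have deg: "degree g \<le> p"
    unfolding g_def using p_gt_2
    by (intro degree_add_le) (auto intro: order.trans[OF degree_monom_le])
  have "V c \<subseteq> {t. poly g t = 0}"
    using uv_relation by (auto simp: V_def g_def poly_monom algebra_simps)
  moreover have "finite {t. poly g t = 0}" using nz by (rule poly_roots_finite)
  ultimately show "finite (V c)" "card (V c) \<le> p"
    using card_poly_roots_bound[OF nz] deg by (auto intro: finite_subset dest: card_mono)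
qed

text \<open>The p^4 distinct pairs lie over at most p^3 values of \<open>u\<close>, with at most p
  of them over each, so neither bound can be strict.\<close>

lemma card_U: "card U = p ^ 3" and card_V: "c \<in> U \<Longrightarrow> card (V c) = p"
proof -
  have img: "(\<lambda>a. (u a, v a)) ` E_exps p = Sigma U V"
  proof (intro set_eqI iffI)
    fix w assume "w \<in> Sigma U V"
    then obtain a where "a \<in> E_exps p" "w = (u a, v a)"
      by (auto simp: U_def V_def)
    then show "w \<in> (\<lambda>a. (u a, v a)) ` E_exps p" by blast
  qed (auto simp: U_def V_def)
  have "card (Sigma U V) = p ^ 4"
    unfolding img[symmetric] by (simp add: card_image[OF inj_uv] card_E_exps)
  then have sum: "(\<Sum>c\<in>U. card (V c)) = p ^ 4"
    by (simp add: card_SigmaI finite_U V_bound)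
  have "p ^ 4 \<le> card U * p"
    unfolding sum[symmetric] using sum_bounded_above[of U "\<lambda>c. card (V c)" p] V_bound by simp
  then have "p ^ 3 * p \<le> card U * p" by (simp add: power4_eq_xxxx power3_eq_cube)
  then have "p ^ 3 \<le> card U" using p_gt_0 by simp
  then show c: "card U = p ^ 3" using card_U_le by simp
  show "card (V c) = p" if "c \<in> U"
  proof (rule ccontr)
    assume "card (V c) \<noteq> p"
    then have "(\<Sum>c\<in>U. card (V c)) < (\<Sum>c\<in>U. p)"
      using V_bound that by (intro sum_strict_mono_ex1[OF finite_U]) (auto intro!: bexI[of _ c] simp: order.strict_iff_order)
    then show False unfolding sum using c by (simp add: power4_eq_xxxx power3_eq_cube)
  qed
qed

text \<open>If \<open>a0\<close> were zero, \<open>u_root\<close> would be an equation of degree p^2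
  in \<open>u ^ p\<close>. Frobenius is injective, so the p^3 elements of \<open>U\<close> would
  give p^3 roots. This is the source of the nonvanishing of the minor 2357 in the denominator of
  \<open>h3\<close>.\<close>

lemma a0_nz: "a0 \<noteq> 0"
proof
  assume "a0 = 0"
  define q where "q = monom 1 (p\<^sup>2) + monom a2 p + monom a1 1"
  have "coeff q (p\<^sup>2) = 1" using p_powers by (simp add: q_def)
  then have nz: "q \<noteq> 0" by auto
  have deg: "degree q \<le> p\<^sup>2"
    unfolding q_def using p_powers
    by (intro degree_add_le) (auto intro: order.trans[OF degree_monom_le])
  have inj: "inj_on (\<lambda>t. t ^ p) U"
    using diff_power_p[of _ _ 1] by (intro inj_onI) (metis eq_iff_diff_eq_0 power_one_right power_eq_0_iff)
  have "(\<lambda>t. t ^ p) ` U \<subseteq> {t. poly q t = 0}"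
    using u_root \<open>a0 = 0\<close>
    by (auto simp: U_def q_def poly_monom power_mult[symmetric] power2_eq_square power3_eq_cube mult.assoc)
  then have "card ((\<lambda>t. t ^ p) ` U) \<le> p\<^sup>2"
    using card_mono[OF poly_roots_finite[OF nz]] card_poly_roots_bound[OF nz] deg by (meson order.trans)
  then show False using p_powers by (simp add: card_image[OF inj] card_U)
qed

end

lemma single_eq_single_iff: "Poly_Mapping.single i n = Poly_Mapping.single j n \<longleftrightarrow> i = j \<or> n = 0"
  by (metis lookup_single_eq lookup_single_not_eq single_zero)

lemma Var_neq_0 [simp]: "Var i \<noteq> (0 :: ('v, 'a::zero_neq_one) mpoly)"
  by (simp add: Var_def Mon_def flip: keys_eq_empty)

subsection \<open>Orbit products\<close>

text \<open>Homogenisation to degree \<open>d\<close>, intended for \<open>d\<close> at least the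
  degree of the polynomial; it carries products over the roots to products of linear forms in y and
  x.\<close>

definition hom_poly :: "nat \<Rightarrow> 'a::field poly \<Rightarrow> 'a xpoly" where
  "hom_poly d q = (\<Sum>i\<le>d. Const (coeff q i) * Y ^ i * X ^ (d - i))"

lemma hom_poly_add: "hom_poly d (q + r) = hom_poly d q + hom_poly d r"
  by (simp add: hom_poly_def Const_add distrib_right sum.distrib)

lemma hom_poly_monom: "k \<le> d \<Longrightarrow> hom_poly d (monom c k) = Const c * Y ^ k * X ^ (d - k)"
proof -
  assume "k \<le> d"
  have "hom_poly d (monom c k) = (\<Sum>i\<le>d. if i = k then Const c * Y ^ k * X ^ (d - k) else 0)"
    unfolding hom_poly_def by (intro sum.cong) auto
  then show ?thesis using \<open>k \<le> d\<close> by simp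
qed

lemma hom_poly_linear_mult:
  assumes "degree q \<le> d"
  shows "hom_poly (Suc d) ([:c, 1:] * q) = (Y + Const c * X) * hom_poly d q"
proof -
  have "hom_poly (Suc d) (smult c q) = (\<Sum>i\<le>d. Const (c * coeff q i) * Y ^ i * X ^ (Suc d - i))"
    unfolding hom_poly_def sum.atMost_Suc using coeff_eq_0[of q "Suc d"] assms by simp
  also have "\<dots> = (\<Sum>i\<le>d. Const c * X * (Const (coeff q i) * Y ^ i * X ^ (d - i)))"
  proof (rule sum.cong)
    fix i assume "i \<in> {..d}"
    then have "X ^ (Suc d - i) = (X * X ^ (d - i) :: 'a xpoly)" by (simp add: Suc_diff_le)
    then show "Const (c * coeff q i) * Y ^ i * X ^ (Suc d - i) = Const c * X * (Const (coeff q i) * Y ^ i * X ^ (d - i))"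
      by (simp only: Const_mult mult_ac)
  qed simp
  finally have 1: "hom_poly (Suc d) (smult c q) = Const c * X * hom_poly d q"
    by (simp add: hom_poly_def sum_distrib_left)
  have "hom_poly (Suc d) (pCons 0 q) = (\<Sum>i\<le>d. Const (coeff q i) * Y ^ Suc i * X ^ (Suc d - Suc i))"
    unfolding hom_poly_def by (subst sum.atMost_Suc_shift) simp
  also have "\<dots> = Y * hom_poly d q"
    by (simp add: hom_poly_def sum_distrib_left mult_ac)
  finally show ?thesis
    using 1 by (simp add: hom_poly_add algebra_simps)
qed

lemma prod_linear:
  fixes A :: "'a::field set"
  assumes "finite A"
  shows "degree (\<Prod>c\<in>A. [:c, 1:]) = card A" "coeff (\<Prod>c\<in>A. [:c, 1:]) (card A) = 1"
    "hom_poly (card A) (\<Prod>c\<in>A. [:c, 1:]) = (\<Prod>c\<in>A. Y + Const c * X)"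
proof -
  show deg: "degree (\<Prod>c\<in>A. [:c, 1:]) = card A" for A :: "'a set"
    by (subst degree_prod_eq_sum_degree) auto
  have "lead_coeff (\<Prod>c\<in>A. [:c, 1:]) = 1"
    by (simp add: lead_coeff_prod)
  then show "coeff (\<Prod>c\<in>A. [:c, 1:]) (card A) = 1" by (simp add: deg)
  show "hom_poly (card A) (\<Prod>c\<in>A. [:c, 1:]) = (\<Prod>c\<in>A. Y + Const c * X)"
    using assms
  proof induction
    case empty
    then show ?case by (simp add: hom_poly_def)
  next
    case (insert c A)
    then show ?case using hom_poly_linear_mult[of "\<Prod>c\<in>A. [:c, 1:]" "card A" c] by (simp add: deg)
  qed
qed

context claim_matrix
begin

lemma add_mpoly_power_p: "(f + g :: 'a xpoly) ^ (p ^ k) = f ^ (p ^ k) + g ^ (p ^ k)"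
  using freshmans_dream'[OF prime_CHAR_mpoly refl, of f g k] by (simp add: CHAR_p)

lemma diff_mpoly_power_p: "(f - g :: 'a xpoly) ^ (p ^ k) = f ^ (p ^ k) - g ^ (p ^ k)"
  using add_mpoly_power_p[of "f - g" g k] by simp

lemma two_nz: "(2 :: 'a) \<noteq> 0"
proof -
  have "\<not> p dvd 2" using p_gt_2 by (auto dest: dvd_imp_le)
  then show ?thesis using of_nat_eq_0_iff_char_dvd[where 'a='a, of 2] CHAR_p by simp
qed

lemma subalgebra_invariants: "subalgebra (invariants p M)"
  by (auto simp: subalgebra_def invariants_def act_eq_transl transl_hom)

lemma X_inv: "X \<in> invariants p M"
  by (simp add: invariants_def act_eq_transl transl_hom)

lemma inv_cancel:
  assumes "f * g \<in> invariants p M" "f \<in> invariants p M" "f \<noteq> 0"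
  shows "g \<in> invariants p M"
  unfolding invariants_def
proof safe
  fix a assume a: "a \<in> E_exps p"
  have "f * act M a g = act M a f * act M a g" using assms(2) a by (simp add: invariants_def)
  also have "\<dots> = f * g" using assms(1) a by (simp add: invariants_def act_eq_transl transl_hom)
  finally show "act M a g = g" using assms(3) by simp
qed

lemma u_v_add_mod: "u (\<lambda>j. (a j + b j) mod p) = u a + u b" "v (\<lambda>j. (a j + b j) mod p) = v a + v b"
proof -
  have "of_nat (n mod p) = (of_nat n :: 'a)" for n
  proof -
    have "(of_nat p :: 'a) = 0" using CHAR_p of_nat_CHAR[where 'a='a] by simp
    then have "(of_nat (p * (n div p) + n mod p) :: 'a) = of_nat (n mod p)"
      by (simp only: of_nat_add of_nat_mult) simp
    then show ?thesis by (simp only: mult_div_mod_eq)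
  qed
  then show "u (\<lambda>j. (a j + b j) mod p) = u a + u b" "v (\<lambda>j. (a j + b j) mod p) = v a + v b"
    by (simp_all add: ushift_def vshift_def distrib_right sum.distrib)
qed

lemma orbit_norm_inv: "orbit_norm p M f \<in> invariants p M"
  unfolding invariants_def
proof safe
  fix a assume a: "a \<in> E_exps p"
  let ?O = "(\<lambda>b. act M b f) ` E_exps p"
  have inj: "inj_on (act M a) ?O"
    by (rule inj_on_inverseI[of _ "transl (- u a) (- v a)"]) (simp add: act_eq_transl transl_transl transl_0)
  have "act M a (act M b f) = act M (\<lambda>j. (a j + b j) mod p) f" for b
    by (simp add: act_eq_transl transl_transl u_v_add_mod)
  moreover have "(\<lambda>j. (a j + b j) mod p) \<in> E_exps p" for b
    using p_gt_0 by (simp add: E_exps_def)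
  ultimately have "act M a ` ?O \<subseteq> ?O" by auto
  then have img: "act M a ` ?O = ?O"
    using inj finite_E_exps by (intro endo_inj_surj) auto
  have "act M a (orbit_norm p M f) = (\<Prod>g\<in>?O. act M a g)"
    by (simp add: orbit_norm_def act_eq_transl transl_prod)
  also have "\<dots> = (\<Prod>g\<in>act M a ` ?O. g)"
    by (simp add: prod.reindex[OF inj])
  also have "\<dots> = orbit_norm p M f"
    by (simp add: img orbit_norm_def)
  finally show "act M a (orbit_norm p M f) = orbit_norm p M f" .
qed

text \<open>The product vanishes at the negatives of \<open>U\<close>. As p is odd,
  \<open>n_poly\<close> is an odd function and vanishes there too, and two monic polynomials of
  degree p^3 with p^3 common zeros coincide.\<close>

lemma n_poly_eq_prod: "n_poly = (\<Prod>c\<in>U. [:c, 1:])"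
proof (rule poly_eqI_degree_lead_coeff[where n = "p ^ 3" and A = "uminus ` U"])
  show "coeff n_poly (p ^ 3) = coeff (\<Prod>c\<in>U. [:c, 1:]) (p ^ 3)"
    using prod_linear(2)[OF finite_U] by (simp add: coeff_n_poly card_U)
  show "p ^ 3 \<le> card (uminus ` U)" by (simp add: card_image card_U)
  show "degree n_poly \<le> p ^ 3" by (simp add: degree_n_poly)
  show "degree (\<Prod>c\<in>U. [:c, 1:]) \<le> p ^ 3" using prod_linear(1)[OF finite_U] by (simp add: card_U)
  fix t assume "t \<in> uminus ` U"
  then obtain a where t: "t = - u a" "- t \<in> U" by (auto simp: U_def)
  have "poly n_poly t = - poly n_poly (u a)"
    using odd_p by (simp add: t poly_n_poly)
  moreover have "poly n_poly (u a) = 0" using u_root by (simp add: poly_n_poly)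
  moreover have "poly (\<Prod>c\<in>U. [:c, 1:]) t = 0"
    unfolding poly_prod using t(2) finite_U by (intro prod_zero) (auto intro!: bexI[of _ "- t"])
  ultimately show "poly n_poly t = poly (\<Prod>c\<in>U. [:c, 1:]) t" by simp
qed

lemma orbit_norm_Y:
  "orbit_norm p M Y = Y ^ p ^ 3 + Const a2 * Y ^ p\<^sup>2 * X ^ (p ^ 3 - p\<^sup>2)
     + Const a1 * Y ^ p * X ^ (p ^ 3 - p) + Const a0 * Y * X ^ (p ^ 3 - 1)"
proof -
  have O: "(\<lambda>a. act M a Y) ` E_exps p = (\<lambda>c. Y + Const c * X) ` U"
    by (auto simp: U_def act_eq_transl transl_hom)
  have inj: "inj_on (\<lambda>c. Y + Const c * X) U"
    by (rule inj_onI) simp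
  have "orbit_norm p M Y = (\<Prod>c\<in>U. Y + Const c * X)"
    unfolding orbit_norm_def O by (simp add: prod.reindex[OF inj])
  also have "\<dots> = hom_poly (p ^ 3) n_poly"
    using prod_linear(3)[OF finite_U] by (simp add: n_poly_eq_prod card_U)
  also have "\<dots> = Y ^ p ^ 3 + Const a2 * Y ^ p\<^sup>2 * X ^ (p ^ 3 - p\<^sup>2)
     + Const a1 * Y ^ p * X ^ (p ^ 3 - p) + Const a0 * Y * X ^ (p ^ 3 - 1)"
    using p_powers by (simp add: n_poly_def hom_poly_add hom_poly_monom)
  finally show ?thesis .
qed

abbreviation "NZ \<equiv> orbit_norm p M Z"

definition Zfac :: "(4 \<Rightarrow> nat) \<Rightarrow> 'a xpoly" where
  "Zfac a = Z + Const (2 * u a) * Y + Const ((u a)\<^sup>2 + v a) * X"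

text \<open>The norm is a product over distinct orbit elements. The coefficients of y and x in
  \<open>Zfac a\<close> recover first \<open>u\<close>, since 2 is invertible, and then
  \<open>v\<close>, so by \<open>inj_uv\<close> the orbit is regular and all p^4 factors
  occur.\<close>

lemma NZ_eq: "NZ = (\<Prod>a\<in>E_exps p. Zfac a)"
proof -
  have act: "act M a Z = Zfac a" for a
    by (simp add: act_eq_transl transl_hom Zfac_def)
  have lk: "lookup (Zfac a) (Poly_Mapping.single VY 1) = 2 * u a"
    "lookup (Zfac a) (Poly_Mapping.single VX 1) = (u a)\<^sup>2 + v a" for a
    by (simp_all add: Zfac_def lookup_add Var_def Mon_def lookup_single when_def single_eq_single_iff)
  have "inj_on Zfac (E_exps p)"
  proof (rule inj_onI)
    fix a b assume ab: "a \<in> E_exps p" "b \<in> E_exps p" and "Zfac a = Zfac b"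
    then have "u a = u b" "v a = v b" using lk[of a] lk[of b] two_nz by simp_all
    then show "a = b" using inj_uv ab by (auto dest: inj_onD)
  qed
  then show ?thesis
    unfolding orbit_norm_def act by (simp add: prod.reindex)
qed

text \<open>Evaluates the constant sums by which \<open>is_lead_power\<close> and
  \<open>is_lead_prod\<close> express multiples of an exponent.\<close>

lemma sum_xyzm: "(\<Sum>i\<in>I. xyzm a b c) = xyzm (card I * a) (card I * b) (card I * c)"
  by (simp add: xyz_mon_eq_iff lookup_sum lookup_add lookup_single)

lemma keys_Zfac: "keys (Zfac a) \<subseteq> {xyzm 0 0 1, xyzm 0 1 0, xyzm 1 0 0}" "xyzm 0 0 1 \<in> keys (Zfac a)"
proof -
  show "keys (Zfac a) \<subseteq> {xyzm 0 0 1, xyzm 0 1 0, xyzm 1 0 0}"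
    by (auto simp: Zfac_def Var_def Const_mult_Mon Mon_def Const_def mult_single dest!: in_keys_addD split: if_splits)
  show "xyzm 0 0 1 \<in> keys (Zfac a)"
    by (simp add: in_keys_iff Zfac_def lookup_add Var_def Mon_def lookup_single when_def single_eq_single_iff)
qed

lemma lead_NZ: "is_lead grevlex_less NZ (xyzm 0 0 (p ^ 4))"
proof -
  have "is_lead grevlex_less (Zfac a) (xyzm 0 0 1)" for a
    using keys_Zfac[of a] by (auto simp: is_lead_def grevlex_less_def mdeg_def lookup_single)
  then have "is_lead grevlex_less NZ (\<Sum>a\<in>E_exps p. xyzm 0 0 1)"
    unfolding NZ_eq by (rule grevlex.is_lead_prod)
  then show ?thesis unfolding sum_xyzm by (simp add: card_E_exps)
qed

lemma wt_lead_NZ: "is_lead wt_less NZ (xyzm 0 0 (p ^ 4))"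
proof -
  have "is_lead wt_less (Zfac a) (xyzm 0 0 1)" for a
    using keys_Zfac[of a] by (auto simp: is_lead_def wt_less_def wt_def lookup_single)
  then have "is_lead wt_less NZ (\<Sum>a\<in>E_exps p. xyzm 0 0 1)"
    unfolding NZ_eq by (rule wt.is_lead_prod)
  then show ?thesis unfolding sum_xyzm by (simp add: card_E_exps)
qed

end

lemma exact_quot_eqI:
  fixes f :: "(xyz, 'a::field) mpoly"
  shows "g \<noteq> 0 \<Longrightarrow> f = h * g \<Longrightarrow> exact_quot f g = h"
  unfolding exact_quot_def by (rule the_equality) auto

lemma homogeneous_delta: "homogeneous 2 delta"
  unfolding delta_def
  using homogeneous_Var_power[of 2 VY] homogeneous_mult[OF homogeneous_Var homogeneous_Var, of VX VZ]
  by (intro homogeneous_diff) (simp_all add: numeral_2_eq_2)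

lemma homogeneous_multI:
  "homogeneous d f \<Longrightarrow> homogeneous e g \<Longrightarrow> d + e = n \<Longrightarrow> homogeneous n (f * g)"
  using homogeneous_mult by blast

lemma homogeneous_powerI: "homogeneous d f \<Longrightarrow> k * d = n \<Longrightarrow> homogeneous n (f ^ k)"
  for f :: "(xyz, 'a::comm_semiring_1) mpoly"
  using homogeneous_power by blast

lemma wt_le_multI: "wt_le v f \<Longrightarrow> wt_le w g \<Longrightarrow> v + w \<le> n \<Longrightarrow> wt_le n (f * g)"
  using wt_le_mult wt_le_mono by blast

lemma wt_le_powerI: "wt_le w f \<Longrightarrow> k * w \<le> n \<Longrightarrow> wt_le n (f ^ k)"
  for f :: "(xyz, 'a::comm_semiring_1) mpoly"
  using wt_le_power wt_le_mono by blast

lemma wt_le_delta: "wt_le 2 delta"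
  unfolding delta_def
  by (intro wt_le_diff wt_le_powerI[OF wt_le_Y] wt_le_multI[OF wt_le_X wt_le_Z]) simp_all

section \<open>Congruences modulo powers of x\<close>

definition xcong :: "nat \<Rightarrow> (xyz, 'a::field) mpoly \<Rightarrow> 'a xpoly \<Rightarrow> bool" where
  "xcong k f g \<longleftrightarrow> X ^ k dvd f - g"

lemma xcong_refl [simp]: "xcong k f f"
  by (simp add: xcong_def)

lemma xcong_add: "xcong k f g \<Longrightarrow> xcong k f' g' \<Longrightarrow> xcong k (f + f') (g + g')"
  unfolding xcong_def using dvd_add[of "X ^ k" "f - g" "f' - g'"] by (simp add: algebra_simps)

lemma xcong_diff: "xcong k f g \<Longrightarrow> xcong k f' g' \<Longrightarrow> xcong k (f - f') (g - g')"
  unfolding xcong_def using dvd_diff[of "X ^ k" "f - g" "f' - g'"] by (simp add: algebra_simps)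

lemma xcong_mult: "xcong k f g \<Longrightarrow> xcong k f' g' \<Longrightarrow> xcong k (f * f') (g * g')"
proof -
  assume a: "xcong k f g" "xcong k f' g'"
  have "f * f' - g * g' = (f - g) * f' + g * (f' - g')" by (simp add: algebra_simps)
  then show ?thesis using a unfolding xcong_def by (metis dvd_add dvd_mult dvd_mult2)
qed

lemma xcong_power: "xcong k f g \<Longrightarrow> xcong k (f ^ n) (g ^ n)"
  by (induction n) (simp_all add: xcong_mult)

lemma xcong_trans: "xcong k f g \<Longrightarrow> xcong k g h \<Longrightarrow> xcong k f h"
  unfolding xcong_def using dvd_add[of "X ^ k" "f - g" "g - h"] by simp

lemma xcong_X_mult: "xcong k f g \<Longrightarrow> n \<le> j + k \<Longrightarrow> xcong n (X ^ j * f) (X ^ j * g)"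
proof -
  assume "xcong k f g" "n \<le> j + k"
  then have "X ^ (j + k) dvd X ^ j * (f - g)"
    unfolding xcong_def by (simp add: power_add mult_dvd_mono)
  then show ?thesis
    using \<open>n \<le> j + k\<close> unfolding xcong_def right_diff_distrib[symmetric] by (meson dvd_trans le_imp_power_dvd)
qed

lemma xcong_add_X: "n \<le> k \<Longrightarrow> xcong n (f + X ^ k * g) f"
  unfolding xcong_def by (simp add: le_imp_power_dvd)

section \<open>Expansions of f1, N(y) and h2 in powers of x\<close>

context claim_matrix
begin

text \<open>The power of x in front of \<open>delta ^ p\<close> in \<open>f1_hat\<close>. Written
  through q and p, exponents are sums. Always p <= q, but 2p <= q fails exactly for p = 3, where q =
  3.\<close>

definition q where "q = p\<^sup>2 - 2 * p"

lemma p2_eq: "p\<^sup>2 = q + 2 * p"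
proof -
  have "2 * p \<le> p\<^sup>2" using p_gt_2 by (simp add: power2_eq_square)
  then show ?thesis by (simp add: q_def)
qed

lemma p3_eq: "p ^ 3 = p * q + 2 * p\<^sup>2"
proof -
  have "p ^ 3 = p * p\<^sup>2" by (simp add: power3_eq_cube power2_eq_square)
  also have "\<dots> = p * q + 2 * (p * p)" by (simp add: p2_eq distrib_left)
  finally show ?thesis by (simp add: power2_eq_square)
qed

lemma p_le_q: "p \<le> q"
proof -
  have "3 * p \<le> p\<^sup>2" using p_gt_2 by (simp add: power2_eq_square)
  then show ?thesis by (simp add: p2_eq)
qed

lemma two_p_le_q: "p \<noteq> 3 \<Longrightarrow> 2 * p \<le> q"
proof -
  assume "p \<noteq> 3"
  then have "4 \<le> p" using p_gt_2 by simp
  then have "4 * p \<le> p\<^sup>2" by (simp add: power2_eq_square)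
  then show ?thesis by (simp add: p2_eq)
qed

lemma expo:
  "p\<^sup>2 - 2 * p = q" "p\<^sup>2 - p = q + p" "p\<^sup>2 - 2 = q + (2 * p - 2)" "p\<^sup>2 - 1 = q + (2 * p - 1)"
  "p * (2 * p - 2) = p\<^sup>2 + q" "p * (2 * p - 1) = p\<^sup>2 + q + p"
  "2 * p\<^sup>2 - 1 = p\<^sup>2 + q + (2 * p - 1)" "2 * p\<^sup>2 - p = p\<^sup>2 + q + p" "2 * p\<^sup>2 - 2 * p = p\<^sup>2 + q"
  "p ^ 3 - 2 * p\<^sup>2 = p * q" "p ^ 3 - p\<^sup>2 = p * q + p\<^sup>2" "p ^ 3 - p = p * q + (p\<^sup>2 + q + p)"
  "p ^ 3 - 1 = p * q + (p\<^sup>2 + q + (2 * p - 1))" "p ^ 3 - p\<^sup>2 - 2 * p = p * q + q"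
proof -
  have "p * (2 * p - 2) = 2 * p\<^sup>2 - 2 * p" "p * (2 * p - 1) = 2 * p\<^sup>2 - p"
    by (simp_all add: power2_eq_square diff_mult_distrib2)
  then show "p * (2 * p - 2) = p\<^sup>2 + q" "p * (2 * p - 1) = p\<^sup>2 + q + p"
    by (simp_all add: p2_eq)
qed (use p_gt_2 in \<open>simp_all add: p3_eq p2_eq\<close>)

abbreviation "F1 \<equiv> f1_hat p M"
abbreviation "H2 \<equiv> h2 p M"
abbreviation "H3 \<equiv> h3 p M"
abbreviation "NY \<equiv> orbit_norm p M Y"
abbreviation S :: "'a xpoly" where "S \<equiv> X ^ q"
abbreviation Yq :: "'a xpoly" where "Yq \<equiv> Y ^ p\<^sup>2"

text \<open>What remains of f1 after its lead power y^(p^2), divided by x^q; \<open>n_tail\<close>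
  is likewise what remains of N(y) after y^(p^3), divided by x^(p q).\<close>

definition eps :: "'a xpoly" where
  "eps = Const b3 * delta ^ p + Const b2 * Y ^ p * X ^ p + Const b1 * delta * X ^ (2 * p - 2)
     + Const b0 * Y * X ^ (2 * p - 1)"

definition n_tail :: "'a xpoly" where
  "n_tail = X ^ p\<^sup>2 * (Const a2 * Yq + Const a1 * Y ^ p * X ^ (q + p) + Const a0 * Y * X ^ (q + (2 * p - 1)))"

text \<open>The quotient by x^(p^2) of \<open>n_tail - eps ^ p\<close> after the cancellation of its
  multiple of y^(2p^2). The power of z comes from delta^(p^2) = y^(2p^2) - x^(p^2) z^(p^2) and will
  be the part of \<open>h2\<close> of highest weight.\<close>

definition h2_tail :: "'a xpoly" where
  "h2_tail = Const (b3 ^ p) * Z ^ p\<^sup>2 + (Const (a2 - b2 ^ p) * Yq + Const (a1 - b0 ^ p) * Y ^ p * X ^ (q + p)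
     + Const a0 * Y * X ^ (q + (2 * p - 1)) - Const (b1 ^ p) * delta ^ p * X ^ q)"

lemma F1_eq: "F1 = Yq + S * eps"
  unfolding f1_hat_def eps_def expo power_add by (simp add: algebra_simps)

lemma NY_eq: "NY = Y ^ p ^ 3 + X ^ (p * q) * n_tail"
  unfolding orbit_norm_Y n_tail_def expo power_add by (simp add: algebra_simps)

lemma power_p_hom: "(f + g :: 'a xpoly) ^ p = f ^ p + g ^ p" "(f - g :: 'a xpoly) ^ p = f ^ p - g ^ p"
  using add_mpoly_power_p[of f g 1] diff_mpoly_power_p[of f g 1] by simp_all

lemma Yq_power: "Yq ^ p = Y ^ p ^ 3"
  by (simp add: power_mult[symmetric] power3_eq_cube power2_eq_square mult.assoc)

lemma F1_power_p: "F1 ^ p = Y ^ p ^ 3 + X ^ (p * q) * eps ^ p"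
  unfolding F1_eq power_p_hom power_mult_distrib Yq_power
  by (simp add: power_mult[symmetric] mult.commute)

lemma delta_power: "delta ^ p\<^sup>2 = Yq\<^sup>2 - X ^ p\<^sup>2 * (Z :: 'a xpoly) ^ p\<^sup>2"
  unfolding delta_def diff_mpoly_power_p[of _ _ 2] power_mult_distrib
  by (simp add: power_mult[symmetric] mult.commute)

lemma eps_power_p: "eps ^ p = Const (b3 ^ p) * delta ^ p\<^sup>2 + Const (b2 ^ p) * Yq * X ^ p\<^sup>2
    + Const (b1 ^ p) * delta ^ p * X ^ (p\<^sup>2 + q) + Const (b0 ^ p) * Y ^ p * X ^ (p\<^sup>2 + q + p)"
proof -
  have pw: "(X ^ (2 * p - 2)) ^ p = (X :: 'a xpoly) ^ (p\<^sup>2 + q)"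
    "(X ^ (2 * p - 1)) ^ p = (X :: 'a xpoly) ^ (p\<^sup>2 + q + p)"
    "(f ^ p) ^ p = f ^ p\<^sup>2" for f :: "'a xpoly"
    using expo(5,6) by (simp_all add: power_mult[symmetric] mult.commute power2_eq_square)
  show ?thesis
    unfolding eps_def power_p_hom power_mult_distrib pw Const_power ..
qed

lemma n_tail_eps: "n_tail - eps ^ p + Const (b3 ^ p) * Yq\<^sup>2 = X ^ p\<^sup>2 * h2_tail"
  unfolding eps_power_p delta_power n_tail_def h2_tail_def power_add Const_diff by (simp add: algebra_simps)

text \<open>After x^(p q) is taken out, \<open>n_tail - eps ^ p\<close> still has the term - b3^p
  y^(2p^2), free of x. The summand with the square of f1 in \<open>h2_tilde\<close> is there to
  cancel it; the cross term of that square then carries another x^q, which explains the exponent in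
  the definition of \<open>h2\<close>.\<close>

lemma h2_tilde_eq:
  "h2_tilde p M = X ^ (p * q + q) * (Const (b3 ^ p) * (2 * Yq * eps + S * eps\<^sup>2) + X ^ (2 * p) * h2_tail)"
proof -
  have "h2_tilde p M = X ^ (p * q) * (n_tail - eps ^ p + Const (b3 ^ p) * F1\<^sup>2)"
    unfolding h2_tilde_def NY_eq F1_power_p expo by (simp add: algebra_simps)
  also have "n_tail - eps ^ p + Const (b3 ^ p) * F1\<^sup>2
      = (n_tail - eps ^ p + Const (b3 ^ p) * Yq\<^sup>2) + Const (b3 ^ p) * (2 * Yq * S * eps + S\<^sup>2 * eps\<^sup>2)"
    unfolding F1_eq by (simp add: algebra_simps power2_eq_square)
  also have "\<dots> = S * (Const (b3 ^ p) * (2 * Yq * eps + S * eps\<^sup>2) + X ^ (2 * p) * h2_tail)"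
  proof -
    have "X ^ p\<^sup>2 = S * X ^ (2 * p)" by (simp add: p2_eq power_add)
    then show ?thesis unfolding n_tail_eps by (simp add: algebra_simps power2_eq_square[of S])
  qed
  finally show ?thesis by (simp add: power_add mult.assoc)
qed

definition h2_tail' :: "'a xpoly" where
  "h2_tail' = Const (1 / (2 * b3 ^ (p + 1))) * h2_tail"

lemma X_power_neq_0 [simp]: "(X :: 'a xpoly) ^ n \<noteq> 0"
  by simp

lemma h2_tilde_factor:
  "h2_tilde p M = (Const (1 / b3) * Yq * eps + Const (1 / (2 * b3)) * S * eps\<^sup>2 + X ^ (2 * p) * h2_tail')
    * (Const (2 * b3 ^ (p + 1)) * X ^ (p * q + q))" (is "_ = ?R * _")
proof -
  have c: "Const (2 * b3 ^ (p + 1)) * Const (1 / b3) = Const (b3 ^ p) * (2 :: 'a xpoly)"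
    "Const (2 * b3 ^ (p + 1)) * Const (1 / (2 * b3)) = (Const (b3 ^ p) :: 'a xpoly)"
    "Const (2 * b3 ^ (p + 1)) * h2_tail' = h2_tail"
    using b3_nz two_nz unfolding h2_tail'_def Const_numeral[symmetric]
    by (simp_all add: mult.assoc[symmetric] flip: Const_mult)
  have "?R * Const (2 * b3 ^ (p + 1)) = (Const (2 * b3 ^ (p + 1)) * Const (1 / b3)) * Yq * eps
      + (Const (2 * b3 ^ (p + 1)) * Const (1 / (2 * b3))) * S * eps\<^sup>2 + X ^ (2 * p) * (Const (2 * b3 ^ (p + 1)) * h2_tail')"
    by (simp add: algebra_simps)
  also have "\<dots> = Const (b3 ^ p) * (2 * Yq * eps + S * eps\<^sup>2) + X ^ (2 * p) * h2_tail"
    unfolding c by (simp add: algebra_simps)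
  finally show ?thesis
    unfolding h2_tilde_eq mult.assoc[symmetric] by simp
qed

lemma H2_eq: "H2 = Const (1 / b3) * Yq * eps + Const (1 / (2 * b3)) * S * eps\<^sup>2 + X ^ (2 * p) * h2_tail'"
  unfolding h2_def expo(14) using b3_nz two_nz h2_tilde_factor by (intro exact_quot_eqI) simp_all

lemma h2_tilde_eq_H2: "h2_tilde p M = H2 * (Const (2 * b3 ^ (p + 1)) * X ^ (p * q + q))"
  unfolding H2_eq by (rule h2_tilde_factor)

text \<open>Rewrites \<open>2 b3 S H2 - F1\<^sup>2\<close>, which is the combination that appears in
  \<open>h3_tilde\<close> with the factor \<open>F1 ^ p\<close>.\<close>

lemma H2_relation: "Const (2 * b3) * S * H2 = Const (1 / b3 ^ p) * (n_tail - eps ^ p) + F1\<^sup>2"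
proof -
  have c: "Const (2 * b3) * Const (1 / b3) = (2 :: 'a xpoly)"
    "Const (2 * b3) * Const (1 / (2 * b3)) = (1 :: 'a xpoly)"
    "Const (2 * b3) * h2_tail' = Const (1 / b3 ^ p) * h2_tail"
    "Const (1 / b3 ^ p) * Const (b3 ^ p) = (1 :: 'a xpoly)"
    using b3_nz two_nz unfolding h2_tail'_def Const_numeral[symmetric] Const_1[symmetric]
    by (simp_all add: mult.assoc[symmetric] del: Const_1 flip: Const_mult)
  have "Const (2 * b3) * S * H2 = (Const (2 * b3) * Const (1 / b3)) * S * Yq * eps
    + (Const (2 * b3) * Const (1 / (2 * b3))) * S\<^sup>2 * eps\<^sup>2 + X ^ p\<^sup>2 * (Const (2 * b3) * h2_tail')"
    unfolding H2_eq p2_eq by (simp add: algebra_simps power_add power2_eq_square)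
  also have "\<dots> = 2 * S * Yq * eps + S\<^sup>2 * eps\<^sup>2 + Const (1 / b3 ^ p) * (X ^ p\<^sup>2 * h2_tail)"
    unfolding c by (simp add: algebra_simps)
  also have "\<dots> = Const (1 / b3 ^ p) * (n_tail - eps ^ p) + (Const (1 / b3 ^ p) * Const (b3 ^ p)) * Yq\<^sup>2
      + 2 * S * Yq * eps + S\<^sup>2 * eps\<^sup>2"
    unfolding n_tail_eps[symmetric] by (simp add: algebra_simps)
  also have "\<dots> = Const (1 / b3 ^ p) * (n_tail - eps ^ p) + F1\<^sup>2"
    unfolding c F1_eq by (simp add: algebra_simps power2_eq_square)
  finally show ?thesis .
qed

text \<open>The p-th power of \<open>H2_eq\<close> is taken term by term. Its leading part y^(p^3)
  eps^p / b3^p cancels against the part - eps^p supplied by \<open>H2_relation\<close>, which leaves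
  y^(p^3) times \<open>n_tail\<close> and terms with high powers of x.\<close>

lemma h3_first_terms:
  "H2 ^ p - F1 ^ (p + 2) + Const (2 * b3) * F1 ^ p * H2 * S = Const (1 / b3 ^ p) * Y ^ p ^ 3 * n_tail
    + X ^ (p * q) * (Const (1 / (2 * b3) ^ p) * eps ^ (2 * p) + Const (1 / b3 ^ p) * eps ^ p * (n_tail - eps ^ p))
    + X ^ (2 * p\<^sup>2) * h2_tail' ^ p"
proof -
  have e: "(eps\<^sup>2) ^ p = eps ^ (2 * p)" "(X ^ q) ^ p = (X :: 'a xpoly) ^ (p * q)"
    "(X ^ (2 * p)) ^ p = (X :: 'a xpoly) ^ (2 * p\<^sup>2)"
    by (simp_all add: power_mult[symmetric] power2_eq_square[of p] mult.assoc mult.commute[of q])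
  have "H2 ^ p = Const (1 / b3 ^ p) * Y ^ p ^ 3 * eps ^ p + Const (1 / (2 * b3) ^ p) * X ^ (p * q) * eps ^ (2 * p)
      + X ^ (2 * p\<^sup>2) * h2_tail' ^ p"
    unfolding H2_eq power_p_hom power_mult_distrib[of _ _ p] Yq_power Const_power[symmetric] power_one_over e ..
  moreover have "Const (2 * b3) * F1 ^ p * H2 * S - F1 ^ (p + 2) = F1 ^ p * (Const (2 * b3) * S * H2 - F1\<^sup>2)"
    unfolding power_add by (simp only: algebra_simps)
  ultimately show ?thesis
    unfolding H2_relation F1_power_p by (simp add: algebra_simps)
qed

text \<open>By additivity of p-th powers every summand of f1 changes only by a scalar multiple of
  x^(p^2), and the scalars add up to the left side of \<open>uv_relation\<close>.\<close>

lemma F1_inv: "F1 \<in> invariants p M"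
  unfolding invariants_def
proof safe
  fix a
  have C: "Const (c ^ p ^ k) = (Const c :: 'a xpoly) ^ p ^ k" for c :: 'a and k
    by (rule Const_power)
  have "act M a F1 = F1 + Const (u a ^ p\<^sup>2 - b3 * v a ^ p + b2 * u a ^ p - b1 * v a + b0 * u a) * X ^ p\<^sup>2"
  proof -
    have x1: "X ^ p * X ^ (q + p) = (X :: 'a xpoly) ^ p\<^sup>2" "X * X ^ (q + (2 * p - 1)) = (X :: 'a xpoly) ^ p\<^sup>2"
      "X\<^sup>2 * X ^ (q + (2 * p - 2)) = (X :: 'a xpoly) ^ p\<^sup>2" "(X\<^sup>2) ^ p * X ^ q = (X :: 'a xpoly) ^ p\<^sup>2"
    proof -
      have n: "p + (q + p) = p\<^sup>2" "Suc (q + (2 * p - 1)) = p\<^sup>2" "2 + (q + (2 * p - 2)) = p\<^sup>2" "2 * p + q = p\<^sup>2"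
        using p_gt_2 by (simp_all add: p2_eq)
      show "X ^ p * X ^ (q + p) = (X :: 'a xpoly) ^ p\<^sup>2" "X * X ^ (q + (2 * p - 1)) = (X :: 'a xpoly) ^ p\<^sup>2"
        "X\<^sup>2 * X ^ (q + (2 * p - 2)) = (X :: 'a xpoly) ^ p\<^sup>2" "(X\<^sup>2) ^ p * X ^ q = (X :: 'a xpoly) ^ p\<^sup>2"
        by (simp_all only: power_add[symmetric] power_Suc[symmetric] power_mult[symmetric] n)
    qed
    have "act M a F1 = Y ^ p\<^sup>2 + Const (u a ^ p\<^sup>2) * X ^ p\<^sup>2
     + Const b3 * (delta ^ p - Const (v a ^ p) * (X\<^sup>2) ^ p) * X ^ q
     + Const b2 * (Y ^ p + Const (u a ^ p) * X ^ p) * X ^ (q + p)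
     + Const b1 * (delta - Const (v a) * X\<^sup>2) * X ^ (q + (2 * p - 2))
     + Const b0 * (Y + Const (u a) * X) * X ^ (q + (2 * p - 1))"
      unfolding act_eq_transl f1_hat_def transl_hom transl_delta expo power_p_hom add_mpoly_power_p[of _ _ 2]
        power_mult_distrib Const_power ..
    also have "\<dots> = F1 + (Const (u a ^ p\<^sup>2) * X ^ p\<^sup>2 - Const b3 * Const (v a ^ p) * ((X\<^sup>2) ^ p * X ^ q)
      + Const b2 * Const (u a ^ p) * (X ^ p * X ^ (q + p)) - Const b1 * Const (v a) * (X\<^sup>2 * X ^ (q + (2 * p - 2)))
      + Const b0 * Const (u a) * (X * X ^ (q + (2 * p - 1))))"
      unfolding f1_hat_def expo by (simp only: algebra_simps)
    also have "\<dots> = F1 + Const (u a ^ p\<^sup>2 - b3 * v a ^ p + b2 * u a ^ p - b1 * v a + b0 * u a) * X ^ p\<^sup>2"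
      unfolding x1 Const_hom by (simp only: algebra_simps)
    finally show ?thesis .
  qed
  then show "act M a F1 = F1" by (simp add: uv_relation)
qed

lemma H2_inv: "H2 \<in> invariants p M"
proof (rule inv_cancel)
  note sub = subalgebraD[OF subalgebra_invariants]
  show K: "Const (2 * b3 ^ (p + 1)) * X ^ (p * q + q) \<in> invariants p M"
    by (intro sub X_inv)
  show "Const (2 * b3 ^ (p + 1)) * X ^ (p * q + q) \<noteq> 0" using b3_nz two_nz by simp
  have "h2_tilde p M \<in> invariants p M"
    unfolding h2_tilde_def by (intro sub X_inv F1_inv orbit_norm_inv)
  then show "Const (2 * b3 ^ (p + 1)) * X ^ (p * q + q) * H2 \<in> invariants p M"
    by (simp add: h2_tilde_eq_H2 mult.commute)
qed


section \<open>The lowest power of x in h3_tilde\<close>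

lemma eps_cong: "xcong p eps (Const b3 * Y ^ (2 * p))"
proof -
  have d: "delta ^ p = Y ^ (2 * p) - X ^ p * (Z :: 'a xpoly) ^ p"
    unfolding delta_def power_p_hom power_mult_distrib by (simp add: power_mult)
  have x: "X ^ (2 * p - 2) = X ^ p * (X :: 'a xpoly) ^ (p - 2)"
    "X ^ (2 * p - 1) = X ^ p * (X :: 'a xpoly) ^ (p - 1)"
    using p_gt_2 by (simp_all add: mult_2 flip: power_add)
  have "eps = Const b3 * Y ^ (2 * p) + X ^ p * (Const b2 * Y ^ p - Const b3 * Z ^ p
      + Const b1 * delta * X ^ (p - 2) + Const b0 * Y * X ^ (p - 1))"
    unfolding eps_def d x by (simp add: algebra_simps)
  then show ?thesis by (simp add: xcong_add_X)
qed

lemma F1_cong: "k \<le> q \<Longrightarrow> xcong k F1 Yq"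
  unfolding F1_eq by (rule xcong_add_X)

lemma F1_power_p_cong: "xcong (p\<^sup>2) (F1 ^ p) (Y ^ p ^ 3)"
proof -
  have "p\<^sup>2 \<le> 3 * q" using p_le_q by (simp add: p2_eq)
  also have "\<dots> \<le> p * q" using p_ge_3 by simp
  finally show ?thesis unfolding F1_power_p by (rule xcong_add_X)
qed

text \<open>The summand with \<open>S\<close> is kept because q is less than 2p when p = 3; for
  larger p it is dropped later.\<close>

lemma b3_H2_cong: "xcong (2 * p) (Const b3 * H2) (Yq * eps + Const (1 / 2) * S * eps\<^sup>2)"
proof -
  have c: "Const b3 * Const (1 / b3) = (1 :: 'a xpoly)"
    "Const b3 * Const (1 / (2 * b3)) = (Const (1 / 2) :: 'a xpoly)"
    using b3_nz by (simp_all flip: Const_mult)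
  have "Const b3 * H2 = (Const b3 * Const (1 / b3)) * Yq * eps + (Const b3 * Const (1 / (2 * b3))) * S * eps\<^sup>2
      + X ^ (2 * p) * (Const b3 * h2_tail')"
    unfolding H2_eq by (simp add: algebra_simps)
  then show ?thesis unfolding c by (simp add: xcong_add_X)
qed

lemma H2_cong: "xcong p H2 (Yq * Y ^ (2 * p))"
proof -
  have c: "Const (1 / b3) * Const b3 = (1 :: 'a xpoly)"
    using b3_nz by (simp flip: Const_mult)
  have "H2 = Const (1 / b3) * Yq * eps + X ^ p * (X ^ (q - p) * Const (1 / (2 * b3)) * eps\<^sup>2 + X ^ p * h2_tail')"
  proof -
    have "S = X ^ p * X ^ (q - p)" "X ^ (2 * p) = X ^ p * (X :: 'a xpoly) ^ p"
      using p_le_q by (simp_all flip: power_add add: mult_2)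
    then show ?thesis unfolding H2_eq by (simp add: algebra_simps)
  qed
  then have "xcong p H2 (Const (1 / b3) * Yq * eps)" by (simp add: xcong_add_X)
  moreover have "xcong p (Const (1 / b3) * Yq * eps) (Const (1 / b3) * Yq * (Const b3 * Y ^ (2 * p)))"
    by (intro xcong_mult xcong_refl eps_cong)
  moreover have "Const (1 / b3) * Yq * (Const b3 * Y ^ (2 * p)) = Yq * Y ^ (2 * p)"
  proof -
    have "Const (1 / b3) * Yq * (Const b3 * Y ^ (2 * p)) = (Const (1 / b3) * Const b3) * (Yq * Y ^ (2 * p))"
      by (simp only: mult_ac)
    then show ?thesis unfolding c by simp
  qed
  ultimately show ?thesis by (auto dest: xcong_trans)
qed

lemma F1_H2_cong: "xcong p (F1 ^ m * H2 ^ n) (Yq ^ m * (Yq * Y ^ (2 * p)) ^ n)"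
  by (intro xcong_mult xcong_power F1_cong H2_cong p_le_q)

text \<open>Modulo x^(2p^2) the first three terms of \<open>h3_tilde\<close> amount to y^(p^3)
  \<open>n_tail\<close> / b3^p. The others reproduce the parts of this with \<open>a2\<close> and
  \<open>a1\<close>, using invariants congruent to y^(p^3+p^2) modulo x^(p^2) and to y^(p^3+p)
  modulo x^p. Only the part with \<open>a0\<close> is left.\<close>

lemma h3_tilde_cong_ge_5:
  assumes "p \<noteq> 3"
  shows "xcong (2 * p\<^sup>2) (h3_tilde p M) (Const (a0 / b3 ^ p) * Y ^ (p ^ 3 + 1) * X ^ (2 * p\<^sup>2 - 1))"
proof -
  define m where "m = (p - 3) div 2"
  define n where "n = (p + 1) div 2"
  have p2: "2 * p \<le> q" using two_p_le_q assms by blast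
  have Yp: "Yq ^ (p - 1) * Yq = Y ^ p ^ 3"
    unfolding Yq_power[symmetric] using p_gt_0 by (metis power_minus_mult)
  have A: "xcong (p\<^sup>2) (F1 ^ (p + 1) - Const b3 * F1 ^ (p - 1) * H2 * S) (Y ^ p ^ 3 * Yq)"
  proof -
    have "xcong (2 * p) (Const b3 * H2) (Yq * eps + X ^ q * (Const (1 / 2) * eps\<^sup>2))"
      using b3_H2_cong by (simp add: mult_ac)
    then have "xcong (2 * p) (Const b3 * H2) (Yq * eps)"
      using xcong_add_X[OF p2] xcong_trans by blast
    then have "xcong (2 * p) (F1 ^ (p - 1) * (Const b3 * H2)) (Yq ^ (p - 1) * (Yq * eps))"
      using F1_cong[OF p2] by (intro xcong_mult[OF xcong_power])
    then have 1: "xcong (p\<^sup>2) (X ^ q * (F1 ^ (p - 1) * (Const b3 * H2))) (X ^ q * (Yq ^ (p - 1) * (Yq * eps)))"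
      by (rule xcong_X_mult) (simp add: p2_eq)
    have 2: "xcong (p\<^sup>2) (F1 ^ p * F1) (Y ^ p ^ 3 * F1)"
      by (intro xcong_mult F1_power_p_cong xcong_refl)
    \<comment> \<open>The second factor \<open>H2\<close> supplies the part x^q eps by which f1
      differs from y^(p^2).\<close>
    have "Y ^ p ^ 3 * F1 - X ^ q * (Yq ^ (p - 1) * (Yq * eps)) = Y ^ p ^ 3 * Yq"
      unfolding F1_eq mult.assoc[symmetric] using Yp by (simp add: algebra_simps)
    then show ?thesis using xcong_diff[OF 2 1] by (simp add: mult_ac)
  qed
  have B: "xcong p (F1 ^ m * H2 ^ n) (Y ^ p ^ 3 * Y ^ p)"
  proof -
    obtain k where k: "p = 2 * k + 3" by (rule p_odd_form)
    have mn: "m = k" "n = k + 2" by (simp_all add: m_def n_def k)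
    have "p\<^sup>2 * m + (p\<^sup>2 + 2 * p) * n = p ^ 3 + p"
      unfolding mn k by (simp add: power2_eq_square power3_eq_cube algebra_simps)
    then have "Yq ^ m * (Yq * Y ^ (2 * p)) ^ n = Y ^ p ^ 3 * Y ^ p"
      by (simp only: power_add[symmetric] power_mult[symmetric])
    then show ?thesis using F1_H2_cong[of m n] by simp
  qed
  have "2 * p\<^sup>2 \<le> p * q" using p2 mult_le_mono2[OF p2, of p] by (simp add: power2_eq_square mult_ac)
  then have FT: "xcong (2 * p\<^sup>2) (H2 ^ p - F1 ^ (p + 2) + Const (2 * b3) * F1 ^ p * H2 * S) (Const (1 / b3 ^ p) * Y ^ p ^ 3 * n_tail)"
    unfolding h3_first_terms by (meson xcong_add_X xcong_trans order.refl)
  have 1: "xcong (2 * p\<^sup>2) (X ^ p\<^sup>2 * (F1 ^ (p + 1) - Const b3 * F1 ^ (p - 1) * H2 * S)) (X ^ p\<^sup>2 * (Y ^ p ^ 3 * Yq))"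
    by (rule xcong_X_mult[OF A]) simp
  have 2: "xcong (2 * p\<^sup>2) (X ^ (p\<^sup>2 + q + p) * (F1 ^ m * H2 ^ n)) (X ^ (p\<^sup>2 + q + p) * (Y ^ p ^ 3 * Y ^ p))"
    by (rule xcong_X_mult[OF B]) (simp add: p2_eq)
  have "h3_tilde p M = (H2 ^ p - F1 ^ (p + 2) + Const (2 * b3) * F1 ^ p * H2 * S)
    - Const (1 / b3 ^ p) * (Const a2 * (X ^ p\<^sup>2 * (F1 ^ (p + 1) - Const b3 * F1 ^ (p - 1) * H2 * S))
      + Const a1 * (X ^ (p\<^sup>2 + q + p) * (F1 ^ m * H2 ^ n)))"
    unfolding h3_tilde_def Let_def expo power_add[of X "p\<^sup>2" q] m_def[symmetric] n_def[symmetric] Const_mult[of a2]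
    using assms by (simp add: algebra_simps)
  moreover have "xcong (2 * p\<^sup>2) \<dots> (Const (1 / b3 ^ p) * Y ^ p ^ 3 * n_tail
     - Const (1 / b3 ^ p) * (Const a2 * (X ^ p\<^sup>2 * (Y ^ p ^ 3 * Yq)) + Const a1 * (X ^ (p\<^sup>2 + q + p) * (Y ^ p ^ 3 * Y ^ p))))"
    by (intro xcong_diff FT xcong_mult xcong_add xcong_refl 1 2)
  moreover have "Const (1 / b3 ^ p) * Y ^ p ^ 3 * n_tail
     - Const (1 / b3 ^ p) * (Const a2 * (X ^ p\<^sup>2 * (Y ^ p ^ 3 * Yq)) + Const a1 * (X ^ (p\<^sup>2 + q + p) * (Y ^ p ^ 3 * Y ^ p)))
     = (Const (1 / b3 ^ p) * Const a0) * Y ^ (p ^ 3 + 1) * X ^ (2 * p\<^sup>2 - 1)"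
    unfolding n_tail_def expo power_add by (simp add: algebra_simps)
  ultimately show ?thesis by (simp flip: Const_mult)
qed

text \<open>Here q = 3, so two terms survive that vanish for larger p: x^9 eps^6 from
  \<open>h3_first_terms\<close> and the one with eps^2 in \<open>b3_H2_cong\<close>. The additional
  b3^3 in the definition cancels the first, which reduces to b3^3 x^9 y^36. The second then leaves
  x^15 y^30 with coefficients b3^5 and a2 / b3, which are the additional coefficients of
  \<open>h2\<^sup>2\<close>.\<close>

lemma h3_tilde_cong_3:
  assumes p: "p = 3"
  shows "xcong (2 * p\<^sup>2) (h3_tilde p M) (Const (a0 / b3 ^ p) * Y ^ (p ^ 3 + 1) * X ^ (2 * p\<^sup>2 - 1))"
proof -
  have q: "q = 3" using q_def[unfolded p] by (simp add: p)
  have en: "q = 3" "2 * p\<^sup>2 = 18" "p\<^sup>2 = 9" "p ^ 3 = 27" "p * 3 = 9" "2 * p = 6"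
    "f ^ p = f ^ 3" "c ^ p = c ^ 3" for f :: "'a xpoly" and c :: 'a
    using q by (simp_all only: p) simp_all
  have three: "(3 :: 'a) = 0" using of_nat_CHAR[where 'a='a] CHAR_p p by simp
  have m1: "(2 :: 'a) = - 1" "(8 :: 'a) = - 1"
  proof -
    have "(2 :: 'a) = 3 - 1" "(8 :: 'a) = 3 * 3 - 1" by simp_all
    then show "(2 :: 'a) = - 1" "(8 :: 'a) = - 1" unfolding three by simp_all
  qed
  define I :: "'a xpoly" where "I = Const (1 / b3 ^ 3)"
  define B :: "'a xpoly" where "B = Const b3"
  have IB: "I * B ^ 3 = 1"
    unfolding I_def B_def using b3_nz by (simp flip: Const_mult Const_power)
  have three': "I + I + I = 0"
  proof -
    have "(3 :: 'a xpoly) = Const 3" by (simp add: Const_numeral)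
    also have "\<dots> = 0" unfolding three by simp
    finally have "3 * I = 0" by simp
    then show ?thesis by (simp add: algebra_simps)
  qed
  have cs: "Const (1 / (2 * b3) ^ 3) = - I" "Const (1 / 2) = (- 1 :: 'a xpoly)" "Const (2 * b3) = - B"
    "Const (a2 / b3 ^ 3 + b3 ^ 3) = Const a2 * I + B ^ 3"
    "Const (a1 / b3 ^ 3 + a2 / b3 + b3 ^ 5) = Const a1 * I + Const a2 * I * B\<^sup>2 + B ^ 5"
    "Const (a0 / b3 ^ 3) = Const a0 * I" "Const (b3 ^ 3) = B ^ 3"
    using b3_nz unfolding I_def B_def power_mult_distrib
    by (simp_all add: m1 power2_eq_square power3_eq_cube flip: Const_mult Const_power Const_uminus Const_add Const_1)
  have n_tail: "n_tail = X ^ 9 * (Const a2 * Y ^ 9 + Const a1 * Y ^ 3 * X ^ 6 + Const a0 * Y * X ^ 8)"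
    unfolding n_tail_def en by (simp add: p)
  have eps3: "xcong 9 (eps ^ 3) (B ^ 3 * Y ^ 18)"
  proof -
    have "n_tail - eps ^ 3 + Const (b3 ^ 3) * (Y ^ 9)\<^sup>2 = X ^ 9 * h2_tail" using n_tail_eps unfolding en by simp
    then have "eps ^ 3 = B ^ 3 * Y ^ 18 + X ^ 9 * (Const a2 * Y ^ 9 + Const a1 * Y ^ 3 * X ^ 6 + Const a0 * Y * X ^ 8 - h2_tail)"
      unfolding cs n_tail by (simp add: algebra_simps flip: power_mult)
    then show ?thesis by (simp add: xcong_add_X)
  qed
  have eps6: "xcong 9 (eps ^ 6) (B ^ 6 * Y ^ 36)"
    using xcong_power[OF eps3, of 2] by (simp add: power_mult_distrib flip: power_mult)
  have eps2: "xcong 3 (eps\<^sup>2) (B\<^sup>2 * Y ^ 12)"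
    using xcong_power[OF eps_cong, of 2] unfolding en B_def[symmetric] power_mult_distrib by (simp add: p flip: power_mult)
  have H22: "xcong 3 (H2\<^sup>2) (Y ^ 30)"
    using F1_H2_cong[of 0 2] unfolding en by (simp add: p flip: power_add power_mult)
  have A: "xcong 9 (F1 ^ 4 - B * F1\<^sup>2 * H2 * X ^ 3) (Y ^ 36 - X ^ 6 * (Y ^ 18 * eps\<^sup>2))"
  proof -
    have F1: "F1 = Y ^ 9 + X ^ 3 * eps" unfolding F1_eq en ..
    have "xcong 6 (B * H2) (Y ^ 9 * eps - X ^ 3 * eps\<^sup>2)"
      using b3_H2_cong unfolding en cs B_def[symmetric] by simp
    moreover have "F1\<^sup>2 = (Y ^ 18 + 2 * X ^ 3 * Y ^ 9 * eps) + X ^ 6 * eps\<^sup>2"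
      unfolding F1 by (simp add: power2_eq_square algebra_simps flip: power_add)
    then have "xcong 6 (F1\<^sup>2) (Y ^ 18 + 2 * X ^ 3 * Y ^ 9 * eps)"
      by (simp add: xcong_add_X)
    ultimately have "xcong 6 (F1\<^sup>2 * (B * H2)) ((Y ^ 18 + 2 * X ^ 3 * Y ^ 9 * eps) * (Y ^ 9 * eps - X ^ 3 * eps\<^sup>2))"
      by (intro xcong_mult)
    moreover have "(Y ^ 18 + 2 * X ^ 3 * Y ^ 9 * eps) * (Y ^ 9 * eps - X ^ 3 * eps\<^sup>2)
      = (Y ^ 27 * eps + X ^ 3 * (Y ^ 18 * eps\<^sup>2)) + X ^ 6 * (- 2 * Y ^ 9 * eps ^ 3)"
    proof -
      have w: "Y ^ 27 = Y ^ 9 * Y ^ 9 * (Y :: 'a xpoly) ^ 9" "Y ^ 18 = Y ^ 9 * (Y :: 'a xpoly) ^ 9"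
        "X ^ 6 = X ^ 3 * (X :: 'a xpoly) ^ 3"
        by (simp_all flip: power_add)
      show ?thesis unfolding w power2_eq_square[of eps] power3_eq_cube[of eps] by (simp add: algebra_simps)
    qed
    ultimately have "xcong 6 (F1\<^sup>2 * (B * H2)) ((Y ^ 27 * eps + X ^ 3 * (Y ^ 18 * eps\<^sup>2)) + X ^ 6 * (- 2 * Y ^ 9 * eps ^ 3))"
      by (simp only:)
    then have "xcong 6 (F1\<^sup>2 * (B * H2)) (Y ^ 27 * eps + X ^ 3 * (Y ^ 18 * eps\<^sup>2))"
      by (rule xcong_trans) (rule xcong_add_X[OF order.refl])
    then have 1: "xcong 9 (X ^ 3 * (F1\<^sup>2 * (B * H2))) (X ^ 3 * (Y ^ 27 * eps + X ^ 3 * (Y ^ 18 * eps\<^sup>2)))"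
      by (rule xcong_X_mult) simp
    have 2: "xcong 9 (F1 ^ 3 * F1) (Y ^ 27 * F1)"
      using xcong_mult[OF F1_power_p_cong xcong_refl] unfolding en .
    have "Y ^ 27 * F1 - X ^ 3 * (Y ^ 27 * eps + X ^ 3 * (Y ^ 18 * eps\<^sup>2)) = Y ^ 36 - X ^ 6 * (Y ^ 18 * eps\<^sup>2)"
      unfolding F1 by (simp add: algebra_simps flip: power_add)
    moreover have "F1 ^ 3 * F1 - X ^ 3 * (F1\<^sup>2 * (B * H2)) = F1 ^ 4 - B * F1\<^sup>2 * H2 * X ^ 3"
      by (simp add: algebra_simps power3_eq_cube power4_eq_xxxx)
    ultimately show ?thesis using xcong_diff[OF 2 1] by (simp only:)
  qed
  have FT: "xcong 18 (H2 ^ 3 - F1 ^ 5 + Const (2 * b3) * F1 ^ 3 * H2 * X ^ 3) (I * Y ^ 27 * n_tail + X ^ 9 * (I * eps ^ 6))"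
  proof -
    have "H2 ^ 3 - F1 ^ 5 + Const (2 * b3) * F1 ^ 3 * H2 * X ^ 3 = I * Y ^ 27 * n_tail
      + X ^ 9 * (- I * eps ^ 6 + I * eps ^ 3 * (n_tail - eps ^ 3)) + X ^ 18 * h2_tail' ^ 3"
    proof -
      have "H2 ^ (p + 2) = H2 ^ 5" "F1 ^ (p + 2) = F1 ^ 5" by (simp_all only: p) simp_all
      then show ?thesis using h3_first_terms unfolding en cs I_def[symmetric] by simp
    qed
    \<comment> \<open>The two copies of - I eps^6 equal + I eps^6 in characteristic 3, and
      \<open>n_tail\<close> contributes a second factor x^9, which pushes its product with eps^3
      beyond the modulus.\<close>
    also have "\<dots> = I * Y ^ 27 * n_tail + X ^ 9 * (I * eps ^ 6)
       + X ^ 18 * (h2_tail' ^ 3 + I * eps ^ 3 * (Const a2 * Y ^ 9 + Const a1 * Y ^ 3 * X ^ 6 + Const a0 * Y * X ^ 8))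
       - X ^ 9 * ((I + I + I) * eps ^ 6)"
    proof -
      have "X ^ 18 = X ^ 9 * (X :: 'a xpoly) ^ 9" "eps ^ 6 = eps ^ 3 * eps ^ 3"
        by (simp_all flip: power_add)
      then show ?thesis unfolding n_tail by (simp add: algebra_simps)
    qed
    finally show ?thesis unfolding three' by (simp add: xcong_add_X)
  qed
  have "h3_tilde p M = (H2 ^ 3 - F1 ^ 5 + Const (2 * b3) * F1 ^ 3 * H2 * X ^ 3)
    - (Const a2 * I + B ^ 3) * (X ^ 9 * (F1 ^ 4 - B * F1\<^sup>2 * H2 * X ^ 3))
    - (Const a1 * I + Const a2 * I * B\<^sup>2 + B ^ 5) * (X ^ 15 * H2\<^sup>2)"
  proof -
    have x12: "X ^ 12 = X ^ 3 * (X :: 'a xpoly) ^ 9" by (simp flip: power_add)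
    then show ?thesis
      unfolding h3_tilde_def Let_def if_P[OF p] cs B_def[symmetric] x12 by (simp only: algebra_simps)
  qed
  moreover have "xcong 18 \<dots> ((I * Y ^ 27 * n_tail + X ^ 9 * (I * (B ^ 6 * Y ^ 36)))
    - (Const a2 * I + B ^ 3) * (X ^ 9 * (Y ^ 36) - X ^ 15 * (Y ^ 18 * (B\<^sup>2 * Y ^ 12)))
    - (Const a1 * I + Const a2 * I * B\<^sup>2 + B ^ 5) * (X ^ 15 * Y ^ 30))"
  proof (rule xcong_diff[OF xcong_diff[OF _ xcong_mult[OF xcong_refl]] xcong_mult[OF xcong_refl]])
    have "xcong 18 (X ^ 9 * (I * eps ^ 6)) (X ^ 9 * (I * (B ^ 6 * Y ^ 36)))"
      by (rule xcong_X_mult[of 9]) (intro xcong_mult xcong_refl eps6, simp)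
    then show "xcong 18 (H2 ^ 3 - F1 ^ 5 + Const (2 * b3) * F1 ^ 3 * H2 * X ^ 3)
        (I * Y ^ 27 * n_tail + X ^ 9 * (I * (B ^ 6 * Y ^ 36)))"
      using FT xcong_trans xcong_add xcong_refl by blast
    have "xcong 18 (X ^ 9 * (F1 ^ 4 - B * F1\<^sup>2 * H2 * X ^ 3)) (X ^ 9 * (Y ^ 36 - X ^ 6 * (Y ^ 18 * eps\<^sup>2)))"
      by (rule xcong_X_mult[OF A]) simp
    moreover have "X ^ 9 * (Y ^ 36 - X ^ 6 * (Y ^ 18 * eps\<^sup>2)) = X ^ 9 * Y ^ 36 - X ^ 15 * (Y ^ 18 * eps\<^sup>2)"
      by (simp add: algebra_simps flip: power_add)
    ultimately have 1: "xcong 18 (X ^ 9 * (F1 ^ 4 - B * F1\<^sup>2 * H2 * X ^ 3)) (X ^ 9 * Y ^ 36 - X ^ 15 * (Y ^ 18 * eps\<^sup>2))"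
      by (simp only:)
    have "xcong 18 (X ^ 15 * (Y ^ 18 * eps\<^sup>2)) (X ^ 15 * (Y ^ 18 * (B\<^sup>2 * Y ^ 12)))"
      by (rule xcong_X_mult[of 3]) (intro xcong_mult xcong_refl eps2, simp)
    then show "xcong 18 (X ^ 9 * (F1 ^ 4 - B * F1\<^sup>2 * H2 * X ^ 3)) (X ^ 9 * Y ^ 36 - X ^ 15 * (Y ^ 18 * (B\<^sup>2 * Y ^ 12)))"
      by (rule xcong_trans[OF 1 xcong_diff[OF xcong_refl]])
    show "xcong 18 (X ^ 15 * H2\<^sup>2) (X ^ 15 * Y ^ 30)"
      by (rule xcong_X_mult[OF H22]) simp
  qed
  moreover have "(I * Y ^ 27 * n_tail + X ^ 9 * (I * (B ^ 6 * Y ^ 36)))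
    - (Const a2 * I + B ^ 3) * (X ^ 9 * (Y ^ 36) - X ^ 15 * (Y ^ 18 * (B\<^sup>2 * Y ^ 12)))
    - (Const a1 * I + Const a2 * I * B\<^sup>2 + B ^ 5) * (X ^ 15 * Y ^ 30)
    = Const a0 * I * Y ^ 28 * X ^ 17"
  proof -
    have y: "Y ^ 27 * Y ^ 9 = (Y :: 'a xpoly) ^ 36" "Y ^ 27 * Y ^ 3 = (Y :: 'a xpoly) ^ 30"
      "Y ^ 27 * Y = (Y :: 'a xpoly) ^ 28" "Y ^ 18 * Y ^ 12 = (Y :: 'a xpoly) ^ 30"
      "X ^ 9 * X ^ 6 = (X :: 'a xpoly) ^ 15" "X ^ 9 * X ^ 8 = (X :: 'a xpoly) ^ 17"
      "B ^ 3 * B\<^sup>2 = B ^ 5" "I * B ^ 6 = B ^ 3"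
    proof -
      show "I * B ^ 6 = B ^ 3"
      proof -
        have "I * B ^ 6 = (I * B ^ 3) * B ^ 3" by (simp add: mult.assoc flip: power_add)
        then show ?thesis unfolding IB by simp
      qed
      show "Y ^ 27 * Y = (Y :: 'a xpoly) ^ 28"
        using power_Suc2[of Y 27, symmetric] by simp
    qed (simp_all flip: power_add)
    have "(I * Y ^ 27 * n_tail + X ^ 9 * (I * (B ^ 6 * Y ^ 36)))
      - (Const a2 * I + B ^ 3) * (X ^ 9 * (Y ^ 36) - X ^ 15 * (Y ^ 18 * (B\<^sup>2 * Y ^ 12)))
      - (Const a1 * I + Const a2 * I * B\<^sup>2 + B ^ 5) * (X ^ 15 * Y ^ 30)
      = Const a2 * I * X ^ 9 * (Y ^ 27 * Y ^ 9) + Const a1 * I * (X ^ 9 * X ^ 6) * (Y ^ 27 * Y ^ 3)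
        + Const a0 * I * (X ^ 9 * X ^ 8) * (Y ^ 27 * Y) + X ^ 9 * (I * B ^ 6) * Y ^ 36
      - (Const a2 * I + B ^ 3) * X ^ 9 * (Y ^ 36) + Const a2 * I * B\<^sup>2 * X ^ 15 * (Y ^ 18 * Y ^ 12)
      + (B ^ 3 * B\<^sup>2) * X ^ 15 * (Y ^ 18 * Y ^ 12)
      - (Const a1 * I + Const a2 * I * B\<^sup>2 + B ^ 5) * (X ^ 15 * Y ^ 30)"
      unfolding n_tail by (simp only: algebra_simps)
    also have "\<dots> = Const a0 * I * Y ^ 28 * X ^ 17"
      unfolding y by (simp add: algebra_simps)
    finally show ?thesis .
  qed
  ultimately show ?thesis unfolding en cs by simp
qed

lemma h3_tilde_cong:
  "xcong (2 * p\<^sup>2) (h3_tilde p M) (Const (a0 / b3 ^ p) * Y ^ (p ^ 3 + 1) * X ^ (2 * p\<^sup>2 - 1))"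
  using h3_tilde_cong_ge_5 h3_tilde_cong_3 by blast


lemma h3_lead_coeff_nz: "a0 / b3 ^ p \<noteq> 0"
  using a0_nz b3_nz by simp

text \<open>The modulus in \<open>h3_tilde_cong\<close> is one power of x above the lead part, so
  after division the error is still a multiple of x. Unfolding the minors shows
  \<open>k * (a0 / b3 ^ p)\<close> to be 1, the purpose of the constant in \<open>h3\<close>; the
  proof keeps only that it is nonzero.\<close>

lemma H3_factor:
  obtains k w where "k \<noteq> 0" "Const k * h3_tilde p M = X ^ (2 * p\<^sup>2 - 1) * H3"
    "H3 = Const (k * (a0 / b3 ^ p)) * Y ^ (p ^ 3 + 1) + X * w"
proof -
  obtain w where w: "h3_tilde p M = Const (a0 / b3 ^ p) * Y ^ (p ^ 3 + 1) * X ^ (2 * p\<^sup>2 - 1) + X ^ (2 * p\<^sup>2) * w"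
    using h3_tilde_cong unfolding xcong_def dvd_def by (auto simp: algebra_simps)
  have x: "X ^ (2 * p\<^sup>2) = X * (X :: 'a xpoly) ^ (2 * p\<^sup>2 - 1)"
    using p_gt_0 by (simp flip: power_Suc)
  define m1 where "m1 = minor p M 1 2 3 5 ^ (p + 1)"
  define m2 where "m2 = minor p M 2 3 5 7 * minor p M 1 2 3 4 ^ p"
  have nz: "m1 \<noteq> 0" "m2 \<noteq> 0"
    using minor1235 minor1234 a0_nz by (auto simp: m1_def m2_def alpha0_def)
  define k where "k = m1 / m2"
  let ?r = "Const (a0 / b3 ^ p) * Y ^ (p ^ 3 + 1) + X * w"
  have k: "Const m1 = Const k * Const m2" using nz by (simp add: k_def flip: Const_mult)
  have h: "h3_tilde p M = X ^ (2 * p\<^sup>2 - 1) * ?r"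
    unfolding w x by (simp add: algebra_simps)
  have H3: "H3 = Const k * ?r"
    unfolding h3_def m1_def[symmetric] m2_def[symmetric]
  proof (rule exact_quot_eqI)
    show "X ^ (2 * p\<^sup>2 - 1) * Const m2 \<noteq> 0" using nz by simp
    show "Const m1 * h3_tilde p M = Const k * ?r * (X ^ (2 * p\<^sup>2 - 1) * Const m2)"
      unfolding h k by (simp only: mult_ac)
  qed
  show ?thesis
  proof
    show "k \<noteq> 0" using nz by (simp add: k_def)
    show "Const k * h3_tilde p M = X ^ (2 * p\<^sup>2 - 1) * H3" unfolding H3 h by (simp only: mult_ac)
    show "H3 = Const (k * (a0 / b3 ^ p)) * Y ^ (p ^ 3 + 1) + X * (Const k * w)"
      unfolding H3 Const_mult by (simp only: algebra_simps)
  qed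
qed

text \<open>The remainder when h2^p is rewritten by h3: all its terms have degree below p in
  h2.\<close>

definition rho :: "'a xpoly" where
  "rho = H2 ^ p - h3_tilde p M"

definition xfh_monoms :: "nat \<Rightarrow> 'a xpoly set" where
  "xfh_monoms n = {X ^ e * F1 ^ a * H2 ^ b | e a b. b < n}"

lemma xfh_monoms_I: "b < n \<Longrightarrow> X ^ e * F1 ^ a * H2 ^ b \<in> mp.span (xfh_monoms n)"
  by (rule mp.span_base) (auto simp: xfh_monoms_def)

lemma rho_eq_3:
  assumes "p = 3"
  shows "rho = X ^ 0 * F1 ^ 5 * H2 ^ 0 - Const (2 * b3) * (X ^ 3 * F1 ^ 3 * H2 ^ 1)
    + Const (a2 / b3 ^ 3 + b3 ^ 3) * (X ^ 9 * F1 ^ 4 * H2 ^ 0 - Const b3 * (X ^ 12 * F1 ^ 2 * H2 ^ 1))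
    + Const (a1 / b3 ^ 3 + a2 / b3 + b3 ^ 5) * (X ^ 15 * F1 ^ 0 * H2 ^ 2)"
proof -
  have "H2 ^ p = H2 ^ 3" by (simp only: assms)
  then show ?thesis
    unfolding rho_def h3_tilde_def Let_def if_P[OF assms] by (simp add: algebra_simps)
qed

lemma rho_eq_ge_5:
  assumes "p \<noteq> 3"
  shows "rho = X ^ 0 * F1 ^ (p + 2) * H2 ^ 0 - Const (2 * b3) * (X ^ (p\<^sup>2 - 2 * p) * F1 ^ p * H2 ^ 1)
    + Const (1 / b3 ^ p) * (Const a2 * (X ^ p\<^sup>2 * F1 ^ (p + 1) * H2 ^ 0)
       - Const (a2 * b3) * (X ^ (2 * p\<^sup>2 - 2 * p) * F1 ^ (p - 1) * H2 ^ 1)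
       + Const a1 * (X ^ (2 * p\<^sup>2 - p) * F1 ^ ((p - 3) div 2) * H2 ^ ((p + 1) div 2)))"
  unfolding rho_def h3_tilde_def Let_def if_not_P[OF assms] by (simp add: algebra_simps)

lemma rho_in_span: "rho \<in> mp.span (xfh_monoms p)"
proof (cases "p = 3")
  case True
  then show ?thesis
    unfolding rho_eq_3[OF True] using p_gt_2 by (intro mp.span_add mp.span_diff mp.span_scale xfh_monoms_I) simp_all
next
  case False
  then show ?thesis
    unfolding rho_eq_ge_5[OF False] using p_gt_2 by (intro mp.span_add mp.span_diff mp.span_scale xfh_monoms_I) simp_all
qed

text \<open>The first relation as a rule that eliminates h2^p.\<close>

lemma H2_power_p:
  obtains c where "c \<noteq> 0" "H2 ^ p = Const c * X ^ (2 * p\<^sup>2 - 1) * H3 + rho"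
proof -
  obtain k w where k: "k \<noteq> 0" "Const k * h3_tilde p M = X ^ (2 * p\<^sup>2 - 1) * H3"
    by (rule H3_factor)
  have "Const (1 / k) * (Const k * h3_tilde p M) = h3_tilde p M"
    using k(1) by (simp add: mult.assoc[symmetric] flip: Const_mult)
  then have "H2 ^ p = Const (1 / k) * X ^ (2 * p\<^sup>2 - 1) * H3 + rho"
    unfolding rho_def k(2) by (simp add: mult.assoc)
  then show ?thesis using k(1) by (intro that[of "1 / k"]) simp_all
qed

lemma H3_inv: "H3 \<in> invariants p M"
proof -
  note sub = subalgebraD[OF subalgebra_invariants]
  obtain k w where k: "k \<noteq> 0" "Const k * h3_tilde p M = X ^ (2 * p\<^sup>2 - 1) * H3"
    by (rule H3_factor)
  have "mp.span (xfh_monoms p) \<subseteq> invariants p M"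
    using sub X_inv F1_inv H2_inv by (intro span_subset_subalgebra subalgebra_invariants) (auto simp: xfh_monoms_def)
  then have "rho \<in> invariants p M" using rho_in_span by blast
  then have "H2 ^ p - rho \<in> invariants p M" by (intro sub H2_inv)
  then have "h3_tilde p M \<in> invariants p M" by (simp add: rho_def)
  then have "X ^ (2 * p\<^sup>2 - 1) * H3 \<in> invariants p M"
    unfolding k(2)[symmetric] by (intro sub)
  then show ?thesis by (rule inv_cancel) (simp_all add: sub X_inv)
qed

subsection \<open>Lead monomials of the generators\<close>

lemma homogeneous_eps: "homogeneous (2 * p) eps"
  unfolding eps_def
  by (intro homogeneous_add; (rule homogeneous_multI | rule homogeneous_Const homogeneous_delta homogeneous_Var_power homogeneous_Var
     homogeneous_powerI[OF homogeneous_delta] refl)+; use p_gt_2 in simp)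

lemma homogeneous_F1: "homogeneous (p\<^sup>2) F1"
  unfolding F1_eq using homogeneous_mult[OF homogeneous_Var_power homogeneous_eps, of q]
  by (intro homogeneous_add homogeneous_Var_power) (simp add: p2_eq)

lemma homogeneous_NY: "homogeneous (p ^ 3) NY"
proof -
  have "homogeneous (p\<^sup>2 + (p ^ 3 - p\<^sup>2)) (Const a2 * Y ^ p\<^sup>2 * X ^ (p ^ 3 - p\<^sup>2))"
    "homogeneous (p + (p ^ 3 - p)) (Const a1 * Y ^ p * X ^ (p ^ 3 - p))"
    "homogeneous (1 + (p ^ 3 - 1)) (Const a0 * Y * X ^ (p ^ 3 - 1))"
    by (intro homogeneous_mult[OF homogeneous_Const_mult] homogeneous_Var_power homogeneous_Var)+
  then show ?thesis
    unfolding orbit_norm_Y using p_powers by (intro homogeneous_add homogeneous_Var_power) simp_all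
qed

lemma homogeneous_H2: "homogeneous (p\<^sup>2 + 2 * p) H2"
proof (rule homogeneous_cancel)
  let ?k = "Const (2 * b3 ^ (p + 1)) * X ^ (p * q + q)"
  show "homogeneous (p * q + q) ?k" by (intro homogeneous_Const_mult homogeneous_Var_power)
  show "?k \<noteq> 0" using b3_nz two_nz by simp
  have "homogeneous (p * p\<^sup>2) (F1 ^ p)" "homogeneous (p ^ 3 - 2 * p\<^sup>2 + 2 * p\<^sup>2) (Const (b3 ^ p) * X ^ (p ^ 3 - 2 * p\<^sup>2) * F1\<^sup>2)"
    by (intro homogeneous_power homogeneous_mult homogeneous_F1 homogeneous_Const_mult homogeneous_Var_power)+
  moreover have "p * p\<^sup>2 = p ^ 3" "p ^ 3 - 2 * p\<^sup>2 + 2 * p\<^sup>2 = p ^ 3"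
    using p3_eq by (simp_all add: power3_eq_cube power2_eq_square mult.assoc)
  ultimately have "homogeneous (p ^ 3) (h2_tilde p M)"
    unfolding h2_tilde_def by (intro homogeneous_add homogeneous_diff homogeneous_NY) simp_all
  moreover have "p ^ 3 = (p * q + q) + (p\<^sup>2 + 2 * p)" by (simp add: p3_eq p2_eq)
  ultimately show "homogeneous ((p * q + q) + (p\<^sup>2 + 2 * p)) (?k * H2)"
    by (simp add: h2_tilde_eq_H2 mult.commute)
qed

lemma homogeneous_XFH:
  "e + a * p\<^sup>2 + b * (p\<^sup>2 + 2 * p) = n \<Longrightarrow> homogeneous n (X ^ e * F1 ^ a * H2 ^ b)"
  using homogeneous_mult[OF homogeneous_mult[OF homogeneous_Var_power[of e VX] homogeneous_power[OF homogeneous_F1, of a]]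
    homogeneous_power[OF homogeneous_H2, of b]] by simp

lemma homogeneous_h3_tilde: "homogeneous (p ^ 3 + 2 * p\<^sup>2) (h3_tilde p M)"
proof -
  obtain k where k: "p = 2 * k + 3" by (rule p_odd_form)
  let ?n = "p ^ 3 + 2 * p\<^sup>2"
  have 0: "homogeneous ?n (H2 ^ p)"
    using homogeneous_power[OF homogeneous_H2, of p]
    by (simp add: power3_eq_cube power2_eq_square algebra_simps)
  have "homogeneous ?n rho"
  proof (cases "p = 3")
    case True
    then show ?thesis
      unfolding rho_eq_3[OF True]
      by (intro homogeneous_add homogeneous_diff homogeneous_Const_mult homogeneous_XFH) simp_all
  next
    case False
    have "0 + (p + 2) * p\<^sup>2 + 0 * (p\<^sup>2 + 2 * p) = ?n"
      "p\<^sup>2 - 2 * p + p * p\<^sup>2 + 1 * (p\<^sup>2 + 2 * p) = ?n" "p\<^sup>2 + (p + 1) * p\<^sup>2 + 0 * (p\<^sup>2 + 2 * p) = ?n"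
      "2 * p\<^sup>2 - 2 * p + (p - 1) * p\<^sup>2 + 1 * (p\<^sup>2 + 2 * p) = ?n"
      "2 * p\<^sup>2 - p + (p - 3) div 2 * p\<^sup>2 + (p + 1) div 2 * (p\<^sup>2 + 2 * p) = ?n"
      unfolding k by (simp_all add: power3_eq_cube power2_eq_square algebra_simps)
    then show ?thesis
      unfolding rho_eq_ge_5[OF False]
      by (intro homogeneous_add homogeneous_diff homogeneous_Const_mult homogeneous_XFH)
  qed
  then have "homogeneous ?n (H2 ^ p - rho)" using 0 by (intro homogeneous_diff)
  then show ?thesis by (simp add: rho_def)
qed

lemma homogeneous_H3: "homogeneous (p ^ 3 + 1) H3"
proof -
  obtain k w where k: "k \<noteq> 0" "Const k * h3_tilde p M = X ^ (2 * p\<^sup>2 - 1) * H3"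
    by (rule H3_factor)
  have "2 * p\<^sup>2 - 1 + (p ^ 3 + 1) = p ^ 3 + 2 * p\<^sup>2" using p_gt_0 by simp
  moreover have "homogeneous (p ^ 3 + 2 * p\<^sup>2) (X ^ (2 * p\<^sup>2 - 1) * H3)"
    unfolding k(2)[symmetric] by (intro homogeneous_Const_mult homogeneous_h3_tilde)
  ultimately have "homogeneous (2 * p\<^sup>2 - 1 + (p ^ 3 + 1)) (X ^ (2 * p\<^sup>2 - 1) * H3)"
    by (simp only:)
  then show ?thesis
    by (rule homogeneous_cancel[OF _ homogeneous_Var_power[of "2 * p\<^sup>2 - 1" VX]]) (simp_all only: X_power_neq_0 not_False_eq_True)
qed

lemma lead_F1: "is_lead grevlex_less F1 (xyzm 0 (p\<^sup>2) 0)"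
proof (rule is_lead_of_mod_X[OF homogeneous_F1])
  have "q \<noteq> 0" using p_le_q p_gt_0 by simp
  then have "S = X * X ^ (q - 1)" by (simp flip: power_Suc)
  then show "F1 = Const 1 * Y ^ p\<^sup>2 + X * (X ^ (q - 1) * eps)"
    by (simp add: F1_eq mult.assoc)
qed simp

lemma lead_H2: "is_lead grevlex_less H2 (xyzm 0 (p\<^sup>2 + 2 * p) 0)"
proof -
  obtain w where "H2 - Yq * Y ^ (2 * p) = X ^ p * w"
    using H2_cong unfolding xcong_def dvd_def by blast
  then have "H2 = Const 1 * Y ^ (p\<^sup>2 + 2 * p) + X * (X ^ (p - 1) * w)"
    using p_gt_0 by (simp add: power_add algebra_simps flip: power_Suc)
  then show ?thesis by (rule is_lead_of_mod_X[OF homogeneous_H2]) simp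
qed

lemma lead_H3: "is_lead grevlex_less H3 (xyzm 0 (p ^ 3 + 1) 0)"
proof -
  obtain k w where k: "k \<noteq> 0" "H3 = Const (k * (a0 / b3 ^ p)) * Y ^ (p ^ 3 + 1) + X * w"
    by (rule H3_factor)
  then show ?thesis using h3_lead_coeff_nz by (intro is_lead_of_mod_X[OF homogeneous_H3 k(2)]) simp
qed

lemma lead_X: "is_lead grevlex_less (X :: 'a xpoly) (xyzm 1 0 0)"
  using grevlex.is_lead_Mon by (simp add: Var_def)

section \<open>Weights of f1 and h2\<close>

lemma wt_le_eps: "wt_le (2 * p) eps"
  unfolding eps_def
  by (intro wt_le_add wt_le_multI[OF wt_le_multI[OF wt_le_Const wt_le_powerI[OF wt_le_Y order.refl] order.refl] wt_le_powerI[OF wt_le_X order.refl]]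
     wt_le_Const_mult[OF wt_le_powerI[OF wt_le_delta]] wt_le_multI[OF wt_le_Const_mult[OF wt_le_delta] wt_le_powerI[OF wt_le_X order.refl]]
     wt_le_multI[OF wt_le_Const_mult[OF wt_le_Y] wt_le_powerI[OF wt_le_X order.refl]])
    (use p_gt_2 in simp_all)

lemma wt_lead_Mon: "c \<noteq> 0 \<Longrightarrow> is_lead wt_less (Const c * Mon m :: 'a xpoly) m"
  by (intro wt.is_lead_Const_mult wt.is_lead_Mon)

lemma wt_le_X_power: "wt_le 0 (X ^ n :: 'a xpoly)"
  by (rule wt_le_powerI[OF wt_le_X]) simp

lemma wt_lead_F1: "is_lead wt_less F1 (xyzm 0 (p\<^sup>2) 0)"
  unfolding F1_eq
proof (rule is_lead_wt_add)
  show "is_lead wt_less Yq (xyzm 0 (p\<^sup>2) 0)" using wt_lead_Mon[of 1 "xyzm 0 (p\<^sup>2) 0"] by (simp add: Var_power)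
  show "wt_le (2 * p) (S * eps)" by (rule wt_le_multI[OF wt_le_X_power wt_le_eps]) simp
  show "2 * p < wt (xyzm 0 (p\<^sup>2) 0)" using p_le_q p_gt_0 by (simp add: wt_def lookup_single p2_eq)
qed

text \<open>The product y^(p^2) eps, which contains the graded lead term, has weight at most p^2 +
  2p, while x^(2p) z^(p^2) from \<open>h2_tail'\<close> has weight 2 p^2, which is larger since p >
  2.\<close>

lemma wt_lead_H2: "is_lead wt_less H2 (xyzm (2 * p) 0 (p\<^sup>2))"
proof -
  define r where "r = Const (a2 - b2 ^ p) * Yq + Const (a1 - b0 ^ p) * Y ^ p * X ^ (q + p)
     + Const a0 * Y * X ^ (q + (2 * p - 1)) - Const (b1 ^ p) * delta ^ p * X ^ q"
  have c: "Const (1 / (2 * b3 ^ (p + 1))) * Const (b3 ^ p) = (Const (1 / (2 * b3)) :: 'a xpoly)"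
    using b3_nz two_nz by (simp flip: Const_mult)
  have h2_tail: "h2_tail' = Const (1 / (2 * b3)) * Z ^ p\<^sup>2 + Const (1 / (2 * b3 ^ (p + 1))) * r"
    unfolding h2_tail'_def h2_tail_def r_def[symmetric] distrib_left mult.assoc[symmetric] c ..
  have "X ^ (2 * p) * Z ^ p\<^sup>2 = (Mon (xyzm (2 * p) 0 (p\<^sup>2)) :: 'a xpoly)"
    using Mon_xyzm[of "2 * p" 0 "p\<^sup>2"] by simp
  then have eq: "H2 = Const (1 / (2 * b3)) * Mon (xyzm (2 * p) 0 (p\<^sup>2))
    + (Const (1 / b3) * Yq * eps + Const (1 / (2 * b3)) * S * eps\<^sup>2 + X ^ (2 * p) * (Const (1 / (2 * b3 ^ (p + 1))) * r))"
    unfolding H2_eq h2_tail by (simp add: algebra_simps)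
  have lt: "2 * p < p\<^sup>2" using p_le_q p_gt_0 by (simp add: p2_eq)
  have Yn: "wt_le n (Y ^ n :: 'a xpoly)" for n by (rule wt_le_powerI[OF wt_le_Y]) simp
  have r: "wt_le (p\<^sup>2) r"
    unfolding r_def
    by (intro wt_le_add wt_le_diff wt_le_Const_mult Yn wt_le_multI[OF wt_le_Const_mult[OF Yn] wt_le_X_power]
        wt_le_multI[OF wt_le_Const_mult[OF wt_le_Y] wt_le_X_power]
        wt_le_multI[OF wt_le_Const_mult[OF wt_le_powerI[OF wt_le_delta order.refl]] wt_le_X_power])
      (use lt in simp_all)
  have "wt_le (p\<^sup>2 + 2 * p) (Const (1 / b3) * Yq * eps + Const (1 / (2 * b3)) * S * eps\<^sup>2
     + X ^ (2 * p) * (Const (1 / (2 * b3 ^ (p + 1))) * r))"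
    by (intro wt_le_add wt_le_multI[OF wt_le_Const_mult[OF Yn] wt_le_eps]
        wt_le_multI[OF wt_le_Const_mult[OF wt_le_X_power] wt_le_powerI[OF wt_le_eps order.refl]]
        wt_le_multI[OF wt_le_X_power wt_le_Const_mult[OF r]])
      (use lt in simp_all)
  then show ?thesis
    unfolding eq
  proof (rule is_lead_wt_add[rotated])
    show "is_lead wt_less (Const (1 / (2 * b3)) * Mon (xyzm (2 * p) 0 (p\<^sup>2)) :: 'a xpoly) (xyzm (2 * p) 0 (p\<^sup>2))"
      using b3_nz two_nz by (intro wt_lead_Mon) simp
    show "p\<^sup>2 + 2 * p < wt (xyzm (2 * p) 0 (p\<^sup>2))" using lt by (simp add: wt_def lookup_add lookup_single)
  qed
qed

end

text \<open>Root counting in an integral domain. Both the coefficients and the points will be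
  elements of F[x,y,z], the points being the translates of y or of \<open>delta\<close>.\<close>

lemma sum_powers_const_imp_coeff:
  fixes c :: "nat \<Rightarrow> 'r::idom"
  assumes "n \<le> card A" "0 < n" "\<And>x. x \<in> A \<Longrightarrow> (\<Sum>j<n. c j * x ^ j) = g"
  shows "c 0 = g" and "0 < j \<Longrightarrow> j < n \<Longrightarrow> c j = 0"
proof -
  define P where "P = (\<Sum>j<n. monom (c j) j)"
  have co: "coeff P j = c j" if "j < n" for j
  proof -
    have "coeff P j = (\<Sum>i<n. if i = j then c j else 0)"
      by (auto simp: P_def coeff_sum intro!: sum.cong)
    then show ?thesis using that by simp
  qed
  have deg: "degree P \<le> n - 1"
    unfolding P_def using assms(2) by (intro degree_sum_le) (auto intro!: order.trans[OF degree_monom_le])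
  have P: "P = [:g:]"
  proof (rule poly_eqI_degree)
    show "poly P x = poly [:g:] x" if "x \<in> A" for x
      using assms(3)[OF that] by (simp add: P_def poly_sum poly_monom)
    show "degree P < card A" "degree [:g:] < card A" using deg assms(1,2) by simp_all
  qed
  show "c 0 = g" using co[OF assms(2)] by (simp add: P)
  show "c j = 0" if "0 < j" "j < n" using co[OF that(2)] that(1) by (cases j) (simp_all add: P)
qed

context claim_matrix
begin

subsection \<open>Invariants after inverting \<open>x\<close>\<close>

definition xfh_alg :: "'a xpoly set" where
  "xfh_alg = mp.span {X ^ e * F1 ^ a * H2 ^ b | e a b. True}"

lemma xfh_alg_I: "X ^ e * F1 ^ a * H2 ^ b \<in> xfh_alg"
  unfolding xfh_alg_def by (rule mp.span_base) auto

lemma subalgebra_xfh_alg: "subalgebra xfh_alg"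
  unfolding xfh_alg_def
proof (rule subalgebra_span)
  show "1 \<in> {X ^ e * F1 ^ a * H2 ^ b | e a b. True}"
    by (auto intro!: exI[of _ 0])
  fix s t assume "s \<in> {X ^ e * F1 ^ a * H2 ^ b | e a b. True}" "t \<in> {X ^ e * F1 ^ a * H2 ^ b | e a b. True}"
  then obtain e a b e' a' b' where "s = X ^ e * F1 ^ a * H2 ^ b" "t = X ^ e' * F1 ^ a' * H2 ^ b'" by blast
  then have "s * t = X ^ (e + e') * F1 ^ (a + a') * H2 ^ (b + b')" by (simp add: power_add)
  then show "s * t \<in> {X ^ e * F1 ^ a * H2 ^ b | e a b. True}" by blast
qed

lemma xfh_alg_gens: "X \<in> xfh_alg" "F1 \<in> xfh_alg" "H2 \<in> xfh_alg" "NY \<in> xfh_alg"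
proof -
  show 1: "X \<in> xfh_alg" "F1 \<in> xfh_alg" "H2 \<in> xfh_alg"
    using xfh_alg_I[of 1 0 0] xfh_alg_I[of 0 1 0] xfh_alg_I[of 0 0 1] by simp_all
  have "NY = H2 * (Const (2 * b3 ^ (p + 1)) * X ^ (p * q + q)) + F1 ^ p - Const (b3 ^ p) * X ^ (p ^ 3 - 2 * p\<^sup>2) * F1\<^sup>2"
    unfolding h2_tilde_eq_H2[symmetric] h2_tilde_def by simp
  also have "\<dots> \<in> xfh_alg"
    by (intro subalgebraD[OF subalgebra_xfh_alg] 1)
  finally show "NY \<in> xfh_alg" .
qed

lemma xfh_alg_subset_inv: "xfh_alg \<subseteq> invariants p M"
  unfolding xfh_alg_def
  using subalgebraD[OF subalgebra_invariants] X_inv F1_inv H2_inv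
  by (intro span_subset_subalgebra subalgebra_invariants) auto

definition xfh_mod :: "'a xpoly set" where
  "xfh_mod = {\<Sum>j<p. \<Sum>i<p ^ 3. c i j * Y ^ i * delta ^ j | c. \<forall>i j. c i j \<in> xfh_alg}"

lemma xfh_mod_add: "f \<in> xfh_mod \<Longrightarrow> g \<in> xfh_mod \<Longrightarrow> f + g \<in> xfh_mod"
proof -
  assume "f \<in> xfh_mod" "g \<in> xfh_mod"
  then obtain c d where "\<forall>i j. c i j \<in> xfh_alg" "\<forall>i j. d i j \<in> xfh_alg"
    "f = (\<Sum>j<p. \<Sum>i<p ^ 3. c i j * Y ^ i * delta ^ j)" "g = (\<Sum>j<p. \<Sum>i<p ^ 3. d i j * Y ^ i * delta ^ j)"
    unfolding xfh_mod_def by blast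
  then have "f + g = (\<Sum>j<p. \<Sum>i<p ^ 3. (c i j + d i j) * Y ^ i * delta ^ j)" "\<forall>i j. c i j + d i j \<in> xfh_alg"
    by (simp_all add: distrib_right sum.distrib subalgebraD[OF subalgebra_xfh_alg])
  then show ?thesis unfolding xfh_mod_def by (auto intro: exI[of _ "\<lambda>i j. c i j + d i j"])
qed

lemma xfh_mod_mult: "w \<in> xfh_alg \<Longrightarrow> f \<in> xfh_mod \<Longrightarrow> w * f \<in> xfh_mod"
proof -
  assume w: "w \<in> xfh_alg" and "f \<in> xfh_mod"
  then obtain c where "\<forall>i j. c i j \<in> xfh_alg" "f = (\<Sum>j<p. \<Sum>i<p ^ 3. c i j * Y ^ i * delta ^ j)"
    unfolding xfh_mod_def by blast
  then have "w * f = (\<Sum>j<p. \<Sum>i<p ^ 3. (w * c i j) * Y ^ i * delta ^ j)" "\<forall>i j. w * c i j \<in> xfh_alg"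
    using w by (simp_all add: sum_distrib_left mult.assoc subalgebraD[OF subalgebra_xfh_alg])
  then show ?thesis unfolding xfh_mod_def by (auto intro: exI[of _ "\<lambda>i j. w * c i j"])
qed

lemma xfh_mod_0: "0 \<in> xfh_mod"
  unfolding xfh_mod_def by (rule CollectI, rule exI[of _ "\<lambda>i j. 0"]) (simp add: subalgebraD[OF subalgebra_xfh_alg])

lemma xfh_mod_sum: "(\<And>i. i \<in> I \<Longrightarrow> f i \<in> xfh_mod) \<Longrightarrow> (\<Sum>i\<in>I. f i) \<in> xfh_mod"
  by (induction I rule: infinite_finite_induct) (auto intro: xfh_mod_0 xfh_mod_add)

lemma xfh_mod_uminus: "f \<in> xfh_mod \<Longrightarrow> - f \<in> xfh_mod"
  using xfh_mod_mult[of "- 1" f] subalgebraD(1)[OF subalgebra_xfh_alg, of "- 1"] by (simp add: Const_uminus)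

lemma xfh_mod_diff: "f \<in> xfh_mod \<Longrightarrow> g \<in> xfh_mod \<Longrightarrow> f - g \<in> xfh_mod"
  using xfh_mod_add[OF _ xfh_mod_uminus] by fastforce

lemma xfh_mod_base: "i < p ^ 3 \<Longrightarrow> j < p \<Longrightarrow> Y ^ i * delta ^ j \<in> xfh_mod"
proof -
  assume ij: "i < p ^ 3" "j < p"
  have "(\<Sum>j'<p. \<Sum>i'<p ^ 3. (if i' = i \<and> j' = j then 1 else 0) * Y ^ i' * delta ^ j')
    = (\<Sum>j'<p. \<Sum>i'<p ^ 3. if i' = i then (if j' = j then Y ^ i * delta ^ j else 0) else 0 :: 'a xpoly)"
    by (intro sum.cong) auto
  also have "\<dots> = Y ^ i * delta ^ j" using ij by simp
  finally show ?thesis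
    unfolding xfh_mod_def using subalgebraD(2,3)[OF subalgebra_xfh_alg]
    by (intro CollectI exI[of _ "\<lambda>i' j'. if i' = i \<and> j' = j then 1 else 0"]) auto
qed

lemma xfh_mod_linear:
  assumes "f \<in> xfh_mod" and "\<And>i j. i < p ^ 3 \<Longrightarrow> j < p \<Longrightarrow> w * (Y ^ i * delta ^ j) \<in> xfh_mod"
  shows "w * f \<in> xfh_mod"
proof -
  obtain c where c: "\<And>i j. c i j \<in> xfh_alg" "f = (\<Sum>j<p. \<Sum>i<p ^ 3. c i j * Y ^ i * delta ^ j)"
    using assms(1) unfolding xfh_mod_def by blast
  have "w * f = (\<Sum>j<p. \<Sum>i<p ^ 3. c i j * (w * (Y ^ i * delta ^ j)))"
    by (simp add: c(2) sum_distrib_left mult_ac)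
  also have "\<dots> \<in> xfh_mod"
    by (intro xfh_mod_sum xfh_mod_mult c assms(2)) auto
  finally show ?thesis .
qed

text \<open>N(y) lies in \<open>xfh_alg\<close> and is monic of degree p^3 in y with coefficients in
  F[x], so it reduces y^(p^3).\<close>

lemma xfh_mod_Y: "f \<in> xfh_mod \<Longrightarrow> Y * f \<in> xfh_mod"
proof (erule xfh_mod_linear)
  fix i j assume ij: "i < p ^ 3" "j < p"
  show "Y * (Y ^ i * delta ^ j) \<in> xfh_mod"
  proof (cases "Suc i < p ^ 3")
    case True
    then show ?thesis using xfh_mod_base[of "Suc i" j] ij by (simp add: mult.assoc)
  next
    case False
    then have "Y * Y ^ i = (Y :: 'a xpoly) ^ p ^ 3" using ij by (metis Suc_lessI power_Suc)
    then have "Y * (Y ^ i * delta ^ j) = NY * (Y ^ 0 * delta ^ j) - Const a2 * X ^ (p ^ 3 - p\<^sup>2) * (Y ^ p\<^sup>2 * delta ^ j)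
      - Const a1 * X ^ (p ^ 3 - p) * (Y ^ p * delta ^ j) - Const a0 * X ^ (p ^ 3 - 1) * (Y ^ 1 * delta ^ j)"
      unfolding orbit_norm_Y mult.assoc[symmetric] by (simp add: algebra_simps)
    also have "\<dots> \<in> xfh_mod"
      using p_powers ij
      by (intro xfh_mod_diff xfh_mod_mult xfh_mod_base xfh_alg_gens subalgebraD[OF subalgebra_xfh_alg]) simp_all
    finally show ?thesis .
  qed
qed

lemma xfh_mod_Y_power: "f \<in> xfh_mod \<Longrightarrow> Y ^ n * f \<in> xfh_mod"
  by (induction n) (simp_all add: xfh_mod_Y mult.assoc)

text \<open>The definition of f1, solved for b3 x^q delta^p, reduces the p-th power of
  \<open>delta\<close> at the price of a factor x^q.\<close>

lemma xfh_mod_delta: "f \<in> xfh_mod \<Longrightarrow> (X ^ q * delta) * f \<in> xfh_mod"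
proof (erule xfh_mod_linear)
  fix i j assume ij: "i < p ^ 3" "j < p"
  note xfh_alg = xfh_alg_gens subalgebraD[OF subalgebra_xfh_alg]
  show "X ^ q * delta * (Y ^ i * delta ^ j) \<in> xfh_mod"
  proof (cases "Suc j < p")
    case True
    have "X ^ q * (Y ^ i * delta ^ Suc j) \<in> xfh_mod" by (intro xfh_mod_mult xfh_mod_base xfh_alg ij True)
    then show ?thesis by (simp add: mult_ac)
  next
    case False
    then have d: "delta * delta ^ j = (delta :: 'a xpoly) ^ p" using ij by (metis Suc_lessI power_Suc)
    have e: "Const b3 * (X ^ q * delta ^ p) = F1 - Yq - Const b2 * Y ^ p * X ^ (q + p) - Const b1 * delta * X ^ (q + (2 * p - 2))
         - Const b0 * Y * X ^ (q + (2 * p - 1))"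
      unfolding f1_hat_def expo by (simp add: algebra_simps)
    have i0: "Y ^ i * delta ^ 0 \<in> xfh_mod" "Y ^ i * delta ^ 1 \<in> xfh_mod"
      using ij p_gt_2 by (intro xfh_mod_base; simp)+
    have "Const b3 * (X ^ q * delta ^ p) * Y ^ i = F1 * (Y ^ i * delta ^ 0) - Yq * (Y ^ i * delta ^ 0)
      - (Const b2 * X ^ (q + p)) * (Y ^ p * (Y ^ i * delta ^ 0)) - (Const b1 * X ^ (q + (2 * p - 2))) * (Y ^ i * delta ^ 1)
      - (Const b0 * X ^ (q + (2 * p - 1))) * (Y * (Y ^ i * delta ^ 0))"
      unfolding e by (simp add: algebra_simps)
    also have "\<dots> \<in> xfh_mod"
      by (intro xfh_mod_diff xfh_mod_mult[where w = "F1"] xfh_mod_mult[where w = "Const c * X ^ n" for c n] xfh_mod_Y_power xfh_mod_Y i0 xfh_alg)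
    finally have "Const (1 / b3) * (Const b3 * (X ^ q * delta ^ p) * Y ^ i) \<in> xfh_mod"
      by (intro xfh_mod_mult[where w = "Const (1 / b3)"] xfh_alg)
    moreover have "Const (1 / b3) * (Const b3 * (X ^ q * delta ^ p) * Y ^ i) = (Const (1 / b3) * Const b3) * (X ^ q * delta * (Y ^ i * delta ^ j))"
      unfolding d[symmetric] by (simp only: mult_ac)
    moreover have "Const (1 / b3) * Const b3 = (1 :: 'a xpoly)" using b3_nz by (simp flip: Const_mult)
    ultimately show ?thesis by (simp only: mult_1)
  qed
qed

lemma ex_X_power_mult_in_xfh_mod: "\<exists>k. X ^ k * f \<in> xfh_mod"
proof (induction f rule: mpoly_induct)
  case (Const c)
  have "Const c * (Y ^ 0 * delta ^ 0) \<in> xfh_mod"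
    using p_gt_0 by (intro xfh_mod_mult xfh_mod_base subalgebraD[OF subalgebra_xfh_alg]) simp_all
  then show ?case by (intro exI[of _ 0]) simp
next
  case (add f g)
  then obtain k l where "X ^ k * f \<in> xfh_mod" "X ^ l * g \<in> xfh_mod" by blast
  moreover have "X ^ n \<in> xfh_alg" for n by (intro subalgebraD[OF subalgebra_xfh_alg] xfh_alg_gens)
  ultimately have "X ^ l * (X ^ k * f) + X ^ k * (X ^ l * g) \<in> xfh_mod"
    by (blast intro: xfh_mod_add xfh_mod_mult)
  then show ?case by (intro exI[of _ "k + l"]) (simp add: power_add algebra_simps)
next
  case (Var w f)
  then obtain k where k: "X ^ k * f \<in> xfh_mod" by blast
  show ?case
  proof (cases w)
    case VX
    then show ?thesis using xfh_mod_mult[OF xfh_alg_gens(1) k] by (auto intro!: exI[of _ k] simp: mult_ac)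
  next
    case VY
    then show ?thesis using xfh_mod_Y[OF k] by (auto intro!: exI[of _ k] simp: mult_ac)
  next
    case VZ
    \<comment> \<open>Uses x z = y^2 - delta, multiplied by the x^q that
      \<open>xfh_mod_delta\<close> demands.\<close>
    have "X ^ q * (Y * (Y * (X ^ k * f))) - X ^ q * delta * (X ^ k * f) \<in> xfh_mod"
      by (intro xfh_mod_diff xfh_mod_delta xfh_mod_Y xfh_mod_mult[where w = "X ^ q"] k subalgebraD[OF subalgebra_xfh_alg] xfh_alg_gens)
    moreover have "X ^ q * (Y * (Y * (X ^ k * f))) - X ^ q * delta * (X ^ k * f) = X ^ (q + k + 1) * (Z * f)"
      by (simp add: delta_def power_add power2_eq_square algebra_simps)
    ultimately show ?thesis using VZ by metis
  qed
qed

text \<open>The coefficients are invariant, so the group moves only y and \<open>delta\<close>. For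
  fixed \<open>u\<close>, a polynomial of degree below p in \<open>delta\<close> takes the value
  \<open>g\<close> at p distinct translates, so its constant term is \<open>g\<close>. That term has
  degree below p^3 in y and takes the value \<open>g\<close> at p^3 translates of y, so
  \<open>g\<close> is the coefficient \<open>c 0 0\<close>.\<close>

lemma inv_xfh_mod_in_xfh_alg:
  assumes "g \<in> invariants p M" "g \<in> xfh_mod"
  shows "g \<in> xfh_alg"
proof -
  obtain c where c: "\<And>i j. c i j \<in> xfh_alg" "g = (\<Sum>j<p. \<Sum>i<p ^ 3. c i j * Y ^ i * delta ^ j)"
    using assms(2) unfolding xfh_mod_def by blast
  define C where "C = (\<lambda>j t. \<Sum>i<p ^ 3. c i j * (Y + Const t * X) ^ i)"
  have act: "g = (\<Sum>j<p. C j (u a) * (delta - Const (v a) * X\<^sup>2) ^ j)" if a: "a \<in> E_exps p" for a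
  proof -
    have "act M a (c i j) = c i j" for i j
      using c(1) xfh_alg_subset_inv a by (auto simp: invariants_def)
    then have "act M a g = (\<Sum>j<p. C j (u a) * (delta - Const (v a) * X\<^sup>2) ^ j)"
      by (simp add: c(2) C_def act_eq_transl transl_sum transl_hom transl_delta sum_distrib_right)
    then show ?thesis using assms(1) a by (simp add: invariants_def)
  qed
  have C0: "C 0 t = g" if t: "t \<in> U" for t
  proof (rule sum_powers_const_imp_coeff(1)[where A = "(\<lambda>d. delta - Const d * X\<^sup>2) ` V t" and n = p and c = "\<lambda>j. C j t"])
    have "inj_on (\<lambda>d. delta - Const d * (X :: 'a xpoly)\<^sup>2) (V t)"
      by (rule inj_onI) simp
    then show "p \<le> card ((\<lambda>d. delta - Const d * (X :: 'a xpoly)\<^sup>2) ` V t)"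
      using card_V[OF t] by (simp add: card_image)
    show "(\<Sum>j<p. C j t * x ^ j) = g" if "x \<in> (\<lambda>d. delta - Const d * X\<^sup>2) ` V t" for x
      using that act by (auto simp: V_def)
  qed (rule p_gt_0)
  have "c 0 0 = g"
  proof (rule sum_powers_const_imp_coeff(1)[where A = "(\<lambda>t. Y + Const t * X) ` U" and n = "p ^ 3" and c = "\<lambda>i. c i 0"])
    have "inj_on (\<lambda>t. Y + Const t * (X :: 'a xpoly)) U"
      by (rule inj_onI) simp
    then show "p ^ 3 \<le> card ((\<lambda>t. Y + Const t * (X :: 'a xpoly)) ` U)"
      by (simp add: card_image card_U)
    show "(\<Sum>i<p ^ 3. c i 0 * x ^ i) = g" if "x \<in> (\<lambda>t. Y + Const t * X) ` U" for x
      using that C0 by (auto simp: C_def)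
  qed (use p_gt_0 in simp)
  then show ?thesis using c(1) by metis
qed

lemma ex_X_power_mult_in_xfh_alg:
  assumes "f \<in> invariants p M"
  shows "\<exists>k. X ^ k * f \<in> xfh_alg"
proof -
  obtain k where "X ^ k * f \<in> xfh_mod" using ex_X_power_mult_in_xfh_mod by blast
  moreover have "X ^ k * f \<in> invariants p M"
    by (intro subalgebraD[OF subalgebra_invariants] X_inv assms)
  ultimately show ?thesis using inv_xfh_mod_in_xfh_alg by blast
qed

subsection \<open>The lead monomial algebra\<close>

definition gen_monom :: "nat \<times> nat \<times> nat \<times> nat \<times> nat \<Rightarrow> 'a xpoly" where
  "gen_monom = (\<lambda>(e, a, b, c, d). X ^ e * F1 ^ a * H2 ^ b * H3 ^ c * NZ ^ d)"

definition lead_gen_monom :: "nat \<times> nat \<times> nat \<times> nat \<times> nat \<Rightarrow> (xyz \<Rightarrow>\<^sub>0 nat)" where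
  "lead_gen_monom = (\<lambda>(e, a, b, c, d). xyzm e (p\<^sup>2 * a + (p\<^sup>2 + 2 * p) * b + (p ^ 3 + 1) * c) (p ^ 4 * d))"

definition reduced_exps :: "(nat \<times> nat \<times> nat \<times> nat \<times> nat) set" where
  "reduced_exps = {(e, a, b, c, d). b < p \<and> c < p}"

definition red_span :: "'a xpoly set" where
  "red_span = mp.span (gen_monom ` reduced_exps)"

lemma lead_gen_monom_eq_sum:
  "lead_gen_monom (e, a, b, c, d) = (\<Sum>i<e. xyzm 1 0 0) + (\<Sum>i<a. xyzm 0 (p\<^sup>2) 0) + (\<Sum>i<b. xyzm 0 (p\<^sup>2 + 2 * p) 0)
    + (\<Sum>i<c. xyzm 0 (p ^ 3 + 1) 0) + (\<Sum>i<d. xyzm 0 0 (p ^ 4))"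
  unfolding sum_xyzm lead_gen_monom_def prod.case
  by (simp add: xyz_mon_eq_iff lookup_add lookup_single algebra_simps)

lemma lead_gen_monom: "is_lead grevlex_less (gen_monom i) (lead_gen_monom i)"
proof -
  obtain e a b c d where i: "i = (e, a, b, c, d)" by (cases i)
  show ?thesis
    unfolding i lead_gen_monom_eq_sum unfolding gen_monom_def prod.case
    by (intro grevlex.is_lead_mult(1) grevlex.is_lead_power lead_X lead_F1 lead_H2 lead_H3 lead_NZ)
qed

text \<open>The exponents of x and z give \<open>e\<close> and \<open>d\<close>. The exponent of y
  is congruent to \<open>c\<close> modulo p; once \<open>c\<close> is removed and p divided out, it
  is congruent to 2 b, which determines \<open>b\<close> as p is odd, and then
  \<open>a\<close>.\<close>

lemma inj_lead_gen_monom: "inj_on lead_gen_monom reduced_exps"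
proof (rule inj_onI)
  fix i j assume "i \<in> reduced_exps" "j \<in> reduced_exps" and eq: "lead_gen_monom i = lead_gen_monom j"
  then obtain e a b c d e' a' b' c' d' where i: "i = (e, a, b, c, d)" "j = (e', a', b', c', d')"
    and lt: "b < p" "c < p" "b' < p" "c' < p" by (auto simp: reduced_exps_def)
  have e: "e = e'" and d: "d = d'"
    using eq p_gt_0 by (simp_all add: lead_gen_monom_def i xyz_mon_eq_iff lookup_add lookup_single)
  have y: "p\<^sup>2 * a + (p\<^sup>2 + 2 * p) * b + (p ^ 3 + 1) * c = p\<^sup>2 * a' + (p\<^sup>2 + 2 * p) * b' + (p ^ 3 + 1) * c'"
    using eq by (simp add: lead_gen_monom_def i xyz_mon_eq_iff lookup_add lookup_single)
  have y1: "p\<^sup>2 * a + (p\<^sup>2 + 2 * p) * b + (p ^ 3 + 1) * c = p * (p * a + (p + 2) * b + p\<^sup>2 * c) + c" for a b c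
    by (simp add: power2_eq_square power3_eq_cube algebra_simps)
  have "c = c'" and y2: "p * a + (p + 2) * b + p\<^sup>2 * c = p * a' + (p + 2) * b' + p\<^sup>2 * c'"
  proof -
    have "(p * (p * a + (p + 2) * b + p\<^sup>2 * c) + c) mod p = (p * (p * a' + (p + 2) * b' + p\<^sup>2 * c') + c') mod p"
      using y unfolding y1 by simp
    then show "c = c'" using lt by simp
    then show "p * a + (p + 2) * b + p\<^sup>2 * c = p * a' + (p + 2) * b' + p\<^sup>2 * c'"
      using y p_gt_0 unfolding y1 by simp
  qed
  then have y3: "p * (a + b) + 2 * b = p * (a' + b') + 2 * b'"
    by (simp add: algebra_simps)
  then have "int p * (int a + int b) + 2 * int b = int p * (int a' + int b') + 2 * int b'"
    by (metis of_nat_add of_nat_mult of_nat_numeral)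
  then have "2 * (int b - int b') = int p * ((int a' + int b') - (int a + int b))"
    by (simp add: algebra_simps)
  then have "int p dvd 2 * (int b - int b')" by simp
  then have "int p dvd 2 \<or> int p dvd int b - int b'"
    using prime_p prime_dvd_mult_iff[of "int p" 2 "int b - int b'"] by (simp only: prime_int_nat_transfer) simp
  moreover have "\<not> int p dvd 2" using p_gt_2 by (auto dest: zdvd_imp_le)
  ultimately have "int b mod int p = int b' mod int p" by (simp add: mod_eq_dvd_iff)
  then have "b = b'" using lt by simp
  then have "a = a'" using y3 p_gt_0 by simp
  then show "i = j" using i e d \<open>b = b'\<close> \<open>c = c'\<close> by simp
qed

lemma red_span_I: "b < p \<Longrightarrow> c < p \<Longrightarrow> X ^ e * F1 ^ a * H2 ^ b * H3 ^ c * NZ ^ d \<in> red_span"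
  unfolding red_span_def by (rule mp.span_base) (auto simp: gen_monom_def reduced_exps_def intro!: image_eqI[of _ _ "(e, a, b, c, d)"])

text \<open>This works because a basis element divisible by \<open>x\<close> is \<open>x\<close> times a basis element, and the others
  have distinct lead monomials not divisible by \<open>x\<close>.\<close>

lemma red_span_X_cancel:
  assumes "X * g \<in> red_span"
  shows "g \<in> red_span"
proof -
  obtain I r where I: "finite I" "I \<subseteq> reduced_exps" "\<And>i. i \<in> I \<Longrightarrow> r i \<noteq> 0" "X * g = (\<Sum>i\<in>I. Const (r i) * gen_monom i)"
    by (rule span_image_finite_sum[OF assms[unfolded red_span_def]]) blast
  define I0 where "I0 = {i \<in> I. fst i = 0}"
  define I1 where "I1 = {i \<in> I. fst i \<noteq> 0}"
  define h where "h = (\<lambda>(e, a, b, c, d). gen_monom (e - 1, a, b, c, d))"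
  have h: "gen_monom i = X * h i" if "i \<in> I1" for i
    using that by (auto simp: I1_def h_def gen_monom_def mult.assoc[symmetric] split: prod.splits simp flip: power_Suc)
  have fin: "finite I0" "finite I1" using I(1) by (simp_all add: I0_def I1_def)
  have split: "X * g = (\<Sum>i\<in>I0. Const (r i) * gen_monom i) + (\<Sum>i\<in>I1. Const (r i) * gen_monom i)"
    unfolding I(4) by (subst sum.union_disjoint[symmetric]) (use fin in \<open>auto simp: I0_def I1_def intro: sum.cong\<close>)
  have I1: "(\<Sum>i\<in>I1. Const (r i) * gen_monom i) = X * (\<Sum>i\<in>I1. Const (r i) * h i)"
    by (simp add: sum_distrib_left h mult.left_commute cong: sum.cong)
  have "I0 = {}"
  proof (rule ccontr)
    assume "I0 \<noteq> {}"
    have r0: "r i \<noteq> 0" if "i \<in> I0" for i using that I(3) by (simp add: I0_def)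
    have "inj_on lead_gen_monom I0" using I(2) by (intro inj_on_subset[OF inj_lead_gen_monom]) (auto simp: I0_def)
    from grevlex.is_lead_sum[where b = gen_monom and c = r, OF fin(1) \<open>I0 \<noteq> {}\<close> this lead_gen_monom r0]
    obtain i where i: "i \<in> I0" "is_lead grevlex_less (\<Sum>i\<in>I0. Const (r i) * gen_monom i) (lead_gen_monom i)"
      by blast
    have "(\<Sum>i\<in>I0. Const (r i) * gen_monom i) = X * (g - (\<Sum>i\<in>I1. Const (r i) * h i))"
      using split unfolding I1 by (simp add: algebra_simps)
    moreover have "lookup (lead_gen_monom i) VX = 0"
      using i(1) by (auto simp: I0_def lead_gen_monom_def lookup_add lookup_single split: prod.splits)
    ultimately have "lookup (\<Sum>i\<in>I0. Const (r i) * gen_monom i) (lead_gen_monom i) = 0"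
      by (simp only: lookup_X_mult_eq_0)
    then show False using i(2) by (simp add: is_lead_def in_keys_iff)
  qed
  then have "X * g = X * (\<Sum>i\<in>I1. Const (r i) * h i)" using split I1 by simp
  then have "g = (\<Sum>i\<in>I1. Const (r i) * h i)" by simp
  moreover have "h i \<in> red_span" if "i \<in> I1" for i
  proof -
    obtain e a b c d where "i = (e, a, b, c, d)" by (cases i)
    then show ?thesis
      using that I(2) red_span_I[of b c "e - 1" a d] by (auto simp: I1_def h_def gen_monom_def reduced_exps_def)
  qed
  ultimately show ?thesis unfolding red_span_def by (auto intro!: mp.span_sum mp.span_scale)
qed

lemma red_span_X_power_cancel: "X ^ k * g \<in> red_span \<Longrightarrow> g \<in> red_span"
  by (induction k) (auto simp: mult.assoc dest: red_span_X_cancel)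


subsection \<open>The invariants are spanned by the reduced monomials\<close>

text \<open>Some x^k N(z) is a combination of monomials in x, f1, h2, whose weight-lead monomials
  x^(e + 2pj) y^(p^2 a) z^(p^2 j) are distinct. Its only monomial of top weight 2 p^4 is x^k
  z^(p^4). So exactly one term has that weight, with a = 0 and j = p^2, and the smaller weight of
  the others bounds their j below p^2.\<close>

lemma X_power_NZ_in_xfh_monoms:
  obtains k e c where "c \<noteq> 0" "X ^ k * NZ - Const c * (X ^ e * H2 ^ p\<^sup>2) \<in> mp.span (xfh_monoms (p\<^sup>2))"
proof -
  obtain k where k: "X ^ k * NZ \<in> xfh_alg" using ex_X_power_mult_in_xfh_alg[OF orbit_norm_inv] by blast
  define b where "b = (\<lambda>(e, a, j). X ^ e * F1 ^ a * H2 ^ j)"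
  define m where "m = (\<lambda>(e, a, j). xyzm (e + 2 * p * j) (p\<^sup>2 * a) (p\<^sup>2 * j))"
  define g where "g = X ^ k * NZ"
  have "{X ^ e * F1 ^ a * H2 ^ b | e a b. True} = b ` UNIV"
    by (auto simp: b_def image_def)
  then have "g \<in> mp.span (b ` UNIV)" using k unfolding xfh_alg_def g_def by simp
  then obtain I c where I: "finite I" "\<And>i. i \<in> I \<Longrightarrow> c i \<noteq> 0" "g = (\<Sum>i\<in>I. Const (c i) * b i)"
    by (rule span_image_finite_sum) blast
  have lead: "is_lead wt_less (b i) (m i)" for i
  proof -
    obtain e a j where i: "i = (e, a, j)" by (cases i)
    have "is_lead wt_less (b i) ((\<Sum>i<e. xyzm 1 0 0) + (\<Sum>i<a. xyzm 0 (p\<^sup>2) 0) + (\<Sum>i<j. xyzm (2 * p) 0 (p\<^sup>2)))"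
      unfolding b_def i prod.case
      using wt.is_lead_Mon[of "xyzm 1 0 0", where 'a='a]
      by (intro wt.is_lead_mult(1) wt.is_lead_power wt_lead_F1 wt_lead_H2) (simp add: Var_def)
    moreover have "(\<Sum>i<e. xyzm 1 0 0) + (\<Sum>i<a. xyzm 0 (p\<^sup>2) 0) + (\<Sum>i<j. xyzm (2 * p) 0 (p\<^sup>2)) = m i"
      unfolding sum_xyzm m_def i prod.case
      by (simp add: xyz_mon_eq_iff lookup_add lookup_single algebra_simps)
    ultimately show ?thesis by simp
  qed
  have inj: "inj_on m I"
    using p_gt_0 by (intro inj_onI) (auto simp: m_def xyz_mon_eq_iff lookup_add lookup_single)
  have wt_m: "wt (m (e, a, j)) = p\<^sup>2 * a + 2 * p\<^sup>2 * j" for e a j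
    by (simp add: m_def wt_def lookup_add lookup_single)
  have "is_lead wt_less (X ^ k :: 'a xpoly) (\<Sum>i<k. xyzm 1 0 0)"
    using wt.is_lead_Mon[of "xyzm 1 0 0", where 'a='a] by (intro wt.is_lead_power) (simp add: Var_def)
  from wt.is_lead_mult(1)[OF this wt_lead_NZ] have "is_lead wt_less g ((\<Sum>i<k. xyzm 1 0 0) + xyzm 0 0 (p ^ 4))"
    by (simp add: g_def)
  moreover have "(\<Sum>i<k. xyzm 1 0 0) + xyzm 0 0 (p ^ 4) = xyzm k 0 (p ^ 4)"
    unfolding sum_xyzm by (simp add: xyz_mon_eq_iff lookup_add lookup_single)
  ultimately have lead_g: "is_lead wt_less g (xyzm k 0 (p ^ 4))" by simp
  have wt_g: "wt (xyzm k 0 (p ^ 4)) = 2 * p ^ 4" by (simp add: wt_def lookup_add lookup_single)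
  \<comment> \<open>Terms of maximal weight cannot cancel, so the lead monomial of each occurs in
    \<open>g\<close>; this determines both the maximal weight and the term attaining it.\<close>
  have max_key: "m i \<in> keys g" if "i \<in> I" "\<And>j. j \<in> I \<Longrightarrow> wt (m j) \<le> wt (m i)" for i
  proof -
    have "lookup g (m i) = c i * lookup (b i) (m i)"
      unfolding I(3) using that
      by (intro wt.lookup_sum_at_maximal[OF I(1) inj lead]) (auto simp: wt_less_def leD)
    then show ?thesis using I(2)[OF that(1)] lead[of i] by (simp add: is_lead_def in_keys_iff)
  qed
  have "g \<noteq> 0" using lead_g by (auto simp: is_lead_def)
  then have "I \<noteq> {}" using I(3) by auto
  then obtain i1 where i1: "i1 \<in> I" "\<And>j. j \<in> I \<Longrightarrow> wt (m j) \<le> wt (m i1)"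
    using wt.ex_maximal[OF I(1), of m] by (auto simp: wt_less_def not_less)
  have key_eq: "wt (m i) \<le> 2 * p ^ 4 \<and> (wt (m i) = 2 * p ^ 4 \<longrightarrow> m i = xyzm k 0 (p ^ 4))" if "m i \<in> keys g" for i
    using lead_g that wt_g unfolding is_lead_def wt_less_def by (metis less_imp_le less_irrefl order_refl)
  have "wt (m i1) = 2 * p ^ 4"
  proof -
    have "xyzm k 0 (p ^ 4) \<in> keys g" using lead_g by (simp add: is_lead_def)
    then obtain i where i: "i \<in> I" "xyzm k 0 (p ^ 4) \<in> keys (Const (c i) * b i)"
      unfolding I(3) by (rule in_keys_sumE)
    then have "xyzm k 0 (p ^ 4) \<in> keys (b i)" by (auto simp: in_keys_iff)
    then have "xyzm k 0 (p ^ 4) = m i \<or> wt (xyzm k 0 (p ^ 4)) < wt (m i)"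
      using lead[of i] unfolding is_lead_def wt_less_def by blast
    then have "2 * p ^ 4 \<le> wt (m i)" unfolding wt_g[symmetric] by (metis less_imp_le order_refl)
    then show ?thesis using i1(2)[OF i(1)] key_eq[OF max_key[OF i1]] by simp
  qed
  then have mi1: "m i1 = xyzm k 0 (p ^ 4)" using key_eq[OF max_key[OF i1]] by blast
  obtain e a j where i1_eq: "i1 = (e, a, j)" by (cases i1)
  have pj: "p\<^sup>2 * j = p ^ 4" "p\<^sup>2 * a = 0"
    using mi1 by (simp_all add: m_def i1_eq xyz_mon_eq_iff lookup_add lookup_single)
  have p4: "p ^ 4 = p\<^sup>2 * p\<^sup>2" using power_add[of p 2 2] by simp
  then have j: "j = p\<^sup>2" "a = 0"
    using pj p_gt_0 unfolding p4 mult_cancel1 by simp_all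
  have "g = Const (c i1) * b i1 + (\<Sum>i\<in>I - {i1}. Const (c i) * b i)"
    unfolding I(3) using I(1) i1(1) by (simp add: sum.remove)
  then have g: "g - Const (c i1) * (X ^ e * H2 ^ p\<^sup>2) = (\<Sum>i\<in>I - {i1}. Const (c i) * b i)"
    by (simp add: b_def i1_eq j)
  have "b i \<in> mp.span (xfh_monoms (p\<^sup>2))" if i: "i \<in> I - {i1}" for i
  proof -
    obtain e' a' j' where i_eq: "i = (e', a', j')" by (cases i)
    have "wt (m i) \<noteq> 2 * p ^ 4"
    proof
      assume w: "wt (m i) = 2 * p ^ 4"
      then have "m i \<in> keys g" using i i1(2) \<open>wt (m i1) = 2 * p ^ 4\<close> by (intro max_key) auto
      then have "m i = m i1" using key_eq w mi1 by auto
      then show False using i i1(1) inj by (auto dest: inj_onD)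
    qed
    then have "wt (m i) < 2 * p ^ 4" using i1(2)[of i] i \<open>wt (m i1) = 2 * p ^ 4\<close> by simp
    then have "2 * p\<^sup>2 * j' < 2 * p\<^sup>2 * p\<^sup>2" unfolding i_eq wt_m p4 by linarith
    then have "j' < p\<^sup>2" using p_gt_0 by (simp only: mult_less_cancel1)
    then show ?thesis by (simp add: b_def i_eq xfh_monoms_I)
  qed
  then have "X ^ k * NZ - Const (c i1) * (X ^ e * H2 ^ p\<^sup>2) \<in> mp.span (xfh_monoms (p\<^sup>2))"
    unfolding g_def[symmetric] g by (intro mp.span_sum mp.span_scale)
  then show ?thesis using that I(2)[OF i1(1)] by blast
qed

text \<open>Frobenius acts term by term, and b < p gives b p < p^2.\<close>

lemma rho_power_in_span: "rho ^ p \<in> mp.span (xfh_monoms (p\<^sup>2))"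
  using rho_in_span
proof (induction rule: mp.span_induct_alt)
  case base
  then show ?case using p_gt_0 by (simp add: mp.span_zero zero_power)
next
  case (step c s f)
  then obtain e a b where s: "s = X ^ e * F1 ^ a * H2 ^ b" "b < p" by (auto simp: xfh_monoms_def)
  have "s ^ p = X ^ (e * p) * F1 ^ (a * p) * H2 ^ (b * p)"
    by (simp add: s power_mult_distrib power_mult)
  moreover have "b * p < p\<^sup>2" using s(2) p_gt_0 by (simp add: power2_eq_square)
  ultimately have "s ^ p \<in> mp.span (xfh_monoms (p\<^sup>2))" by (simp add: xfh_monoms_I)
  moreover have "(Const c * s + f) ^ p = Const (c ^ p) * s ^ p + f ^ p"
    by (simp add: power_p_hom power_mult_distrib Const_power)
  ultimately show ?case using step by (simp add: mp.span_add mp.span_scale)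
qed

text \<open>The bound counts h3 with degree p, its degree in h2 up to powers of x, so that rewriting
  h2^p never raises it.\<close>

definition xfhh_monoms :: "nat \<Rightarrow> 'a xpoly set" where
  "xfhh_monoms n = {X ^ e * F1 ^ a * H2 ^ b * H3 ^ c | e a b c. b < p \<and> b + p * c \<le> n}"

lemma xfhh_monoms_I: "b < p \<Longrightarrow> b + p * c \<le> n \<Longrightarrow> X ^ e * F1 ^ a * H2 ^ b * H3 ^ c \<in> mp.span (xfhh_monoms n)"
  by (rule mp.span_base) (auto simp: xfhh_monoms_def)

lemma H2_mult_xfhh_monoms:
  assumes "f \<in> mp.span (xfhh_monoms n)"
  shows "H2 * f \<in> mp.span (xfhh_monoms (Suc n))"
proof (rule span_mult_left[OF assms])
  fix s assume "s \<in> xfhh_monoms n"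
  then obtain e a b c where s: "s = X ^ e * F1 ^ a * H2 ^ b * H3 ^ c" "b < p" "b + p * c \<le> n"
    by (auto simp: xfhh_monoms_def)
  show "H2 * s \<in> mp.span (xfhh_monoms (Suc n))"
  proof (cases "Suc b < p")
    case True
    then have "X ^ e * F1 ^ a * H2 ^ Suc b * H3 ^ c \<in> mp.span (xfhh_monoms (Suc n))" using s by (intro xfhh_monoms_I) simp_all
    then show ?thesis by (simp add: s mult_ac)
  next
    case False
    then have b: "p = Suc b" using s(2) by simp
    then have pw: "H2 * H2 ^ b = H2 ^ p" by simp
    obtain k where k: "H2 ^ p = Const k * X ^ (2 * p\<^sup>2 - 1) * H3 + rho" by (rule H2_power_p)
    have "H2 * s = (H2 * H2 ^ b) * (X ^ e * F1 ^ a * H3 ^ c)" by (simp add: s mult_ac)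
    also have "\<dots> = Const k * (X ^ (e + (2 * p\<^sup>2 - 1)) * F1 ^ a * H2 ^ 0 * H3 ^ Suc c) + X ^ e * F1 ^ a * H3 ^ c * rho"
      unfolding pw k by (simp add: power_add algebra_simps)
    also have "\<dots> \<in> mp.span (xfhh_monoms (Suc n))"
    proof (intro mp.span_add mp.span_scale xfhh_monoms_I)
      show "0 + p * Suc c \<le> Suc n" using s(3) b by simp
      show "X ^ e * F1 ^ a * H3 ^ c * rho \<in> mp.span (xfhh_monoms (Suc n))"
      proof (rule span_mult_left[OF rho_in_span])
        fix t assume "t \<in> xfh_monoms p"
        then obtain e' a' b' where t: "t = X ^ e' * F1 ^ a' * H2 ^ b'" "b' < p" by (auto simp: xfh_monoms_def)
        have "X ^ (e + e') * F1 ^ (a + a') * H2 ^ b' * H3 ^ c \<in> mp.span (xfhh_monoms (Suc n))"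
          using t(2) s(3) b by (intro xfhh_monoms_I) simp_all
        then show "X ^ e * F1 ^ a * H3 ^ c * t \<in> mp.span (xfhh_monoms (Suc n))" by (simp add: t power_add mult_ac)
      qed
    qed (rule p_gt_0)
    finally show ?thesis .
  qed
qed

text \<open>Below degree p^2 in h2 the bound on b + p c forces c < p. No h3^p can arise, which makes
  this available before h3^p can be rewritten.\<close>

lemma xfh_monoms_subset_red_span: "mp.span (xfh_monoms (p\<^sup>2)) \<subseteq> red_span"
proof -
  have H: "X ^ e * F1 ^ a * H2 ^ n \<in> mp.span (xfhh_monoms n)" for e a n
  proof (induction n)
    case 0
    then show ?case using xfhh_monoms_I[of 0 0 0 e a] p_gt_0 by simp
  next
    case (Suc n)
    then show ?case using H2_mult_xfhh_monoms[of "X ^ e * F1 ^ a * H2 ^ n" n] by (simp add: mult_ac)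
  qed
  have G: "xfhh_monoms n \<subseteq> red_span" if "n < p\<^sup>2" for n
  proof
    fix s assume "s \<in> xfhh_monoms n"
    then obtain e a b c where s: "s = X ^ e * F1 ^ a * H2 ^ b * H3 ^ c" "b < p" "b + p * c \<le> n"
      by (auto simp: xfhh_monoms_def)
    have "p * c < p * p" using that s(3) unfolding power2_eq_square by linarith
    then have "c < p" by simp
    then show "s \<in> red_span" using red_span_I[of b c e a 0] s by simp
  qed
  have "xfh_monoms (p\<^sup>2) \<subseteq> red_span"
  proof
    fix s assume "s \<in> xfh_monoms (p\<^sup>2)"
    then obtain e a n where s: "s = X ^ e * F1 ^ a * H2 ^ n" "n < p\<^sup>2" by (auto simp: xfh_monoms_def)
    have "mp.span (xfhh_monoms n) \<subseteq> red_span"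
      unfolding red_span_def by (rule mp.span_minimal) (use G[OF s(2)] in \<open>simp_all add: red_span_def mp.subspace_span\<close>)
    then show "s \<in> red_span" using H s(1) by blast
  qed
  then show ?thesis unfolding red_span_def by (rule mp.span_minimal) (rule mp.subspace_span)
qed

text \<open>The p-th power of the first relation expresses h2^(p^2) by a power of x times h3^p, plus
  \<open>rho ^ p\<close>. Inserted into the expansion of x^k N(z), it places a power of x times h3^p
  in the span, and the power of x cancels.\<close>

lemma H3_power_p_in_red_span: "H3 ^ p \<in> red_span"
proof -
  obtain k e c where 1: "c \<noteq> 0" "X ^ k * NZ - Const c * (X ^ e * H2 ^ p\<^sup>2) \<in> mp.span (xfh_monoms (p\<^sup>2))"
    by (rule X_power_NZ_in_xfh_monoms)
  obtain d where d: "d \<noteq> 0" "H2 ^ p = Const d * X ^ (2 * p\<^sup>2 - 1) * H3 + rho" by (rule H2_power_p)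
  have "H2 ^ p\<^sup>2 = (H2 ^ p) ^ p" by (simp add: power2_eq_square power_mult)
  also have "\<dots> = Const (d ^ p) * X ^ ((2 * p\<^sup>2 - 1) * p) * H3 ^ p + rho ^ p"
    unfolding d(2) power_p_hom power_mult_distrib Const_power by (simp add: power_mult)
  finally have H: "H2 ^ p\<^sup>2 = Const (d ^ p) * X ^ ((2 * p\<^sup>2 - 1) * p) * H3 ^ p + rho ^ p" .
  have eq: "Const (c * d ^ p) * (X ^ (e + (2 * p\<^sup>2 - 1) * p) * H3 ^ p)
      = X ^ k * NZ - Const c * (X ^ e * rho ^ p) - (X ^ k * NZ - Const c * (X ^ e * H2 ^ p\<^sup>2))"
    unfolding H Const_mult power_add[of X e] by (simp only: algebra_simps)
  have "X ^ e * rho ^ p \<in> mp.span (xfh_monoms (p\<^sup>2))"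
  proof (rule span_mult_left[OF rho_power_in_span])
    fix s assume "s \<in> xfh_monoms (p\<^sup>2)"
    then obtain e' a b where "s = X ^ e' * F1 ^ a * H2 ^ b" "b < p\<^sup>2" by (auto simp: xfh_monoms_def)
    then show "X ^ e * s \<in> mp.span (xfh_monoms (p\<^sup>2))" using xfh_monoms_I[of b "p\<^sup>2" "e + e'" a] by (simp add: power_add mult_ac)
  qed
  moreover have "X ^ k * NZ \<in> red_span" using red_span_I[of 0 0 k 0 1] p_gt_0 by simp
  ultimately have "Const (c * d ^ p) * (X ^ (e + (2 * p\<^sup>2 - 1) * p) * H3 ^ p) \<in> red_span"
    unfolding eq using xfh_monoms_subset_red_span 1(2) unfolding red_span_def
    by (intro mp.span_diff[OF mp.span_diff[OF _ mp.span_scale]]) auto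
  then have "Const (1 / (c * d ^ p)) * (Const (c * d ^ p) * (X ^ (e + (2 * p\<^sup>2 - 1) * p) * H3 ^ p)) \<in> red_span"
    unfolding red_span_def by (rule mp.span_scale)
  then have "X ^ (e + (2 * p\<^sup>2 - 1) * p) * H3 ^ p \<in> red_span"
    using 1(1) d(1) unfolding mult.assoc[symmetric] by (simp flip: Const_mult)
  then show ?thesis by (rule red_span_X_power_cancel)
qed

lemma red_span_mult_left:
  assumes "f \<in> red_span"
    and "\<And>e a b c d. b < p \<Longrightarrow> c < p \<Longrightarrow> h * (X ^ e * F1 ^ a * H2 ^ b * H3 ^ c * NZ ^ d) \<in> red_span"
  shows "h * f \<in> red_span"
  using assms unfolding red_span_def
  by (intro span_mult_left[of f "gen_monom ` reduced_exps"]) (auto simp: gen_monom_def reduced_exps_def)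

lemma red_span_XFN: "f \<in> red_span \<Longrightarrow> X ^ e * F1 ^ a * NZ ^ d * f \<in> red_span"
proof (erule red_span_mult_left)
  fix e' a' b c d' assume "b < p" "c < p"
  then have "X ^ (e + e') * F1 ^ (a + a') * H2 ^ b * H3 ^ c * NZ ^ (d + d') \<in> red_span" by (rule red_span_I)
  then show "X ^ e * F1 ^ a * NZ ^ d * (X ^ e' * F1 ^ a' * H2 ^ b * H3 ^ c * NZ ^ d') \<in> red_span"
    by (simp add: power_add mult_ac)
qed

text \<open>When \<open>b\<close> and \<open>c\<close> are both p - 1, rewriting h2^p produces h3^p,
  but with only x, f1 and N(z) beside it, so \<open>red_span_XFN\<close> suffices. Closure under h3
  can then use closure under h2.\<close>

lemma red_span_H2: "f \<in> red_span \<Longrightarrow> H2 * f \<in> red_span"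
proof (erule red_span_mult_left)
  fix e a b c d assume b: "b < p" and c: "c < p"
  let ?s = "X ^ e * F1 ^ a * H2 ^ b * H3 ^ c * NZ ^ d"
  show "H2 * ?s \<in> red_span"
  proof (cases "Suc b < p")
    case True
    then have "X ^ e * F1 ^ a * H2 ^ Suc b * H3 ^ c * NZ ^ d \<in> red_span" using c by (rule red_span_I)
    then show ?thesis by (simp add: mult_ac)
  next
    case False
    then have pw: "H2 * H2 ^ b = H2 ^ p" using b by (metis Suc_lessI power_Suc)
    obtain k where k: "H2 ^ p = Const k * X ^ (2 * p\<^sup>2 - 1) * H3 + rho" by (rule H2_power_p)
    have "H2 * ?s = (H2 * H2 ^ b) * (X ^ e * F1 ^ a * H3 ^ c * NZ ^ d)" by (simp add: mult_ac)
    also have "\<dots> = Const k * (X ^ (e + (2 * p\<^sup>2 - 1)) * F1 ^ a * NZ ^ d * H3 ^ Suc c) + X ^ e * F1 ^ a * NZ ^ d * (H3 ^ c * rho)"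
      unfolding pw k by (simp add: power_add algebra_simps)
    also have "\<dots> \<in> red_span"
    proof -
      have "H3 ^ Suc c \<in> red_span"
      proof (cases "Suc c < p")
        case True
        then show ?thesis using red_span_I[of 0 "Suc c" 0 0 0] p_gt_0 by simp
      next
        case False
        then have "Suc c = p" using c by simp
        then show ?thesis using H3_power_p_in_red_span by simp
      qed
      then have 1: "X ^ (e + (2 * p\<^sup>2 - 1)) * F1 ^ a * NZ ^ d * H3 ^ Suc c \<in> red_span" by (rule red_span_XFN)
      have "H3 ^ c * rho \<in> mp.span (gen_monom ` reduced_exps)"
      proof (rule span_mult_left[OF rho_in_span])
        fix t assume "t \<in> xfh_monoms p"
        then obtain e' a' b' where t: "t = X ^ e' * F1 ^ a' * H2 ^ b'" "b' < p" by (auto simp: xfh_monoms_def)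
        then show "H3 ^ c * t \<in> mp.span (gen_monom ` reduced_exps)"
          using red_span_I[of b' c e' a' 0] c unfolding red_span_def[symmetric] by (simp add: mult_ac)
      qed
      then have "X ^ e * F1 ^ a * NZ ^ d * (H3 ^ c * rho) \<in> red_span" by (intro red_span_XFN) (simp add: red_span_def)
      with 1 show ?thesis unfolding red_span_def by (intro mp.span_add mp.span_scale)
    qed
    finally show ?thesis .
  qed
qed

lemma red_span_H2_power: "f \<in> red_span \<Longrightarrow> H2 ^ n * f \<in> red_span"
  by (induction n) (simp_all add: red_span_H2 mult.assoc)

lemma red_span_H3: "f \<in> red_span \<Longrightarrow> H3 * f \<in> red_span"
proof (erule red_span_mult_left)
  fix e a b c d assume b: "b < p" and c: "c < p"
  let ?s = "X ^ e * F1 ^ a * H2 ^ b * H3 ^ c * NZ ^ d"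
  show "H3 * ?s \<in> red_span"
  proof (cases "Suc c < p")
    case True
    then have "X ^ e * F1 ^ a * H2 ^ b * H3 ^ Suc c * NZ ^ d \<in> red_span" using b by (intro red_span_I)
    then show ?thesis by (simp add: mult_ac)
  next
    case False
    then have pw: "H3 * H3 ^ c = H3 ^ p" using c by (metis Suc_lessI power_Suc)
    have "X ^ e * F1 ^ a * NZ ^ d * (H2 ^ b * H3 ^ p) \<in> red_span"
      by (intro red_span_XFN red_span_H2_power H3_power_p_in_red_span)
    then show ?thesis unfolding pw[symmetric] by (simp add: mult_ac)
  qed
qed

lemma red_span_gen_monom: "f \<in> red_span \<Longrightarrow> gen_monom i * f \<in> red_span"
proof -
  assume f: "f \<in> red_span"
  obtain e a b c d where i: "i = (e, a, b, c, d)" by (cases i)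
  have "H3 ^ n * f \<in> red_span" for n by (induction n) (simp_all add: f red_span_H3 mult.assoc)
  then have "X ^ e * F1 ^ a * NZ ^ d * (H2 ^ b * (H3 ^ c * f)) \<in> red_span" by (intro red_span_XFN red_span_H2_power)
  then show ?thesis by (simp add: i gen_monom_def mult_ac)
qed

lemma one_in_red_span: "1 \<in> red_span"
  using red_span_I[of 0 0 0 0 0] p_gt_0 by simp

lemma gen_monom_in_red_span: "gen_monom i \<in> red_span"
  using red_span_gen_monom[OF one_in_red_span] by simp

lemma gen_monom_in_inv: "gen_monom i \<in> invariants p M"
proof -
  obtain e a b c d where i: "i = (e, a, b, c, d)" by (cases i)
  show ?thesis
    unfolding gen_monom_def i prod.case
    by (intro subalgebraD[OF subalgebra_invariants] X_inv F1_inv H2_inv H3_inv orbit_norm_inv)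
qed

theorem invariants_eq_red_span: "invariants p M = red_span"
proof
  show "red_span \<subseteq> invariants p M"
    unfolding red_span_def using gen_monom_in_inv by (intro span_subset_subalgebra subalgebra_invariants) auto
  show "invariants p M \<subseteq> red_span"
  proof
    fix f assume "f \<in> invariants p M"
    then obtain k where k: "X ^ k * f \<in> xfh_alg" using ex_X_power_mult_in_xfh_alg by blast
    have "xfh_alg \<subseteq> red_span"
      unfolding xfh_alg_def red_span_def
    proof (rule mp.span_minimal)
      show "{X ^ e * F1 ^ a * H2 ^ b | e a b. True} \<subseteq> mp.span (gen_monom ` reduced_exps)"
      proof
        fix s assume "s \<in> {X ^ e * F1 ^ a * H2 ^ b | e a b. True}"
        then obtain e a b where "s = gen_monom (e, a, b, 0, 0)" by (auto simp: gen_monom_def)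
        then show "s \<in> mp.span (gen_monom ` reduced_exps)" using gen_monom_in_red_span by (simp add: red_span_def)
      qed
    qed (rule mp.subspace_span)
    then show "f \<in> red_span" using k red_span_X_power_cancel by blast
  qed
qed

end

subsection \<open>Ideals of polynomial rings\<close>

lemma polyring_closed:
  fixes f g :: "(nat, 'a::field) mpoly" and c :: 'a
  shows "f \<in> polyring n \<Longrightarrow> g \<in> polyring n \<Longrightarrow> f + g \<in> polyring n"
  "f \<in> polyring n \<Longrightarrow> g \<in> polyring n \<Longrightarrow> f * g \<in> polyring n"
  "f \<in> polyring n \<Longrightarrow> - f \<in> polyring n"
  "f \<in> polyring n \<Longrightarrow> g \<in> polyring n \<Longrightarrow> f - g \<in> polyring n"
  "Const c \<in> polyring n" "(0 :: (nat, 'a) mpoly) \<in> polyring n" "(1 :: (nat, 'a) mpoly) \<in> polyring n"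
  "keys K \<subseteq> {..<n} \<Longrightarrow> (Mon K :: (nat, 'a) mpoly) \<in> polyring n"
proof -
  show add: "f \<in> polyring n \<Longrightarrow> g \<in> polyring n \<Longrightarrow> f + g \<in> polyring n" for f g :: "(nat, 'a) mpoly"
    unfolding polyring_def by (blast dest: in_keys_addD)
  show "f \<in> polyring n \<Longrightarrow> g \<in> polyring n \<Longrightarrow> f * g \<in> polyring n"
  proof -
    assume f: "f \<in> polyring n" and g: "g \<in> polyring n"
    have "keys m \<subseteq> {..<n}" if "m \<in> keys (f * g)" for m
    proof -
      from that obtain a b where "m = a + b" "a \<in> keys f" "b \<in> keys g" by (rule in_keys_multE)
      then show ?thesis using f g Poly_Mapping.keys_add[of a b] unfolding polyring_def by blast
    qed
    then show ?thesis by (simp add: polyring_def)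
  qed
  show neg: "f \<in> polyring n \<Longrightarrow> - f \<in> polyring n" for f :: "(nat, 'a) mpoly"
    by (simp add: polyring_def in_keys_iff)
  show "f \<in> polyring n \<Longrightarrow> g \<in> polyring n \<Longrightarrow> f - g \<in> polyring n"
    using add[OF _ neg, of f g] by simp
  show C: "Const c \<in> polyring n" for c :: 'a by (auto simp: polyring_def Const_def split: if_splits)
  show "(0 :: (nat, 'a) mpoly) \<in> polyring n" "(1 :: (nat, 'a) mpoly) \<in> polyring n"
    using C[of 0] C[of 1] by simp_all
  show "keys K \<subseteq> {..<n} \<Longrightarrow> (Mon K :: (nat, 'a) mpoly) \<in> polyring n" by (simp add: polyring_def)
qed

lemma ideal_gen_closed:
  fixes rs :: "(nat, 'a::field) mpoly list"
  shows "0 \<in> ideal_gen (polyring n) rs"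
    and "f \<in> ideal_gen (polyring n) rs \<Longrightarrow> g \<in> ideal_gen (polyring n) rs \<Longrightarrow> f + g \<in> ideal_gen (polyring n) rs"
    and "f \<in> ideal_gen (polyring n) rs \<Longrightarrow> h \<in> polyring n \<Longrightarrow> h * f \<in> ideal_gen (polyring n) rs"
    and "i < length rs \<Longrightarrow> rs ! i \<in> ideal_gen (polyring n) rs"
proof -
  show "0 \<in> ideal_gen (polyring n) rs"
    unfolding ideal_gen_def by (rule CollectI, rule exI[of _ "\<lambda>_. 0"]) (simp add: polyring_closed)
  show "f + g \<in> ideal_gen (polyring n) rs" if "f \<in> ideal_gen (polyring n) rs" "g \<in> ideal_gen (polyring n) rs"
  proof -
    from that obtain c d where "f = (\<Sum>i<length rs. c i * rs ! i)" "g = (\<Sum>i<length rs. d i * rs ! i)"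
      "\<forall>i<length rs. c i \<in> polyring n" "\<forall>i<length rs. d i \<in> polyring n" unfolding ideal_gen_def by blast
    then have "f + g = (\<Sum>i<length rs. (c i + d i) * rs ! i)" "\<forall>i<length rs. c i + d i \<in> polyring n"
      by (simp_all add: distrib_right sum.distrib polyring_closed)
    then show ?thesis unfolding ideal_gen_def by (auto intro: exI[of _ "\<lambda>i. c i + d i"])
  qed
  show "h * f \<in> ideal_gen (polyring n) rs" if "f \<in> ideal_gen (polyring n) rs" "h \<in> polyring n"
  proof -
    from that obtain c where "f = (\<Sum>i<length rs. c i * rs ! i)"
      "\<forall>i<length rs. c i \<in> polyring n" unfolding ideal_gen_def by blast
    then have "h * f = (\<Sum>i<length rs. (h * c i) * rs ! i)" "\<forall>i<length rs. h * c i \<in> polyring n"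
      using that(2) by (simp_all add: sum_distrib_left mult.assoc polyring_closed)
    then show ?thesis unfolding ideal_gen_def by (auto intro: exI[of _ "\<lambda>i. h * c i"])
  qed
  show "rs ! i \<in> ideal_gen (polyring n) rs" if "i < length rs"
  proof -
    have "rs ! i = (\<Sum>j<length rs. (if j = i then 1 else 0) * rs ! j)"
      using that by (simp add: if_distrib[of "\<lambda>x. x * _"] cong: if_cong)
    moreover have "\<forall>j<length rs. (if j = i then 1 else 0) \<in> polyring n" by (simp add: polyring_closed)
    ultimately show ?thesis unfolding ideal_gen_def by (auto intro: exI[of _ "\<lambda>j. if j = i then 1 else 0"])
  qed
qed

lemma ideal_gen_diff:
  fixes rs :: "(nat, 'a::field) mpoly list"
  assumes "f \<in> ideal_gen (polyring n) rs" "g \<in> ideal_gen (polyring n) rs"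
  shows "f - g \<in> ideal_gen (polyring n) rs"
  using ideal_gen_closed(2)[OF assms(1) ideal_gen_closed(3)[OF assms(2) polyring_closed(5)[of "- 1"]]]
  by (simp add: Const_uminus)

section \<open>Exponents of the five generators and an order on them\<close>

context claim_matrix
begin

definition bs :: "'a xpoly list" where
  "bs = [X, F1, H2, H3, NZ]"

lemma length_bs: "length bs = 5"
  by (simp add: bs_def)

definition tup :: "(nat \<Rightarrow>\<^sub>0 nat) \<Rightarrow> nat \<times> nat \<times> nat \<times> nat \<times> nat" where
  "tup K = (lookup K 0, lookup K 1, lookup K 2, lookup K 3, lookup K 4)"

definition gens_lead :: "(nat \<Rightarrow>\<^sub>0 nat) \<Rightarrow> (xyz \<Rightarrow>\<^sub>0 nat)" where
  "gens_lead K = lead_gen_monom (tup K)"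

abbreviation supp5 :: "(nat \<Rightarrow>\<^sub>0 nat) \<Rightarrow> bool" where
  "supp5 K \<equiv> keys K \<subseteq> {..<5}"

lemma lessThan_5: "{..<5::nat} = {0, 1, 2, 3, 4}"
  by auto

lemma gens_pow_eq: "gens_pow bs K = gen_monom (tup K)"
  unfolding gens_pow_def length_bs lessThan_5 by (simp add: bs_def gen_monom_def tup_def mult_ac)

lemma gens_lead_add: "gens_lead (K + L) = gens_lead K + gens_lead L"
  by (simp add: gens_lead_def lead_gen_monom_def tup_def xyz_mon_eq_iff lookup_add lookup_single algebra_simps)

lemma lead_gens_pow: "is_lead grevlex_less (gens_pow bs K) (gens_lead K)"
  by (simp add: gens_pow_eq gens_lead_def lead_gen_monom)

lemma gens_pow_nz: "gens_pow bs K \<noteq> 0"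
  using lead_gens_pow[of K] by (auto simp: is_lead_def)

lemma lead_mon_gens_pow: "c \<noteq> 0 \<Longrightarrow> lead_mon (Const c * gens_pow bs K) = gens_lead K"
  by (intro lead_mon_eqI grevlex.is_lead_Const_mult lead_gens_pow)

lemma supp5_eq_iff: "supp5 K \<Longrightarrow> supp5 L \<Longrightarrow> tup K = tup L \<Longrightarrow> K = L"
proof (rule poly_mapping_eqI)
  fix i assume K: "supp5 K" and L: "supp5 L" and "tup K = tup L"
  show "lookup K i = lookup L i"
  proof (cases "i < 5")
    case True
    then have "i \<in> {0, 1, 2, 3, 4}" using lessThan_5 by blast
    then show ?thesis using \<open>tup K = tup L\<close> by (auto simp: tup_def)
  next
    case False
    then have "i \<notin> keys K" "i \<notin> keys L" using K L by auto
    then show ?thesis by (simp add: in_keys_iff)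
  qed
qed

definition of_tup :: "nat \<times> nat \<times> nat \<times> nat \<times> nat \<Rightarrow> (nat \<Rightarrow>\<^sub>0 nat)" where
  "of_tup = (\<lambda>(e, a, b, c, d). Poly_Mapping.single 0 e + Poly_Mapping.single 1 a + Poly_Mapping.single 2 b
     + Poly_Mapping.single 3 c + Poly_Mapping.single 4 d)"

lemma tup_of_tup [simp]: "tup (of_tup i) = i"
  by (cases i) (simp add: tup_def of_tup_def lookup_add lookup_single)

lemma supp5_of_tup [simp]: "supp5 (of_tup i)"
  by (cases i) (auto simp: of_tup_def dest!: in_keys_addD split: if_splits)

definition lt5 :: "(nat \<Rightarrow>\<^sub>0 nat) \<Rightarrow> (nat \<Rightarrow>\<^sub>0 nat) \<Rightarrow> bool" where
  "lt5 K L \<longleftrightarrow> grevlex_less (gens_lead K) (gens_lead L) \<or> gens_lead K = gens_lead L \<and> L < K"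

text \<open>Ties are broken by the reversed order on exponents, so that the lead monomials of the two
  relations are the coprime monomials \<open>X\<^sub>2\<^sup>p\<close> and \<open>X\<^sub>3\<^sup>p\<close>.\<close>

interpretation ord5: total_mon_order lt5
proof
  fix k l m n :: "nat \<Rightarrow>\<^sub>0 nat"
  show "\<not> lt5 m m" by (simp add: lt5_def grevlex.irrefl)
  show "lt5 l m \<Longrightarrow> lt5 m n \<Longrightarrow> lt5 l n"
    unfolding lt5_def by (metis grevlex.trans less_trans)
  show "lt5 m n \<Longrightarrow> lt5 (m + k) (n + k)"
    by (auto simp: lt5_def gens_lead_add grevlex.add_right add_strict_right_mono)
  show "m \<noteq> n \<Longrightarrow> lt5 m n \<or> lt5 n m"
    unfolding lt5_def using grevlex.total by (metis neq_iff)
qed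

text \<open>Every generator has positive degree, so the degree of the lead monomial bounds all five
  exponents.\<close>

lemma finite_lt5: "finite {L. supp5 L \<and> lt5 L K}"
proof -
  let ?N = "mdeg (gens_lead K)"
  have "{L. supp5 L \<and> lt5 L K} \<subseteq> of_tup ` ({..?N} \<times> {..?N} \<times> {..?N} \<times> {..?N} \<times> {..?N})"
  proof
    fix L assume "L \<in> {L. supp5 L \<and> lt5 L K}"
    then have L: "supp5 L" and "mdeg (gens_lead L) \<le> ?N" by (auto simp: lt5_def grevlex_less_def)
    moreover have "n \<le> k * n" if "0 < k" for k n :: nat using that by (cases k) simp_all
    then have "lookup L 1 \<le> p\<^sup>2 * lookup L 1" "lookup L 2 \<le> (p\<^sup>2 + 2 * p) * lookup L 2"
      "lookup L 3 \<le> (p ^ 3 + 1) * lookup L 3" "lookup L 4 \<le> p ^ 4 * lookup L 4"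
      using p_gt_0 by (simp_all only: zero_less_power add_pos_pos zero_less_one mult_pos_pos zero_less_numeral)
    moreover have "mdeg (gens_lead L) = lookup L 0 + (p\<^sup>2 * lookup L 1 + (p\<^sup>2 + 2 * p) * lookup L 2 + (p ^ 3 + 1) * lookup L 3)
        + p ^ 4 * lookup L 4"
      by (simp add: mdeg_def gens_lead_def lead_gen_monom_def tup_def lookup_add lookup_single)
    ultimately have "tup L \<in> {..?N} \<times> {..?N} \<times> {..?N} \<times> {..?N} \<times> {..?N}"
      unfolding tup_def mem_Times_iff fst_conv snd_conv atMost_iff by linarith
    moreover have "L = of_tup (tup L)" by (rule supp5_eq_iff[OF L]) simp_all
    ultimately show "L \<in> of_tup ` ({..?N} \<times> {..?N} \<times> {..?N} \<times> {..?N} \<times> {..?N})"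
      by (intro image_eqI[of L of_tup "tup L"])
  qed
  then show ?thesis by (rule finite_subset) simp
qed

lemma lt5_induct:
  assumes "supp5 K" "\<And>K. supp5 K \<Longrightarrow> (\<And>L. supp5 L \<Longrightarrow> lt5 L K \<Longrightarrow> P L) \<Longrightarrow> P K"
  shows "P K"
  using assms(1)
proof (induction "card {L. supp5 L \<and> lt5 L K}" arbitrary: K rule: less_induct)
  case less
  show ?case
  proof (rule assms(2)[OF less.prems])
    fix L assume L: "supp5 L" "lt5 L K"
    then have "{M. supp5 M \<and> lt5 M L} \<subset> {M. supp5 M \<and> lt5 M K}"
      using ord5.trans ord5.irrefl by blast
    then show "P L" using L(1) by (intro less.hyps psubset_card_mono finite_lt5)
  qed
qed

subsection \<open>Subduction\<close>

lemma lead_mon_inv: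
  assumes "f \<in> invariants p M" "f \<noteq> 0"
  obtains i where "i \<in> reduced_exps" "lead_mon f = lead_gen_monom i"
proof -
  have "f \<in> mp.span (gen_monom ` reduced_exps)" using assms(1) by (simp add: invariants_eq_red_span red_span_def)
  then obtain I c where I: "finite I" "I \<subseteq> reduced_exps" "\<And>i. i \<in> I \<Longrightarrow> c i \<noteq> 0" "f = (\<Sum>i\<in>I. Const (c i) * gen_monom i)"
    by (rule span_image_finite_sum) blast
  have "I \<noteq> {}" using I(4) assms(2) by auto
  from grevlex.is_lead_sum[where b = gen_monom and c = c, OF I(1) this inj_on_subset[OF inj_lead_gen_monom I(2)] lead_gen_monom I(3)]
  obtain i where "i \<in> I" "is_lead grevlex_less f (lead_gen_monom i)" unfolding I(4) by blast
  then show ?thesis using that lead_mon_eqI I(2) by blast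
qed

lemma ex_subducts: "f \<in> invariants p M \<Longrightarrow> \<exists>P. subducts bs f P"
proof (induction "lead_mon f" arbitrary: f rule: wfp_induct_rule[OF wfp_grevlex_less])
  case (1 f)
  show ?case
  proof (cases "f = 0")
    case True
    then show ?thesis using subducts.zero by blast
  next
    case False
    obtain i where i: "i \<in> reduced_exps" "lead_mon f = lead_gen_monom i" by (rule lead_mon_inv[OF 1(2) False])
    define K where "K = of_tup i"
    have E: "gens_lead K = lead_mon f" by (simp add: gens_lead_def K_def i(2))
    define d where "d = lookup f (lead_mon f) / lookup (gens_pow bs K) (lead_mon f)"
    have nz: "lookup f (lead_mon f) \<noteq> 0" "lookup (gens_pow bs K) (lead_mon f) \<noteq> 0"
      using is_lead_lead_mon[OF False] lead_gens_pow[of K] by (simp_all add: is_lead_def in_keys_iff E)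
    then have "d \<noteq> 0" by (simp add: d_def)
    then have lm: "lead_mon (Const d * gens_pow bs K) = lead_mon f" by (simp add: lead_mon_gens_pow E)
    have "d * lookup (gens_pow bs K) (lead_mon f) = lookup f (lead_mon f)" using nz by (simp add: d_def)
    then have lt: "lead_term f = lead_term (Const d * gens_pow bs K)"
      unfolding lead_term_def lm lookup_Const_mult by simp
    let ?f' = "f - Const d * gens_pow bs K"
    have inv: "?f' \<in> invariants p M"
      unfolding gens_pow_eq by (intro subalgebraD[OF subalgebra_invariants] 1(2) gen_monom_in_inv)
    have "\<exists>P. subducts bs ?f' P"
    proof (cases "?f' = 0")
      case True
      then show ?thesis using subducts.zero by (intro exI[of _ 0]) simp
    next
      case f': False
      show ?thesis using lead_mon_diff_less[OF lt False f'] inv by (rule 1(1))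
    qed
    then obtain P where "subducts bs ?f' P" by blast
    then have "subducts bs f (Const d * Mon K + P)"
      using False lt by (intro subducts.step) (simp_all add: length_bs K_def)
    then show ?thesis by blast
  qed
qed

lemma subst_Mon: "supp5 K \<Longrightarrow> subst ((!) bs) (Mon K) = gens_pow bs K"
proof -
  assume "supp5 K"
  then have "(\<Prod>i\<in>keys K. bs ! i ^ lookup K i) = (\<Prod>i<5. bs ! i ^ lookup K i)"
    by (intro prod.mono_neutral_left) (auto simp: in_keys_iff)
  then show ?thesis by (simp add: Mon_def subst_single gens_pow_def length_bs)
qed

text \<open>The bound on the monomials of \<open>P\<close> is what later identifies the lead
  monomial of a relation: no subtracted product lies above the lead monomial of
  \<open>f\<close>.\<close>

lemma subductsD:
  assumes "subducts bs f P"
  shows "P \<in> polyring 5 \<and> subst ((!) bs) P = f \<and>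
    (\<forall>K\<in>keys P. f \<noteq> 0 \<and> (gens_lead K = lead_mon f \<or> grevlex_less (gens_lead K) (lead_mon f)))"
  using assms
proof induction
  case zero
  then show ?case by (simp add: polyring_closed)
next
  case (step f K d P)
  have K: "supp5 K" using step.hyps(2) by (simp add: length_bs)
  \<comment> \<open>The inductive rule does not itself exclude d = 0, but then the right-hand lead
    term would be zero.\<close>
  have "d \<noteq> 0"
  proof
    assume "d = 0"
    then have "lead_term f = 0" using step.hyps(3) by (simp add: lead_term_def)
    then have "lookup (lead_term f) (lead_mon f) = 0" by simp
    then show False using is_lead_lead_mon[OF step.hyps(1)] by (simp add: lead_term_def is_lead_def in_keys_iff)
  qed
  have lm: "lead_mon f = gens_lead K"
  proof -
    have "lookup f (lead_mon f) \<noteq> 0" using is_lead_lead_mon[OF step.hyps(1)] by (simp add: is_lead_def in_keys_iff)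
    then have "keys (lead_term f) = {lead_mon f}" by (simp add: lead_term_def)
    moreover have "keys (lead_term (Const d * gens_pow bs K)) \<subseteq> {gens_lead K}"
      by (simp add: lead_term_def lead_mon_gens_pow[OF \<open>d \<noteq> 0\<close>])
    ultimately show ?thesis using step.hyps(3) by auto
  qed
  let ?f' = "f - Const d * gens_pow bs K"
  have IH: "P \<in> polyring 5" "subst ((!) bs) P = ?f'"
    "\<And>K'. K' \<in> keys P \<Longrightarrow> ?f' \<noteq> 0 \<and> (gens_lead K' = lead_mon ?f' \<or> grevlex_less (gens_lead K') (lead_mon ?f'))"
    using step.IH by blast+
  have "gens_lead K' = lead_mon f \<or> grevlex_less (gens_lead K') (lead_mon f)" if "K' \<in> keys (Const d * Mon K + P)" for K'
  proof -
    from in_keys_addD[OF that] consider "K' = K" | "K' \<in> keys P"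
      by (auto simp: Const_mult_Mon split: if_splits)
    then show ?thesis
    proof cases
      case 1
      then show ?thesis by (simp add: lm)
    next
      case 2
      then have "grevlex_less (lead_mon ?f') (lead_mon f)"
        using lead_mon_diff_less[OF step.hyps(3,1)] IH(3) by blast
      then show ?thesis using IH(3)[OF 2] grevlex.trans by metis
    qed
  qed
  moreover have "Const d * Mon K + P \<in> polyring 5" by (intro polyring_closed K IH)
  moreover have "subst ((!) bs) (Const d * Mon K + P) = f" by (simp add: subst_hom subst_Mon K IH)
  ultimately show ?case using step.hyps(1) by blast
qed

text \<open>The lead terms of the two products cancel, so every monomial of \<open>P\<close> has a
  strictly smaller image. Only \<open>I\<close> and \<open>J\<close> compete, and the tie-break
  decides for \<open>I\<close>.\<close>

lemma tete_relation_props: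
  assumes "tete_relation bs I J r" "lt5 J I"
  shows "r \<in> polyring 5" "subst ((!) bs) r = 0" "is_lead lt5 r I" "lookup r I = 1"
proof -
  obtain c P where IJ: "supp5 I" "supp5 J" and lt: "lead_term (gens_pow bs I) = lead_term (Const c * gens_pow bs J)"
    and P: "subducts bs (gens_pow bs I - Const c * gens_pow bs J) P" and r: "r = Mon I - Const c * Mon J - P"
    using assms(1) by (auto simp: tete_relation_def tete_a_tete_def length_bs)
  note P' = subductsD[OF P]
  show "r \<in> polyring 5" unfolding r using P' IJ by (intro polyring_closed) auto
  show "subst ((!) bs) r = 0" unfolding r using P' IJ by (simp add: subst_hom subst_Mon)
  have P_lt: "lt5 K I" if "K \<in> keys P" for K
  proof -
    have "gens_pow bs I - Const c * gens_pow bs J \<noteq> 0" using P' that by blast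
    then have "grevlex_less (lead_mon (gens_pow bs I - Const c * gens_pow bs J)) (gens_lead I)"
      using lead_mon_diff_less[OF lt gens_pow_nz] lead_mon_gens_pow[of 1 I] by simp
    then have "grevlex_less (gens_lead K) (gens_lead I)" using P' that grevlex.trans by metis
    then show ?thesis by (simp add: lt5_def)
  qed
  have "I \<noteq> J" using assms(2) ord5.irrefl by auto
  moreover have "lookup P I = 0" using P_lt ord5.irrefl by (auto simp: in_keys_iff)
  ultimately show 1: "lookup r I = 1" by (simp add: r lookup_minus Mon_def lookup_single)
  have "K = I \<or> lt5 K I" if "K \<in> keys r" for K
  proof (rule ccontr)
    assume n: "\<not> (K = I \<or> lt5 K I)"
    then have "K \<noteq> J" "lookup P K = 0" using assms(2) P_lt by (auto simp: in_keys_iff)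
    then show False using that n by (simp add: r in_keys_iff lookup_minus Mon_def lookup_single)
  qed
  then show "is_lead lt5 r I" using 1 by (simp add: is_lead_def in_keys_iff)
qed

lemma ex_tete_relation:
  assumes "supp5 I" "supp5 J" "gens_lead I = gens_lead J"
  shows "\<exists>r. tete_relation bs I J r"
proof -
  have lm: "lead_mon (gens_pow bs K) = gens_lead K" for K using lead_mon_gens_pow[of 1 K] by simp
  define c where "c = lookup (gens_pow bs I) (gens_lead I) / lookup (gens_pow bs J) (gens_lead J)"
  have nz: "lookup (gens_pow bs K) (gens_lead K) \<noteq> 0" for K
    using lead_gens_pow[of K] by (simp add: is_lead_def in_keys_iff)
  then have "c \<noteq> 0" by (simp add: c_def)
  have lt: "lead_term (gens_pow bs I) = lead_term (Const c * gens_pow bs J)"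
    unfolding lead_term_def lead_mon_gens_pow[OF \<open>c \<noteq> 0\<close>] lm using nz[of J] by (simp add: c_def assms(3))
  have "gens_pow bs I - Const c * gens_pow bs J \<in> invariants p M"
    unfolding gens_pow_eq by (intro subalgebraD[OF subalgebra_invariants] gen_monom_in_inv)
  then obtain P where "subducts bs (gens_pow bs I - Const c * gens_pow bs J) P" using ex_subducts by blast
  then show ?thesis
    unfolding tete_relation_def tete_a_tete_def using assms lt by (auto simp: length_bs lm)
qed

subsection \<open>Division with remainder\<close>

definition reducible :: "(nat \<Rightarrow>\<^sub>0 nat) list \<Rightarrow> (nat \<Rightarrow>\<^sub>0 nat) \<Rightarrow> bool" where
  "reducible Ls K \<longleftrightarrow> (\<exists>i<length Ls. \<exists>K'. K = K' + Ls ! i)"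

text \<open>Induction along \<open>lt5\<close>, whose initial segments are finite: a reducible
  monomial is a multiple of some \<open>rs ! i\<close> plus smaller monomials. The list is arbitrary
  because the kernel requires division by both relations and regularity by the first alone.\<close>

lemma division:
  assumes rs: "\<And>i. i < length rs \<Longrightarrow> rs ! i \<in> polyring 5 \<and> is_lead lt5 (rs ! i) (Ls ! i) \<and> lookup (rs ! i) (Ls ! i) = 1"
    and len: "length Ls = length rs" and f: "f \<in> polyring 5"
  obtains g where "g \<in> polyring 5" "f - g \<in> ideal_gen (polyring 5) rs" "\<And>K. K \<in> keys g \<Longrightarrow> \<not> reducible Ls K"
proof -
  define Red where "Red = {f. \<exists>g\<in>polyring 5. f - g \<in> ideal_gen (polyring 5) rs \<and> (\<forall>K\<in>keys g. \<not> reducible Ls K)}"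
  have Red_0: "0 \<in> Red"
    unfolding Red_def using ideal_gen_closed(1) by (auto intro!: bexI[of _ 0] polyring_closed)
  have Red_add: "f1 + f2 \<in> Red" if "f1 \<in> Red" "f2 \<in> Red" for f1 f2
  proof -
    from that obtain g1 g2 where g: "g1 \<in> polyring 5" "f1 - g1 \<in> ideal_gen (polyring 5) rs" "\<forall>K\<in>keys g1. \<not> reducible Ls K"
      "g2 \<in> polyring 5" "f2 - g2 \<in> ideal_gen (polyring 5) rs" "\<forall>K\<in>keys g2. \<not> reducible Ls K" unfolding Red_def by blast
    have "f1 + f2 - (g1 + g2) \<in> ideal_gen (polyring 5) rs"
      using ideal_gen_closed(2)[OF g(2,5)] by (simp add: algebra_simps)
    then show ?thesis
      unfolding Red_def using g by (auto intro!: bexI[of _ "g1 + g2"] polyring_closed dest: in_keys_addD)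
  qed
  have Red_scale: "Const c * f1 \<in> Red" if "f1 \<in> Red" for c f1
  proof -
    from that obtain g1 where g: "g1 \<in> polyring 5" "f1 - g1 \<in> ideal_gen (polyring 5) rs" "\<forall>K\<in>keys g1. \<not> reducible Ls K"
      unfolding Red_def by blast
    have kc: "keys (Const c * g1) \<subseteq> keys g1" by (auto simp: in_keys_iff)
    have "Const c * f1 - Const c * g1 \<in> ideal_gen (polyring 5) rs"
      using ideal_gen_closed(3)[OF g(2) polyring_closed(5)[of c]] by (simp add: algebra_simps)
    then show ?thesis
      unfolding Red_def using g kc by (blast intro: polyring_closed)
  qed
  have Red_sum: "f1 \<in> Red" if "\<And>K. K \<in> keys f1 \<Longrightarrow> Mon K \<in> Red" for f1
  proof -
    have sum: "(\<Sum>K\<in>S. Const (lookup f1 K) * Mon K) \<in> Red" if "finite S" "\<And>K. K \<in> S \<Longrightarrow> Mon K \<in> Red" for S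
      using that by (induction S) (simp_all add: Red_0 Red_add Red_scale)
    show ?thesis using sum[of "keys f1"] that by (simp flip: mpoly_sum_Mon)
  qed
  have Red_ideal: "f1 + f2 \<in> Red" if "f1 \<in> ideal_gen (polyring 5) rs" "f2 \<in> Red" for f1 f2
  proof -
    from that obtain g where g: "g \<in> polyring 5" "f2 - g \<in> ideal_gen (polyring 5) rs" "\<forall>K\<in>keys g. \<not> reducible Ls K"
      unfolding Red_def by blast
    have "f1 + f2 - g \<in> ideal_gen (polyring 5) rs" using ideal_gen_closed(2)[OF that(1) g(2)] by (simp add: algebra_simps)
    then show ?thesis unfolding Red_def using g by blast
  qed
  have Mon: "Mon K \<in> Red" if "supp5 K" for K
    using that
  proof (rule lt5_induct)
    fix K assume K: "supp5 K" and IH: "\<And>L. supp5 L \<Longrightarrow> lt5 L K \<Longrightarrow> Mon L \<in> Red"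
    show "Mon K \<in> Red"
    proof (cases "reducible Ls K")
      case False
      then show ?thesis
        unfolding Red_def using ideal_gen_closed(1) K by (auto intro!: bexI[of _ "Mon K"] polyring_closed)
    next
      case True
      then obtain i K' where i: "i < length rs" and K': "K = K' + Ls ! i" by (auto simp: reducible_def len)
      let ?r = "rs ! i"
      have r: "?r \<in> polyring 5" "is_lead lt5 ?r (Ls ! i)" "lookup ?r (Ls ! i) = 1" using rs[OF i] by auto
      have "supp5 K'"
      proof
        fix j assume "j \<in> keys K'"
        then have "j \<in> keys K" by (simp add: K' in_keys_iff lookup_add)
        then show "j \<in> {..<5}" using K by blast
      qed
      then have 1: "Mon K' * ?r \<in> ideal_gen (polyring 5) rs"
        by (intro ideal_gen_closed i polyring_closed)
      let ?t = "Mon K' * (Mon (Ls ! i) - ?r)"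
      have "supp5 (Ls ! i)" using r(1,2) by (auto simp: polyring_def is_lead_def)
      then have t: "?t \<in> polyring 5" using \<open>supp5 K'\<close> r(1) by (intro polyring_closed)
      have "?t \<in> Red"
      proof (rule Red_sum)
        fix L assume L: "L \<in> keys ?t"
        have "supp5 L" using L t by (auto simp: polyring_def)
        obtain L' where L': "L = K' + L'" "L' \<in> keys (Mon (Ls ! i) - ?r)"
          using L by (rule in_keys_multE) auto
        then have "L' \<noteq> Ls ! i" using r(3) by (auto simp: in_keys_iff lookup_minus Mon_def)
        then have "L' \<in> keys ?r" using L'(2) by (simp add: in_keys_iff lookup_minus Mon_def lookup_single)
        then have "lt5 L' (Ls ! i)" using r(2) \<open>L' \<noteq> Ls ! i\<close> by (auto simp: is_lead_def)
        then have "lt5 L K" by (simp add: L' K' ord5.add_left)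
        then show "Mon L \<in> Red" using IH \<open>supp5 L\<close> by blast
      qed
      then have "Mon K' * ?r + ?t \<in> Red" by (rule Red_ideal[OF 1])
      moreover have "Mon K' * ?r + ?t = Mon K" unfolding K' Mon_add right_diff_distrib by simp
      ultimately show ?thesis by (simp only:)
    qed
  qed
  have "f \<in> Red"
  proof (rule Red_sum)
    fix K assume "K \<in> keys f"
    then show "Mon K \<in> Red" using f by (intro Mon) (simp add: polyring_def)
  qed
  then obtain g where "g \<in> polyring 5" "f - g \<in> ideal_gen (polyring 5) rs" "\<forall>K\<in>keys g. \<not> reducible Ls K"
    unfolding Red_def by blast
  then show ?thesis by (intro that[of g]) blast+
qed

subsection \<open>The presentation\<close>

abbreviation "I1 \<equiv> Poly_Mapping.single (2 :: nat) p"
abbreviation "J1 \<equiv> Poly_Mapping.single (1 :: nat) (p + 2)"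
abbreviation "I2 \<equiv> Poly_Mapping.single (3 :: nat) p"
abbreviation "J2 \<equiv> Poly_Mapping.single (1 :: nat) ((p\<^sup>2 - 2 * p - 1) div 2) + Poly_Mapping.single 2 ((p\<^sup>2 + 1) div 2)"

lemma tete_exponents:
  "gens_lead I1 = gens_lead J1" "gens_lead I2 = gens_lead J2" "lt5 J1 I1" "lt5 J2 I2"
  "supp5 I1" "supp5 J1" "supp5 I2" "supp5 J2"
proof -
  obtain k where k: "p = 2 * k + 3" by (rule p_odd_form)
  define e where "e = (p\<^sup>2 - 2 * p - 1) div 2"
  define e' where "e' = (p\<^sup>2 + 1) div 2"
  have "p\<^sup>2 - 2 * p - 1 = 2 * (2 * k\<^sup>2 + 4 * k + 1)" "p\<^sup>2 + 1 = 2 * (2 * k\<^sup>2 + 6 * k + 5)"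
    unfolding k by (simp_all add: power2_eq_square algebra_simps)
  then have e: "e = 2 * k\<^sup>2 + 4 * k + 1" "e' = 2 * k\<^sup>2 + 6 * k + 5" by (simp_all add: e_def e'_def)
  show E1: "gens_lead I1 = gens_lead J1"
    by (simp add: gens_lead_def lead_gen_monom_def tup_def xyz_mon_eq_iff lookup_add lookup_single power2_eq_square algebra_simps)
  have "(p ^ 3 + 1) * p = p\<^sup>2 * e + (p\<^sup>2 + 2 * p) * e'"
    unfolding e k by (simp add: power2_eq_square power3_eq_cube algebra_simps)
  then show E2: "gens_lead I2 = gens_lead J2"
    unfolding e_def[symmetric] e'_def[symmetric]
    by (simp add: gens_lead_def lead_gen_monom_def tup_def xyz_mon_eq_iff lookup_add lookup_single)
  \<comment> \<open>The order on exponents looks at the smallest variable where they differ. This is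
    variable 1, absent from \<open>I1\<close>; being smaller there makes \<open>I1\<close> larger
    for \<open>lt5\<close>.\<close>
  have "I1 < J1"
    unfolding less_poly_mapping.rep_eq
    by (rule less_funI, rule exI[of _ 1]) (simp add: lookup_single)
  then show "lt5 J1 I1" by (simp add: lt5_def E1)
  \<comment> \<open>The exponent \<open>e\<close> of variable 1 is positive even for p = 3, where it
    equals 1.\<close>
  have "I2 < J2"
    unfolding less_poly_mapping.rep_eq e_def[symmetric]
    by (rule less_funI, rule exI[of _ 1]) (simp add: lookup_single lookup_add e)
  then show "lt5 J2 I2" by (simp add: lt5_def E2)
  show "supp5 I1" "supp5 J1" "supp5 I2" by (simp_all split: if_splits)
  show "supp5 J2" by (auto dest!: in_keys_addD split: if_splits)
qed

lemma subst_polyring_in_inv: "f \<in> polyring 5 \<Longrightarrow> subst ((!) bs) f \<in> invariants p M"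
proof -
  assume f: "f \<in> polyring 5"
  have "subst ((!) bs) f = (\<Sum>K\<in>keys f. Const (lookup f K) * gens_pow bs K)"
    by (subst mpoly_sum_Mon) (use f in \<open>simp add: subst_sum subst_mult subst_Mon polyring_def\<close>)
  then show ?thesis
    by (simp only: gens_pow_eq) (intro subalgebra_sum subalgebraD(5)[OF subalgebra_invariants] subalgebra_invariants
      subalgebraD(1)[OF subalgebra_invariants] gen_monom_in_inv)
qed

lemma ci_presentation_inv:
  assumes r1: "tete_relation bs I1 J1 r1" and r2: "tete_relation bs I2 J2 r2"
  shows "ci_presentation (invariants p M) bs [r1, r2]"
proof -
  note r1 = tete_relation_props[OF r1 tete_exponents(3)]
  note r2 = tete_relation_props[OF r2 tete_exponents(4)]
  have irr: "lookup K 2 < p" if "\<not> reducible [I1] K" for K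
  proof (rule ccontr)
    assume "\<not> lookup K 2 < p"
    then have "K = (K - I1) + I1"
      by (intro poly_mapping_eqI) (simp add: lookup_add lookup_minus lookup_single when_def)
    then show False using that unfolding reducible_def by force
  qed
  have irr2: "lookup K 2 < p \<and> lookup K 3 < p" if "\<not> reducible [I1, I2] K" for K
  proof -
    have "K = (K - I2) + I2" if "\<not> lookup K 3 < p"
      using that by (intro poly_mapping_eqI) (simp add: lookup_add lookup_minus lookup_single when_def)
    then have "lookup K 3 < p" using that unfolding reducible_def by force
    moreover have "\<not> reducible [I1] K" using that by (force simp: reducible_def)
    ultimately show ?thesis using irr by blast
  qed
  have R: "rs ! i \<in> polyring 5 \<and> is_lead lt5 (rs ! i) (Ls ! i) \<and> lookup (rs ! i) (Ls ! i) = 1"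
    if "i < length rs" "rs = [r1] \<and> Ls = [I1] \<or> rs = [r1, r2] \<and> Ls = [I1, I2]" for i rs Ls
    using that r1 r2 by (auto simp: less_Suc_eq)
  have ideal_ker: "subst ((!) bs) f = 0" "f \<in> polyring 5" if "f \<in> ideal_gen (polyring 5) [r1, r2]" for f
  proof -
    from that obtain c where "f = (\<Sum>i<length [r1, r2]. c i * [r1, r2] ! i)" "\<forall>i<length [r1, r2]. c i \<in> polyring 5"
      unfolding ideal_gen_def by blast
    then have "f = c 0 * r1 + c 1 * r2" "c 0 \<in> polyring 5" "c 1 \<in> polyring 5" by (simp_all add: lessThan_Suc)
    then show "subst ((!) bs) f = 0" "f \<in> polyring 5" using r1 r2 by (simp_all add: subst_hom polyring_closed)
  qed
  have img: "subst ((!) bs) ` polyring 5 = invariants p M"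
  proof
    show "subst ((!) bs) ` polyring 5 \<subseteq> invariants p M" using subst_polyring_in_inv by blast
    show "invariants p M \<subseteq> subst ((!) bs) ` polyring 5"
    proof
      fix f assume "f \<in> invariants p M"
      then obtain P where "subducts bs f P" using ex_subducts by blast
      then show "f \<in> subst ((!) bs) ` polyring 5" using subductsD by blast
    qed
  qed
  have ker: "{f \<in> polyring 5. subst ((!) bs) f = 0} = ideal_gen (polyring 5) [r1, r2]"
  proof
    show "ideal_gen (polyring 5) [r1, r2] \<subseteq> {f \<in> polyring 5. subst ((!) bs) f = 0}" using ideal_ker by blast
    show "{f \<in> polyring 5. subst ((!) bs) f = 0} \<subseteq> ideal_gen (polyring 5) [r1, r2]"
    proof
      fix f assume "f \<in> {f \<in> polyring 5. subst ((!) bs) f = 0}"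
      then have f: "f \<in> polyring 5" "subst ((!) bs) f = 0" by auto
      obtain g where g: "g \<in> polyring 5" "f - g \<in> ideal_gen (polyring 5) [r1, r2]" "\<And>K. K \<in> keys g \<Longrightarrow> \<not> reducible [I1, I2] K"
        by (rule division[of "[r1, r2]" "[I1, I2]" f]) (use R f in auto)
      have "subst ((!) bs) g = 0" using ideal_ker(1)[OF g(2)] f(2) by (simp add: subst_hom)
      \<comment> \<open>The monomials of \<open>g\<close> are reduced, so their images have distinct
        lead monomials and are linearly independent.\<close>
      have "g = 0"
      proof (rule ccontr)
        assume "g \<noteq> 0"
        then have ne: "keys g \<noteq> {}" by simp
        have supp: "supp5 K" if "K \<in> keys g" for K using g(1) that by (auto simp: polyring_def)
        have inj: "inj_on gens_lead (keys g)"
        proof (rule inj_onI)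
          fix K L assume KL: "K \<in> keys g" "L \<in> keys g" "gens_lead K = gens_lead L"
          then have "tup K \<in> reduced_exps" "tup L \<in> reduced_exps" using irr2 g(3) by (auto simp: reduced_exps_def tup_def)
          then have "tup K = tup L" using KL(3) inj_lead_gen_monom by (auto simp: gens_lead_def dest: inj_onD)
          then show "K = L" using supp KL supp5_eq_iff by blast
        qed
        have "lookup g K \<noteq> 0" if "K \<in> keys g" for K using that by (simp add: in_keys_iff)
        from grevlex.is_lead_sum[where b = "gens_pow bs" and c = "lookup g", OF finite_keys ne inj lead_gens_pow this]
        obtain K where "is_lead grevlex_less (\<Sum>K\<in>keys g. Const (lookup g K) * gens_pow bs K) (gens_lead K)" by blast
        then have "(\<Sum>K\<in>keys g. Const (lookup g K) * gens_pow bs K) \<noteq> 0" by (auto simp: is_lead_def)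
        moreover have "subst ((!) bs) g = (\<Sum>K\<in>keys g. Const (lookup g K) * gens_pow bs K)"
          by (subst mpoly_sum_Mon) (use supp in \<open>simp add: subst_sum subst_mult subst_Mon\<close>)
        ultimately show False using \<open>subst ((!) bs) g = 0\<close> by simp
      qed
      then show "f \<in> ideal_gen (polyring 5) [r1, r2]" using g(2) by simp
    qed
  qed
  have id0: "ideal_gen (polyring 5) [] = {0 :: (nat, 'a) mpoly}" by (auto simp: ideal_gen_def)
  have reg: "regular_seq (polyring 5) [r1, r2]"
    unfolding regular_seq_def
  proof (intro conjI allI ballI impI)
    show "set [r1, r2] \<subseteq> polyring 5" using r1 r2 by simp
    show "1 \<notin> ideal_gen (polyring 5) [r1, r2]" using ideal_ker(1)[of 1] by auto
    fix i f assume i: "i < length [r1, r2]" and f: "f \<in> polyring 5"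
      and fr: "f * [r1, r2] ! i \<in> ideal_gen (polyring 5) (take i [r1, r2])"
    consider "i = 0" | "i = 1" using i by (auto simp: less_Suc_eq)
    then show "f \<in> ideal_gen (polyring 5) (take i [r1, r2])"
    proof cases
      case 1
      have "r1 \<noteq> 0" using r1(4) by auto
      then show ?thesis using fr 1 by (simp add: id0)
    next
      case 2
      obtain g where g: "g \<in> polyring 5" "f - g \<in> ideal_gen (polyring 5) [r1]" "\<And>K. K \<in> keys g \<Longrightarrow> \<not> reducible [I1] K"
        by (rule division[of "[r1]" "[I1]" f]) (use r1 f in auto)
      have "f * r2 - r2 * (f - g) \<in> ideal_gen (polyring 5) [r1]"
        using fr 2 ideal_gen_diff[OF _ ideal_gen_closed(3)[OF g(2) r2(1)]] by simp
      then have "g * r2 \<in> ideal_gen (polyring 5) [r1]" by (simp add: algebra_simps)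
      then obtain c where c: "g * r2 = c * r1" unfolding ideal_gen_def by auto
      \<comment> \<open>\<open>I1\<close> and \<open>I2\<close> involve different variables: equal
        lead monomials of the two products would force variable 2 to occur in the lead monomial of
        \<open>g\<close> with exponent at least p, although \<open>g\<close> is reduced modulo
        \<open>r1\<close>.\<close>
      have "g = 0"
      proof (rule ccontr)
        assume "g \<noteq> 0"
        then obtain K where K: "is_lead lt5 g K" using ord5.ex_is_lead by blast
        have "r2 \<noteq> 0" using r2(4) by auto
        then have "c \<noteq> 0" using c \<open>g \<noteq> 0\<close> by auto
        then obtain L where L: "is_lead lt5 c L" using ord5.ex_is_lead by blast
        have "K + I2 = L + I1"
          using ord5.is_lead_mult(1)[OF K r2(3)] ord5.is_lead_mult(1)[OF L r1(3)] ord5.is_lead_unique unfolding c by blast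
        then have "lookup (K + I2) 2 = lookup (L + I1) 2" by simp
        then have "p \<le> lookup K 2" by (simp add: lookup_add lookup_single)
        moreover have "lookup K 2 < p" using K g(3) irr by (auto simp: is_lead_def)
        ultimately show False by simp
      qed
      then show ?thesis using g(2) 2 by simp
    qed
  qed
  show ?thesis unfolding ci_presentation_def length_bs using img ker reg by blast
qed

text \<open>Products of lead monomials are again lead monomials of invariants, so their span is
  already an algebra. Conversely \<open>lead_mon_inv\<close> factors each of them into the five lead
  monomials.\<close>

lemma sagbi_inv: "sagbi_basis (invariants p M) (set bs)"
  unfolding sagbi_basis_def
proof (intro conjI)
  show "finite (set bs)" by simp
  show sub: "set bs \<subseteq> invariants p M"
    by (simp add: bs_def X_inv F1_inv H2_inv H3_inv orbit_norm_inv)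
  let ?LB = "LMs (set bs)" and ?LA = "LMs (invariants p M)"
  show "subalgebra hull ?LB = mp.span ?LA"
  proof
    have "subalgebra (mp.span ?LA)"
    proof (rule subalgebra_span)
      have "lead_mon (1 :: 'a xpoly) = 0" by (rule lead_mon_eqI[OF grevlex.is_lead_1])
      then show "1 \<in> ?LA"
        using subalgebraD(2)[OF subalgebra_invariants] by (auto simp: LMs_def intro!: exI[of _ 1])
      fix s t assume "s \<in> ?LA" "t \<in> ?LA"
      then obtain f g where fg: "f \<in> invariants p M" "f \<noteq> 0" "g \<in> invariants p M" "g \<noteq> 0"
        "s = Mon (lead_mon f)" "t = Mon (lead_mon g)" by (auto simp: LMs_def)
      then have "s * t = Mon (lead_mon (f * g))" by (simp add: lead_mon_mult Mon_add)
      moreover have "f * g \<in> invariants p M" by (intro subalgebraD[OF subalgebra_invariants] fg)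
      ultimately show "s * t \<in> ?LA" using fg by (auto simp: LMs_def intro!: exI[of _ "f * g"])
    qed
    moreover have "?LB \<subseteq> mp.span ?LA" using sub by (intro subsetI mp.span_base) (auto simp: LMs_def)
    ultimately show "subalgebra hull ?LB \<subseteq> mp.span ?LA" by (intro hull_minimal)
    show "mp.span ?LA \<subseteq> subalgebra hull ?LB"
    proof (rule span_subset_subalgebra[OF subalgebra_hull])
      show "?LA \<subseteq> subalgebra hull ?LB"
      proof
        fix s assume "s \<in> ?LA"
        then obtain f where f: "f \<in> invariants p M" "f \<noteq> 0" "s = Mon (lead_mon f)" by (auto simp: LMs_def)
        obtain i where i: "i \<in> reduced_exps" "lead_mon f = lead_gen_monom i" by (rule lead_mon_inv[OF f(1,2)])
        obtain e a b c d where i_eq: "i = (e, a, b, c, d)" by (cases i)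
        have gen: "Mon m \<in> subalgebra hull ?LB" if "g \<in> set bs" "is_lead grevlex_less g m" for g m
        proof -
          have "g \<noteq> 0" using that(2) by (auto simp: is_lead_def)
          moreover have "Mon m = Mon (lead_mon g)" by (simp add: lead_mon_eqI[OF that(2)])
          ultimately have "Mon m \<in> ?LB" unfolding LMs_def using that(1) by blast
          then show ?thesis using hull_subset[of ?LB subalgebra] by blast
        qed
        have pow: "Mon m ^ n = (Mon (\<Sum>i<n. m) :: 'a xpoly)" for m n
          by (induction n) (simp_all add: Mon_add mult.commute)
        have "s = Mon (xyzm 1 0 0) ^ e * Mon (xyzm 0 (p\<^sup>2) 0) ^ a * Mon (xyzm 0 (p\<^sup>2 + 2 * p) 0) ^ b
          * Mon (xyzm 0 (p ^ 3 + 1) 0) ^ c * Mon (xyzm 0 0 (p ^ 4)) ^ d"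
          unfolding pow Mon_add[symmetric] f(3) i(2) i_eq lead_gen_monom_eq_sum ..
        also have "\<dots> \<in> subalgebra hull ?LB"
          by (intro subalgebraD(5,8)[OF subalgebra_hull] gen[OF _ lead_X] gen[OF _ lead_F1] gen[OF _ lead_H2]
            gen[OF _ lead_H3] gen[OF _ lead_NZ]) (simp_all add: bs_def)
        finally show "s \<in> subalgebra hull ?LB" .
      qed
    qed
  qed
qed

end

theorem theorem6p5:
  fixes p :: nat and M :: "'a::field^4^2"
  assumes "prime p" and "p > 2" and "CHAR('a) = p"
    and "minor p M 1 2 3 4 \<noteq> 0" and "minor p M 1 2 3 5 \<noteq> 0" and "minor p M 1 3 5 7 = 0"
  shows "sagbi_basis (invariants p M) {X, f1_hat p M, h2 p M, h3 p M, orbit_norm p M Z} \<and>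
    complete_intersection (invariants p M) \<and>
    (let bs = [X, f1_hat p M, h2 p M, h3 p M, orbit_norm p M Z];
         rel1 = tete_relation bs (Poly_Mapping.single 2 p) (Poly_Mapping.single 1 (p + 2));
         rel2 = tete_relation bs (Poly_Mapping.single 3 p)
           (Poly_Mapping.single 1 ((p\<^sup>2 - 2 * p - 1) div 2) + Poly_Mapping.single 2 ((p\<^sup>2 + 1) div 2))
     in (\<exists>r1. rel1 r1) \<and> (\<exists>r2. rel2 r2) \<and>
        (\<forall>r1 r2. rel1 r1 \<longrightarrow> rel2 r2 \<longrightarrow> ci_presentation (invariants p M) bs [r1, r2]))"
proof -
  interpret claim_matrix p M
    using assms by unfold_locales
  have r: "\<exists>r1. tete_relation bs I1 J1 r1" "\<exists>r2. tete_relation bs I2 J2 r2"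
    by (intro ex_tete_relation tete_exponents)+
  then have "complete_intersection (invariants p M)"
    unfolding complete_intersection_def using ci_presentation_inv by blast
  moreover have "set bs = {X, F1, H2, H3, NZ}" by (simp add: bs_def)
  ultimately show ?thesis
    using sagbi_inv r ci_presentation_inv unfolding Let_def bs_def[symmetric] by simp
qed

end
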